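(* Let $\Gamma$ be a countable group. Every factor of iid thinning of $\Gamma$ is a weak-* limit of unimodular random subsets of $\Gamma$ supported on finite subsets of $\Gamma$.
   Context: $\mathcal M(\Gamma)$ denotes the space of non-empty subsets of $\Gamma$ and $\mathcal M_o(\Gamma)$ the space of subsets containing the identity, with the product topology. The re-rooting equivalence relation on $\mathcal M_o(\Gamma)$ is $E\sim\gamma^{-1}E$ for $\gamma\in E$. A unimodular random subset is a probability measure on $\mathcal M_o(\Gamma)$ invariant under the re-rooting relation. For a measure preserving action $\Gamma\curvearrowright(Y,\nu)$ and a measurable $U\subset Y$ of finite positive measure, let $\iota_U(y)=\{\gamma\in\Gamma\mid\gamma^{-1}y\in U\}$ and $\mathcal F(Y,U):=\nu(U)^{-1}(\iota_U)_*(\nu|_U)$, a unimodular random subset. A thinning of a probability measure preserving action $(X,\mu)$ is a weak-* limit of $\mathcal F(X,U_n)$ with $\mu(U_n)\to0$. A factor of iid thinning is a thinning of the Bernoulli shift $([0,1]^\Gamma,\mathrm{Leb}^\Gamma)$. *)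

theory Defs
  imports "HOL-Probability.Probability"
begin

text \<open>The countable group Gamma is a type of class group_add (written additively:
  identity 0, product g + h, inverse -g; not assumed commutative) and countable.\<close>

text \<open>M(Gamma): subsets of Gamma with the product topology of 2^Gamma, i.e. the topology
  generated by the subbasic cylinders {E. g in E} and {E. g notin E}.\<close>
definition subsets_top :: "'g set topology" where
  "subsets_top = topology_generated_by (\<Union>g. {{E. g \<in> E}, {E. g \<notin> E}})"

definition Mo_space :: "'g::group_add set set" where
  "Mo_space = {E. 0 \<in> E}"

definition Mo_top :: "'g::group_add set topology" where
  "Mo_top = subtopology subsets_top Mo_space"

definition Mo_borel :: "'g::group_add set measure" where
  "Mo_borel = sigma Mo_space {U. openin Mo_top U}"

definition translate_set :: "'g::group_add \<Rightarrow> 'g set \<Rightarrow> 'g set" where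
  "translate_set g E = (\<lambda>x. - g + x) ` E"

definition rerooting :: "('g::group_add set \<times> 'g set) set" where
  "rerooting = {(E, translate_set g E) | E g. 0 \<in> E \<and> g \<in> E}"

definition rel_invariant :: "'a measure \<Rightarrow> ('a \<times> 'a) set \<Rightarrow> bool" where
  "rel_invariant \<mu> R \<longleftrightarrow>
     (\<forall>A \<phi>. A \<in> sets \<mu> \<and> \<phi> ` A \<in> sets \<mu> \<and> inj_on \<phi> A
        \<and> \<phi> \<in> measurable (restrict_space \<mu> A) \<mu>
        \<and> (\<forall>x\<in>A. (x, \<phi> x) \<in> R)
        \<longrightarrow> emeasure \<mu> (\<phi> ` A) = emeasure \<mu> A)"

definition random_rooted_subset :: "'g::group_add set measure \<Rightarrow> bool" where
  "random_rooted_subset \<mu> \<longleftrightarrow> prob_space \<mu> \<and> sets \<mu> = sets Mo_borel"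

definition unimodular :: "'g::group_add set measure \<Rightarrow> bool" where
  "unimodular \<mu> \<longleftrightarrow> random_rooted_subset \<mu> \<and> rel_invariant \<mu> rerooting"

definition weak_star_lim ::
    "(nat \<Rightarrow> 'g::group_add set measure) \<Rightarrow> 'g set measure \<Rightarrow> bool" where
  "weak_star_lim \<mu>s \<mu> \<longleftrightarrow>
     (\<forall>f. continuous_map Mo_top euclideanreal f \<and> bounded (f ` Mo_space)
        \<longrightarrow> (\<lambda>n. \<integral>E. f E \<partial>\<mu>s n) \<longlonglongrightarrow> (\<integral>E. f E \<partial>\<mu>))"

text \<open>The Bernoulli shift ([0,1]^Gamma, Leb^Gamma); Gamma acts by
  (g . x)(h) = x(g^{-1} h), so (g^{-1} . x)(h) = x(g h).\<close>
definition bernoulli :: "('g \<Rightarrow> real) measure" where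
  "bernoulli = PiM UNIV (\<lambda>_. restrict_space lborel {0..1::real})"

definition shift_inv :: "'g::group_add \<Rightarrow> ('g \<Rightarrow> real) \<Rightarrow> ('g \<Rightarrow> real)" where
  "shift_inv g x = (\<lambda>h. x (g + h))"

definition iota :: "('g::group_add \<Rightarrow> real) set \<Rightarrow> ('g \<Rightarrow> real) \<Rightarrow> 'g set" where
  "iota U x = {g. shift_inv g x \<in> U}"

definition F_bern :: "('g::group_add \<Rightarrow> real) set \<Rightarrow> 'g set measure" where
  "F_bern U = distr (restrict_space (uniform_measure bernoulli U) U) Mo_borel (iota U)"

definition fiid_thinning :: "'g::{group_add,countable} set measure \<Rightarrow> bool" where
  "fiid_thinning \<nu> \<longleftrightarrow> random_rooted_subset \<nu> \<and>
     (\<exists>U :: nat \<Rightarrow> ('g \<Rightarrow> real) set.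
        (\<forall>n. U n \<in> sets bernoulli \<and> emeasure bernoulli (U n) > 0)
        \<and> (\<lambda>n. measure bernoulli (U n)) \<longlonglongrightarrow> 0
        \<and> weak_star_lim (\<lambda>n. F_bern (U n)) \<nu>)"

end

theory Submission
  imports Defs
begin

text \<open>
  Write the coordinates of the Bernoulli shift in binary and approximate the small set \<open>U\<close> by a set
  that depends on finitely many bits. Reveal the bits in a uniformly random order. For each
  \<open>g\<close> in \<open>E = \<iota>\<^sub>U(x)\<close> the conditional probability of the event \<open>g\<^sup>-\<^sup>1 x \<in> U\<close>
  has to climb from the tiny value \<open>\<mu>(U)\<close> to 1, and since one bit can at most double it, the sum of
  the squares of its relative jumps is at least about \<open>log (1 / \<mu>(U))\<close>. On the other hand, for
  \<open>g\<close> and \<open>gs\<close> both in \<open>E\<close> the two vectors of relative jumps differ by \<open>O(1)\<close> in \<open>\<ell>\<^sup>2\<close>: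
  both are compared, through the Hellinger distance, with the jumps for the event that \<open>g\<close> and \<open>gs\<close>
  both lie in \<open>E\<close>, whose probability is bounded by \<open>\<mu>(U)\<close>. Normalising the squares thus gives, for
  each \<open>g \<in> E\<close>, a probability measure on bit positions which hardly changes from \<open>g\<close> to \<open>gs\<close>.
  The set of those \<open>g \<in> E\<close> which give weight at least \<open>t\<close> to a fixed position is finite, and re-rooting
  it at a uniform point yields a finite unimodular random subset which, for random \<open>t\<close>, looks
  like \<open>\<F>(X, U)\<close> on any given finite window as \<open>\<mu>(U) \<rightarrow> 0\<close>.
\<close>

section \<open>Doob martingales of sets of bits\<close>

text \<open>No structure of the group is at hand for cutting \<open>E\<close> into finite pieces.
  Bit positions serve as labels of pieces: when the event reads finitely many bits, a given position
  matters for finitely many \<open>g\<close> only. A fixed order of revelation would not be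
  compatible with shifts; a uniformly random one is invariant in law. The comparison of
  \<open>g\<close> with \<open>gs\<close> must not deteriorate when the joint event is rare. If it
  has probability \<open>W\<close> and each event has probability \<open>P\<close>, the Hellinger
  potential falls from \<open>sqrt (W * P)\<close> to \<open>W\<close>, so the squared differences
  integrate over the joint event to at most \<open>16 * (sqrt (W * P) - W) \<le> 8 * P\<close>
  whatever \<open>W\<close> is: a constant relative to \<open>P\<close>. The normalising sum of
  squares is below \<open>T\<close> with conditional probability at most \<open>exp T * P\<close>.
  Hence \<open>T\<close> is taken large first and \<open>P\<close> small afterwards. That the model
  has the right law is mass transport: summing over \<open>g\<close> the weights which the event at
  \<open>g\<close> puts over the identity is, after re-rooting at \<open>g\<close>, summing over all
  positions the weights of the event at the identity. These add up to 1 on that event unless all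
  increments vanish.\<close>

text \<open>A configuration of bits is the set of positions carrying a 1; \<open>avg R u x\<close> is the conditional
  expectation of \<open>u\<close> when the bits outside \<open>R\<close> are those of \<open>x\<close> and the bits in \<open>R\<close> are fair coins.\<close>

definition avg :: "'p set \<Rightarrow> ('p set \<Rightarrow> real) \<Rightarrow> 'p set \<Rightarrow> real" where
  "avg R u x = (\<Sum>T\<in>Pow R. u ((x - R) \<union> T)) / 2 ^ card R"

lemma avg_empty [simp]: "avg {} u x = u x"
  by (simp add: avg_def)

text \<open>The tower property for one more fair coin; it drives the inductions over the set of
  averaged bits.\<close>

lemma avg_insert:
  assumes "finite R" "p \<notin> R"
  shows "avg (insert p R) u x = (avg R u (x - {p}) + avg R u (insert p x)) / 2"
proof -
  have "(\<Sum>T\<in>Pow (insert p R). u ((x - insert p R) \<union> T))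
     = (\<Sum>T\<in>Pow R. u ((x - insert p R) \<union> T)) + (\<Sum>T\<in>insert p ` Pow R. u ((x - insert p R) \<union> T))"
    unfolding Pow_insert using assms by (intro sum.union_disjoint) auto
  also have "(\<Sum>T\<in>Pow R. u ((x - insert p R) \<union> T)) = (\<Sum>T\<in>Pow R. u ((x - {p} - R) \<union> T))"
    by (intro sum.cong refl arg_cong[where f=u]) auto
  also have "(\<Sum>T\<in>insert p ` Pow R. u ((x - insert p R) \<union> T))
      = (\<Sum>T\<in>Pow R. u ((x - insert p R) \<union> insert p T))"
    using assms by (intro sum.reindex_cong[where l="insert p"]) (auto simp: inj_on_def)
  also have "\<dots> = (\<Sum>T\<in>Pow R. u ((insert p x - R) \<union> T))"
    using assms by (intro sum.cong refl arg_cong[where f=u]) auto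
  finally show ?thesis
    unfolding avg_def card_insert_disjoint[OF assms] power_Suc
    by (simp add: add_divide_distrib)
qed

lemma avg_cong:
  assumes "\<And>y. y - R = x - R \<Longrightarrow> u y = v y"
  shows "avg R u x = avg R v x"
  unfolding avg_def by (intro arg_cong2[where f="(/)"] sum.cong refl assms) auto

lemma avg_mono:
  assumes "\<And>y. y - R = x - R \<Longrightarrow> u y \<le> v y"
  shows "avg R u x \<le> avg R v x"
  unfolding avg_def by (intro divide_right_mono sum_mono assms) auto

lemma avg_off: "x - R = y - R \<Longrightarrow> avg R u x = avg R u y"
  unfolding avg_def by simp

lemma avg_add: "avg R (\<lambda>x. u x + v x) x = avg R u x + avg R v x"
  by (simp add: avg_def sum.distrib add_divide_distrib)

lemma avg_diff: "avg R (\<lambda>x. u x - v x) x = avg R u x - avg R v x"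
  by (simp add: avg_def sum_subtractf diff_divide_distrib)

lemma avg_cmult: "avg R (\<lambda>x. c * u x) x = c * avg R u x"
  by (simp add: avg_def sum_distrib_left)

lemma avg_sum: "avg R (\<lambda>x. \<Sum>i\<in>I. u i x) x = (\<Sum>i\<in>I. avg R (u i) x)"
  unfolding avg_def
  by (subst sum.swap) (simp add: sum_divide_distrib)

lemma avg_nonneg: "(\<And>x. u x \<ge> 0) \<Longrightarrow> avg R u x \<ge> 0"
  unfolding avg_def by (intro divide_nonneg_nonneg sum_nonneg) auto

section \<open>Functions of finitely many bits\<close>

definition local_on :: "'p set \<Rightarrow> ('p set \<Rightarrow> 'b) \<Rightarrow> bool" where
  "local_on F u \<longleftrightarrow> (\<forall>x. u x = u (x \<inter> F))"

lemma local_onD: "local_on F u \<Longrightarrow> x \<inter> F = y \<inter> F \<Longrightarrow> u x = u y"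
  unfolding local_on_def by metis

lemma avg_local_point:
  assumes "local_on F u" "x \<inter> F = y \<inter> F"
  shows "avg R u x = avg R u y"
  unfolding avg_def
proof (intro arg_cong2[where f="(/)"] sum.cong refl)
  fix T
  have "((x - R) \<union> T) \<inter> F = ((y - R) \<union> T) \<inter> F" using assms(2) by auto
  thus "u ((x - R) \<union> T) = u ((y - R) \<union> T)" by (rule local_onD[OF assms(1)])
qed

text \<open>Averaging over a bit that \<open>u\<close> does not read changes nothing, so irrelevant
  positions can be added one at a time. Events living on different windows can thus be averaged over
  a common one.\<close>

lemma avg_local:
  assumes "finite B" "local_on F u"
  shows "avg B u x = avg (B \<inter> F) u x"
proof -
  have "avg ((B \<inter> F) \<union> D) u x = avg (B \<inter> F) u x" if "D \<subseteq> B - F" for D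
    using finite_subset[OF that finite_Diff[OF assms(1)]] that
  proof (induction D arbitrary: x rule: finite_induct)
    case (insert p D)
    have fin: "finite ((B \<inter> F) \<union> D)" using insert assms(1) by auto
    have "avg ((B \<inter> F) \<union> insert p D) u x
        = (avg ((B \<inter> F) \<union> D) u (x - {p}) + avg ((B \<inter> F) \<union> D) u (insert p x)) / 2"
      using avg_insert[OF fin, of p] insert by auto
    also have "\<dots> = (avg (B \<inter> F) u (x - {p}) + avg (B \<inter> F) u (insert p x)) / 2"
      using insert by auto
    also have "avg (B \<inter> F) u (x - {p}) = avg (B \<inter> F) u x"
      using insert.prems by (intro avg_local_point[OF assms(2)]) auto
    also have "avg (B \<inter> F) u (insert p x) = avg (B \<inter> F) u x"
      using insert.prems by (intro avg_local_point[OF assms(2)]) auto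
    finally show ?case by simp
  qed simp
  from this[of "B - F"] show ?thesis by (simp add: Int_Diff_Un)
qed

lemma avg_image:
  assumes "bij \<tau>"
  shows "avg (\<tau> ` R) u x = avg R (\<lambda>x. u (\<tau> ` x)) (\<tau> -` x)"
proof -
  have inj: "inj \<tau>" and surj: "surj \<tau>" using assms by (auto simp: bij_def)
  have "(\<Sum>T\<in>Pow (\<tau> ` R). u ((x - \<tau> ` R) \<union> T)) = (\<Sum>T\<in>Pow R. u ((x - \<tau> ` R) \<union> \<tau> ` T))"
    by (rule sum.reindex_cong[where l="(`) \<tau>"])
       (simp_all add: image_Pow_surj inj_on_image_Pow[OF inj_on_subset[OF inj subset_UNIV]])
  also have "\<dots> = (\<Sum>T\<in>Pow R. u (\<tau> ` ((\<tau> -` x - R) \<union> T)))"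
    by (intro sum.cong refl arg_cong[where f=u])
       (simp add: image_Un image_set_diff[OF inj] surj)
  finally show ?thesis
    unfolding avg_def by (simp add: card_image[OF inj_on_subset[OF inj subset_UNIV]])
qed

text \<open>Positions are revealed in order of decreasing \<open>k\<close>. Revealing \<open>p\<close> multiplies the conditional
  expectation of \<open>u\<close> by \<open>1 + inc\<close> or \<open>1 - inc\<close>, according to the bit. The junk value at a
  conditional expectation 0 is 0.\<close>

definition inc :: "('p \<Rightarrow> nat) \<Rightarrow> 'p set \<Rightarrow> ('p set \<Rightarrow> real) \<Rightarrow> 'p \<Rightarrow> 'p set \<Rightarrow> real" where
  "inc k B u p x =
     (let R = {q \<in> B. k q < k p}; m1 = avg R u (insert p x); m0 = avg R u (x - {p})
      in (m1 - m0) / (m1 + m0))"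

text \<open>A new position of largest rank is revealed first, while all of \<open>B\<close> is still
  averaged. By \<open>inc_below\<close> it leaves the increments in \<open>B\<close> unchanged.
  Induction by increasing rank rests on these two facts.\<close>

lemma inc_top:
  assumes "\<And>q. q \<in> B \<Longrightarrow> k q < k p"
  shows "inc k (insert p B) u p x =
    (avg B u (insert p x) - avg B u (x - {p})) / (avg B u (insert p x) + avg B u (x - {p}))"
proof -
  have "{q \<in> insert p B. k q < k p} = B" using assms by auto
  thus ?thesis by (simp add: inc_def Let_def)
qed

lemma inc_below:
  assumes "q \<in> B" "k q < k p"
  shows "inc k (insert p B) u q x = inc k B u q x"
proof -
  have "{r \<in> insert p B. k r < k q} = {r \<in> B. k r < k q}" using assms by auto
  thus ?thesis by (simp add: inc_def)
qed

lemma rank_insert_less: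
  fixes k :: "'p \<Rightarrow> nat"
  assumes "inj_on k (insert p B)" "p \<notin> B" "\<And>y. y \<in> B \<Longrightarrow> k y \<le> k p" "q \<in> B"
  shows "k q < k p"
  using assms by (metis inj_on_eq_iff insertCI le_neq_implies_less)

text \<open>Conditionally on \<open>u = 1\<close>, the conditional expectation of \<open>u\<close> is multiplied on average by
  \<open>1 + inc\<^sup>2 \<le> exp (inc\<^sup>2)\<close> at each step, while overall it grows by the factor \<open>1 / avg B u\<close>.\<close>

lemma avg_exp_inc_le:
  assumes "finite B" "inj_on k B" "\<And>x. u x = 0 \<or> u x = 1"
  shows "avg B (\<lambda>x. u x * exp (- (\<Sum>p\<in>B. (inc k B u p x)\<^sup>2))) x0 \<le> (avg B u x0)\<^sup>2"
  using assms(1,2)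
proof (induction B arbitrary: x0 rule: finite_ranking_induct[where f=k])
  case empty
  then show ?case using assms(3)[of x0] by auto
next
  case (insert p B)
  show ?case
  proof (cases "p \<in> B")
    case True
    then show ?thesis using insert by (simp add: insert_absorb)
  next
    case False
    note less = rank_insert_less[OF insert.prems(1) False insert.hyps(2)]
    define m0 m1 where "m0 = avg B u (x0 - {p})" and "m1 = avg B u (insert p x0)"
    define d where "d = (m1 - m0) / (m1 + m0)"
    have nn: "m0 \<ge> 0" "m1 \<ge> 0"
      unfolding m0_def m1_def by (rule avg_nonneg, metis assms(3) zero_le_one order_refl)+
    \<comment> \<open>\<open>p\<close> is revealed first, so its increment is the same
      \<open>d\<close> for all configurations that enter the average.\<close>
    have top: "inc k (insert p B) u p y = d" if "y - insert p B = x0 - insert p B" for y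
    proof -
      have "avg B u (insert p y) = m1" "avg B u (y - {p}) = m0"
        unfolding m0_def m1_def using that by (auto intro!: avg_off)
      thus ?thesis using inc_top[of B k p u y] less by (metis d_def)
    qed
    let ?g = "\<lambda>x. u x * exp (- (\<Sum>q\<in>B. (inc k B u q x)\<^sup>2))"
    have "avg (insert p B) (\<lambda>x. u x * exp (- (\<Sum>q\<in>insert p B. (inc k (insert p B) u q x)\<^sup>2))) x0
        = avg (insert p B) (\<lambda>x. exp (- d\<^sup>2) * ?g x) x0"
    proof (intro avg_cong)
      fix y assume "y - insert p B = x0 - insert p B"
      hence "(\<Sum>q\<in>insert p B. (inc k (insert p B) u q y)\<^sup>2) = d\<^sup>2 + (\<Sum>q\<in>B. (inc k B u q y)\<^sup>2)"
        unfolding sum.insert[OF insert.hyps(1) False]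
        by (intro arg_cong2[where f="(+)"] sum.cong arg_cong[where f="\<lambda>z. z\<^sup>2"] top inc_below less refl)
      thus "u y * exp (- (\<Sum>q\<in>insert p B. (inc k (insert p B) u q y)\<^sup>2)) = exp (- d\<^sup>2) * ?g y"
        by (metis exp_add minus_add_distrib mult.left_commute)
    qed
    also have "\<dots> = exp (- d\<^sup>2) * ((avg B ?g (x0 - {p}) + avg B ?g (insert p x0)) / 2)"
      by (simp add: avg_cmult avg_insert[OF insert.hyps(1) False])
    also have "\<dots> \<le> exp (- d\<^sup>2) * ((m0\<^sup>2 + m1\<^sup>2) / 2)"
      unfolding m0_def m1_def
      by (intro mult_left_mono divide_right_mono add_mono insert.IH inj_on_subset[OF insert.prems(1)]
            subset_insertI exp_ge_zero zero_le_numeral)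
    \<comment> \<open>With \<open>M\<close> the mean of the two values,
      \<open>m0 = M * (1 - d)\<close> and \<open>m1 = M * (1 + d)\<close>: this produces the factor
      \<open>1 + d\<^sup>2\<close>. If both values vanish, so does \<open>d\<close>, by division by
      zero.\<close>
    also have "(m0\<^sup>2 + m1\<^sup>2) / 2 = (1 + d\<^sup>2) * ((m0 + m1) / 2)\<^sup>2"
    proof (cases "m0 + m1 = 0")
      case True
      then have "m0 = 0" "m1 = 0" using nn by auto
      then show ?thesis by simp
    next
      case False
      hence "d * (m0 + m1) = m1 - m0" by (simp add: d_def add.commute)
      hence "d\<^sup>2 * (m0 + m1)\<^sup>2 = (m1 - m0)\<^sup>2" by (metis power_mult_distrib)
      thus ?thesis by (simp add: power2_eq_square field_simps)
    qed
    also have "exp (- d\<^sup>2) * ((1 + d\<^sup>2) * ((m0 + m1) / 2)\<^sup>2) \<le> 1 * ((m0 + m1) / 2)\<^sup>2"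
    proof -
      have "exp (- d\<^sup>2) * (1 + d\<^sup>2) \<le> exp (- d\<^sup>2) * exp (d\<^sup>2)"
        by (intro mult_left_mono exp_ge_add_one_self) auto
      hence "exp (- d\<^sup>2) * (1 + d\<^sup>2) \<le> 1" by (simp flip: exp_add)
      thus ?thesis by (metis mult.assoc mult_right_mono zero_le_power2)
    qed
    also have "(m0 + m1) / 2 = avg (insert p B) u x0"
      by (simp add: avg_insert[OF insert.hyps(1) False] m0_def m1_def)
    finally show ?thesis by simp
  qed
qed

section \<open>Hellinger comparison of two nested events\<close>

lemma sqrt_mult_le_amean:
  fixes x y :: real
  assumes "0 \<le> x" "x \<le> 2" "0 \<le> y" "y \<le> 2"
  shows "sqrt (x * y) \<le> (x + y) / 2 - (x - y)\<^sup>2 / 16"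
proof -
  have "(sqrt x + sqrt y)\<^sup>2 \<le> 8"
  proof -
    have "sqrt x \<le> sqrt 2" "sqrt y \<le> sqrt 2" using assms by auto
    hence "(sqrt x + sqrt y)\<^sup>2 \<le> (sqrt 2 + sqrt 2)\<^sup>2"
      using assms by (intro power_mono add_mono) auto
    also have "\<dots> = 8" by (simp add: power2_eq_square algebra_simps)
    finally show ?thesis .
  qed
  \<comment> \<open>The gap in the AM-GM inequality is \<open>(sqrt x - sqrt y)\<^sup>2 / 2\<close>,
    and \<open>x - y\<close> contains the factor \<open>sqrt x - sqrt y\<close>. The bound 2 on the
    arguments, which will be 1 plus or minus an increment, controls the other factor.\<close>
  have "(x - y)\<^sup>2 = ((sqrt x + sqrt y) * (sqrt x - sqrt y))\<^sup>2"
    using assms by (simp add: algebra_simps)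
  also have "\<dots> = (sqrt x + sqrt y)\<^sup>2 * (sqrt x - sqrt y)\<^sup>2" by (rule power_mult_distrib)
  also have "\<dots> \<le> 8 * (sqrt x - sqrt y)\<^sup>2"
    using \<open>(sqrt x + sqrt y)\<^sup>2 \<le> 8\<close> by (intro mult_right_mono) auto
  also have "(sqrt x - sqrt y)\<^sup>2 = x + y - 2 * sqrt (x * y)"
    using assms by (simp add: power2_diff real_sqrt_mult)
  finally have "(x - y)\<^sup>2 \<le> 8 * (x + y - 2 * sqrt (x * y))" .
  moreover have "z \<le> 8 * (t - 2 * r) \<Longrightarrow> r \<le> t / 2 - z / 16" for z t r :: real by simp
  ultimately show ?thesis by blast
qed

text \<open>With means \<open>W\<close>, \<open>U\<close> and increments \<open>b\<close>,
  \<open>a\<close>, the values are \<open>W * (1 - b)\<close>, \<open>W * (1 + b)\<close> and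
  likewise for \<open>U\<close>. The quantified AM-GM inequality for both outcomes shows that the
  expected geometric mean drops by at least \<open>sqrt (W * U) * (a - b)\<^sup>2 / 16\<close>, and
  \<open>sqrt (W * U)\<close> dominates \<open>W\<close> because \<open>W \<le> U\<close>.\<close>

lemma hellinger_step:
  fixes w0 w1 u0 u1 :: real
  assumes "0 \<le> w0" "w0 \<le> u0" "0 \<le> w1" "w1 \<le> u1"
  shows "((u1 - u0) / (u1 + u0) - (w1 - w0) / (w1 + w0))\<^sup>2 * ((w0 + w1) / 2)
    \<le> 16 * (sqrt ((w0 + w1) / 2 * ((u0 + u1) / 2)) - (sqrt (w0 * u0) + sqrt (w1 * u1)) / 2)"
proof (cases "w0 + w1 = 0")
  case True
  hence "w0 = 0" "w1 = 0" using assms by auto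
  thus ?thesis by simp
next
  case False
  define W U where "W = (w0 + w1) / 2" and "U = (u0 + u1) / 2"
  define a b where "a = (u1 - u0) / (u1 + u0)" and "b = (w1 - w0) / (w1 + w0)"
  have pos: "W > 0" "U \<ge> W" using False assms by (auto simp: W_def U_def)
  hence "U > 0" by simp
  have eq: "w0 = W * (1 - b)" "w1 = W * (1 + b)" "u0 = U * (1 - a)" "u1 = U * (1 + a)"
    using pos \<open>U > 0\<close> by (simp_all add: W_def U_def a_def b_def field_simps)
  have bounds: "-1 \<le> a" "a \<le> 1" "-1 \<le> b" "b \<le> 1"
    using pos \<open>U > 0\<close> assms by (simp_all add: W_def U_def a_def b_def field_simps)
  have "sqrt (w0 * u0) = sqrt (W * U) * sqrt ((1 - b) * (1 - a))"
    unfolding eq by (simp flip: real_sqrt_mult add: mult_ac)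
  also have "\<dots> \<le> sqrt (W * U) * (((1 - b) + (1 - a)) / 2 - (a - b)\<^sup>2 / 16)"
    using sqrt_mult_le_amean[of "1 - b" "1 - a"] bounds pos \<open>U > 0\<close>
    by (intro mult_left_mono) auto
  finally have 1: "sqrt (w0 * u0) \<le> sqrt (W * U) * (((1 - b) + (1 - a)) / 2 - (a - b)\<^sup>2 / 16)" .
  have "sqrt (w1 * u1) = sqrt (W * U) * sqrt ((1 + b) * (1 + a))"
    unfolding eq by (simp flip: real_sqrt_mult add: mult_ac)
  also have "\<dots> \<le> sqrt (W * U) * (((1 + b) + (1 + a)) / 2 - (a - b)\<^sup>2 / 16)"
    using sqrt_mult_le_amean[of "1 + b" "1 + a"] bounds pos \<open>U > 0\<close>
    by (intro mult_left_mono) (auto simp: power2_commute)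
  finally have 2: "sqrt (w1 * u1) \<le> sqrt (W * U) * (((1 + b) + (1 + a)) / 2 - (a - b)\<^sup>2 / 16)" .
  have "W = sqrt (W * W)" using pos by simp
  also have "\<dots> \<le> sqrt (W * U)" using pos by (intro real_sqrt_le_mono mult_left_mono) auto
  finally have "(a - b)\<^sup>2 * W \<le> (a - b)\<^sup>2 * sqrt (W * U)" by (intro mult_left_mono) auto
  also have "\<dots> \<le> 16 * (sqrt (W * U) - (sqrt (w0 * u0) + sqrt (w1 * u1)) / 2)"
  proof -
    have "sqrt (w0 * u0) + sqrt (w1 * u1) \<le> sqrt (W * U) * (2 - (a - b)\<^sup>2 / 8)"
      using 1 2 by (simp add: algebra_simps)
    also have "\<dots> = 2 * sqrt (W * U) - (a - b)\<^sup>2 * sqrt (W * U) / 8"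
      by (simp add: algebra_simps)
    finally have "sqrt (w0 * u0) + sqrt (w1 * u1) \<le> 2 * sqrt (W * U) - (a - b)\<^sup>2 * sqrt (W * U) / 8" .
    moreover have "s \<le> 2 * t - z / 8 \<Longrightarrow> z \<le> 16 * (t - s / 2)" for s t z :: real by simp
    ultimately show ?thesis by blast
  qed
  finally show ?thesis unfolding a_def b_def W_def U_def .
qed

text \<open>The potential is the expectation of the geometric mean of the conditional expectations of \<open>w\<close> and \<open>u\<close>:
  it decreases from \<open>sqrt (avg w * avg u)\<close> to \<open>avg w\<close>, losing at each step a multiple of the squared
  difference of the increments.\<close>

lemma avg_inc_diff_le:
  assumes "finite B" "inj_on k B"
    and "\<And>x. u x = 0 \<or> u x = 1" "\<And>x. w x = 0 \<or> w x = 1" "\<And>x. w x \<le> u x"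
  shows "avg B (\<lambda>x. w x * (\<Sum>p\<in>B. (inc k B u p x - inc k B w p x)\<^sup>2)) x0
    \<le> 16 * (sqrt (avg B w x0 * avg B u x0) - avg B w x0)"
  using assms(1,2)
proof (induction B arbitrary: x0 rule: finite_ranking_induct[where f=k])
  case empty
  then show ?case using assms(3-5)[of x0] by auto
next
  case (insert p B)
  show ?case
  proof (cases "p \<in> B")
    case True
    then show ?thesis using insert by (simp add: insert_absorb)
  next
    case False
    note less = rank_insert_less[OF insert.prems(1) False insert.hyps(2)]
    define u0 u1 where "u0 = avg B u (x0 - {p})" and "u1 = avg B u (insert p x0)"
    define w0 w1 where "w0 = avg B w (x0 - {p})" and "w1 = avg B w (insert p x0)"
    define d where "d = (u1 - u0) / (u1 + u0) - (w1 - w0) / (w1 + w0)"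
    have nn: "w0 \<ge> 0" "w1 \<ge> 0"
      unfolding w0_def w1_def by (rule avg_nonneg, metis assms(4) zero_le_one order_refl)+
    have le: "w0 \<le> u0" "w1 \<le> u1"
      unfolding w0_def w1_def u0_def u1_def by (rule avg_mono, rule assms(5))+
    have top: "inc k (insert p B) u p y - inc k (insert p B) w p y = d"
      if "y - insert p B = x0 - insert p B" for y
    proof -
      have "avg B u (insert p y) = u1" "avg B u (y - {p}) = u0"
           "avg B w (insert p y) = w1" "avg B w (y - {p}) = w0"
        unfolding u0_def u1_def w0_def w1_def using that by (auto intro!: avg_off)
      thus ?thesis using inc_top[of B k p u y] inc_top[of B k p w y] less by (metis d_def)
    qed
    let ?g = "\<lambda>x. w x * (\<Sum>q\<in>B. (inc k B u q x - inc k B w q x)\<^sup>2)"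
    have "avg (insert p B) (\<lambda>x. w x * (\<Sum>q\<in>insert p B. (inc k (insert p B) u q x - inc k (insert p B) w q x)\<^sup>2)) x0
        = avg (insert p B) (\<lambda>x. d\<^sup>2 * w x + ?g x) x0"
    proof (intro avg_cong)
      fix y assume "y - insert p B = x0 - insert p B"
      hence "(\<Sum>q\<in>insert p B. (inc k (insert p B) u q y - inc k (insert p B) w q y)\<^sup>2)
          = d\<^sup>2 + (\<Sum>q\<in>B. (inc k B u q y - inc k B w q y)\<^sup>2)"
        unfolding sum.insert[OF insert.hyps(1) False]
        by (intro arg_cong2[where f="(+)"] sum.cong arg_cong[where f="\<lambda>z. z\<^sup>2"] top refl)
           (simp_all add: inc_below less)
      moreover have "a = b + c \<Longrightarrow> w y * a = b * w y + w y * c" for a b c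
        by (simp add: algebra_simps)
      ultimately show "w y * (\<Sum>q\<in>insert p B. (inc k (insert p B) u q y - inc k (insert p B) w q y)\<^sup>2) = d\<^sup>2 * w y + ?g y"
        by blast
    qed
    also have "\<dots> = d\<^sup>2 * ((w0 + w1) / 2) + (avg B ?g (x0 - {p}) + avg B ?g (insert p x0)) / 2"
      by (simp add: avg_cmult avg_add avg_insert[OF insert.hyps(1) False] w0_def w1_def)
    \<comment> \<open>The loss of potential in the first step plus the induction hypothesis in both
      halves; the terms \<open>sqrt (w0 * u0)\<close> and \<open>sqrt (w1 * u1)\<close>
      cancel.\<close>
    also have "\<dots> \<le> 16 * (sqrt ((w0 + w1) / 2 * ((u0 + u1) / 2)) - (sqrt (w0 * u0) + sqrt (w1 * u1)) / 2)
        + (16 * (sqrt (w0 * u0) - w0) + 16 * (sqrt (w1 * u1) - w1)) / 2"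
      unfolding d_def
      by (intro add_mono divide_right_mono hellinger_step nn le zero_le_numeral;
          unfold w0_def w1_def u0_def u1_def;
          intro insert.IH inj_on_subset[OF insert.prems(1)] subset_insertI)
    also have "\<dots> = 16 * (sqrt (avg (insert p B) w x0 * avg (insert p B) u x0) - avg (insert p B) w x0)"
    proof -
      have "16 * (r - (a + b) / 2) + (16 * (a - w0) + 16 * (b - w1)) / 2 = 16 * (r - (w0 + w1) / 2)" for a b r
        by (simp add: field_simps)
      thus ?thesis
        unfolding avg_insert[OF insert.hyps(1) False] w0_def w1_def u0_def u1_def .
    qed
    finally show ?thesis .
  qed
qed

section \<open>Influence weights\<close>

text \<open>Bits outside \<open>F\<close> neither move the martingale nor matter when averaged.
  Increments of events with different windows can therefore be compared inside one common
  \<open>B\<close>.\<close>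

lemma inc_local:
  assumes "finite B" "local_on F u" "F \<subseteq> B"
  shows "inc k B u p x = (if p \<in> F then inc k F u p x else 0)"
proof (cases "p \<in> F")
  case True
  let ?R = "{q \<in> B. k q < k p}" and ?R' = "{q \<in> F. k q < k p}"
  have "avg ?R u y = avg ?R' u y" for y
  proof -
    have "?R \<inter> F = ?R'" using assms(3) by auto
    thus ?thesis using avg_local[OF _ assms(2), of ?R] assms(1) by simp
  qed
  thus ?thesis using True by (simp add: inc_def Let_def)
next
  case False
  have "avg R u (insert p x) = avg R u (x - {p})" for R
    using False by (intro avg_local_point[OF assms(2)]) auto
  thus ?thesis using False by (simp add: inc_def Let_def)
qed

lemma inc_cong:
  assumes "local_on F u" "x \<inter> F = y \<inter> F" "p \<in> F" "\<And>q. q \<in> F \<Longrightarrow> k q = k' q"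
  shows "inc k F u p x = inc k' F u p y"
proof -
  have R: "{q \<in> F. k q < k p} = {q \<in> F. k' q < k' p}" using assms(3,4) by auto
  have "avg R u (insert p x) = avg R u (insert p y)" "avg R u (x - {p}) = avg R u (y - {p})" for R
    using assms(2) by (auto intro!: avg_local_point[OF assms(1)])
  thus ?thesis by (simp add: inc_def R)
qed

text \<open>Shifts transport the increments only together with the ranks \<open>k\<close>. There is
  no equivariance for one fixed order; averaging over random orders will restore it.\<close>

lemma inc_image:
  assumes "bij \<tau>"
  shows "inc k (\<tau> ` B) u (\<tau> p) x = inc (k \<circ> \<tau>) B (\<lambda>x. u (\<tau> ` x)) p (\<tau> -` x)"
proof -
  have inj: "inj \<tau>" using assms by (auto simp: bij_def)
  have 1: "{q \<in> \<tau> ` B. k q < k (\<tau> p)} = \<tau> ` {q \<in> B. (k \<circ> \<tau>) q < (k \<circ> \<tau>) p}" by auto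
  have 2: "\<tau> -` insert (\<tau> p) x = insert p (\<tau> -` x)" "\<tau> -` (x - {\<tau> p}) = \<tau> -` x - {p}"
    using inj by (auto simp: inj_eq)
  show ?thesis unfolding inc_def 1 Let_def avg_image[OF assms] 2 ..
qed

text \<open>For \<open>u\<close> an indicator this is the normalised squared increment on the event
  and 0 off it. If all increments vanish, division by zero makes all weights 0 and the total mass
  \<open>u x\<close> is lost; this case has to be bounded separately.\<close>

definition wt :: "('p \<Rightarrow> nat) \<Rightarrow> 'p set \<Rightarrow> ('p set \<Rightarrow> real) \<Rightarrow> 'p \<Rightarrow> 'p set \<Rightarrow> real" where
  "wt k F u p x = (if p \<in> F then u x * (inc k F u p x)\<^sup>2 / (\<Sum>q\<in>F. (inc k F u q x)\<^sup>2) else 0)"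

lemma wt_nonneg: "u x \<ge> 0 \<Longrightarrow> wt k F u p x \<ge> 0"
  by (auto simp: wt_def intro!: divide_nonneg_nonneg sum_nonneg)

lemma sum_wt:
  assumes "finite B" "F \<subseteq> B"
  shows "(\<Sum>p\<in>B. wt k F u p x) = (if (\<Sum>q\<in>F. (inc k F u q x)\<^sup>2) = 0 then 0 else u x)"
proof -
  have "(\<Sum>p\<in>B. wt k F u p x) = (\<Sum>p\<in>F. wt k F u p x)"
    using assms by (intro sum.mono_neutral_right) (auto simp: wt_def)
  also have "\<dots> = (\<Sum>p\<in>F. u x * (inc k F u p x)\<^sup>2) / (\<Sum>q\<in>F. (inc k F u q x)\<^sup>2)"
    by (simp add: wt_def sum_divide_distrib)
  also have "\<dots> = u x * (\<Sum>p\<in>F. (inc k F u p x)\<^sup>2) / (\<Sum>q\<in>F. (inc k F u q x)\<^sup>2)"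
    by (simp add: sum_distrib_left)
  finally show ?thesis by auto
qed

lemma wt_le_1:
  assumes "finite F" "u x = 0 \<or> u x = 1"
  shows "wt k F u p x \<le> 1"
proof (cases "p \<in> F")
  case True
  have "wt k F u p x \<le> (\<Sum>p\<in>F. wt k F u p x)"
    using assms True by (intro member_le_sum wt_nonneg) auto
  also have "\<dots> \<le> 1" using assms by (subst sum_wt) auto
  finally show ?thesis .
qed (simp add: wt_def)

lemma wt_cong:
  assumes "local_on F u" "x \<inter> F = y \<inter> F" "\<And>q. q \<in> F \<Longrightarrow> k q = k' q"
  shows "wt k F u p x = wt k' F u p y"
proof -
  have "u x = u y" by (rule local_onD[OF assms(1,2)])
  moreover have "inc k F u q x = inc k' F u q y" if "q \<in> F" for q
    by (rule inc_cong[OF assms(1,2) that assms(3)])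
  ultimately show ?thesis by (simp add: wt_def)
qed

lemma wt_local:
  assumes "finite B" "local_on F u" "F \<subseteq> B" "p \<in> B"
  shows "wt k F u p x = wt k B u p x"
proof -
  have "(\<Sum>q\<in>B. (inc k B u q x)\<^sup>2) = (\<Sum>q\<in>F. (inc k B u q x)\<^sup>2)"
    using assms by (intro sum.mono_neutral_right) (auto simp: inc_local[OF assms(1-3)])
  also have "\<dots> = (\<Sum>q\<in>F. (inc k F u q x)\<^sup>2)"
    by (intro sum.cong refl) (simp add: inc_local[OF assms(1-3)])
  finally show ?thesis
    using assms(4) by (auto simp: wt_def inc_local[OF assms(1-3)])
qed

lemma wt_image:
  assumes "bij \<tau>"
  shows "wt k (\<tau> ` F) u (\<tau> p) x = wt (k \<circ> \<tau>) F (\<lambda>x. u (\<tau> ` x)) p (\<tau> -` x)"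
proof -
  have inj: "inj \<tau>" and surj: "surj \<tau>" using assms by (auto simp: bij_def)
  have "(\<Sum>q\<in>\<tau> ` F. (inc k (\<tau> ` F) u q x)\<^sup>2) = (\<Sum>q\<in>F. (inc k (\<tau> ` F) u (\<tau> q) x)\<^sup>2)"
    by (rule sum.reindex_cong[OF inj_on_subset[OF inj subset_UNIV]]) auto
  thus ?thesis
    unfolding wt_def by (simp add: inc_image[OF assms] inj_image_mem_iff[OF inj] surj)
qed

text \<open>Young's inequality with parameter \<open>\<eta>\<close> bounds the change of each square
  by \<open>(1 + 1 / \<eta>) * (a p - b p)\<^sup>2 + \<eta> * (a p)\<^sup>2\<close>. After division
  by the total for \<open>a\<close>, which is at least \<open>T\<close>, the second parts sum to
  \<open>\<eta>\<close>. Exchanging the normalising constants costs the same again, hence the factor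
  2.\<close>

lemma sum_normalized_squares_diff_le:
  fixes a b :: "'p \<Rightarrow> real"
  assumes "finite I" "T > 0" "\<eta> > 0" "(\<Sum>p\<in>I. (a p)\<^sup>2) \<ge> T"
  shows "(\<Sum>p\<in>I. \<bar>(a p)\<^sup>2 / (\<Sum>q\<in>I. (a q)\<^sup>2) - (b p)\<^sup>2 / (\<Sum>q\<in>I. (b q)\<^sup>2)\<bar>)
    \<le> 2 * \<eta> + 2 * (1 + 1 / \<eta>) / T * (\<Sum>p\<in>I. (a p - b p)\<^sup>2)"
proof -
  define A where "A = (\<Sum>q\<in>I. (a q)\<^sup>2)"
  define D where "D = (\<Sum>q\<in>I. (b q)\<^sup>2)"
  define r where "r = (\<Sum>p\<in>I. (a p - b p)\<^sup>2)"
  have A: "A > 0" "A \<ge> T" using assms by (auto simp: A_def)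
  have D: "D \<ge> 0" by (simp add: D_def sum_nonneg)
  have r: "r \<ge> 0" by (simp add: r_def sum_nonneg)
  have pt: "\<bar>(a p)\<^sup>2 - (b p)\<^sup>2\<bar> \<le> (1 + 1 / \<eta>) * (a p - b p)\<^sup>2 + \<eta> * (a p)\<^sup>2" for p
  proof -
    have "0 \<le> (\<bar>a p - b p\<bar> - \<eta> * \<bar>a p\<bar>)\<^sup>2 / \<eta>" using assms by simp
    also have "\<dots> = (a p - b p)\<^sup>2 / \<eta> + \<eta> * (a p)\<^sup>2 - 2 * \<bar>a p - b p\<bar> * \<bar>a p\<bar>"
      using assms(3) by (simp add: power2_diff power_mult_distrib diff_divide_distrib add_divide_distrib)
         (simp add: power2_eq_square)
    finally have 1: "2 * \<bar>a p - b p\<bar> * \<bar>a p\<bar> \<le> (a p - b p)\<^sup>2 / \<eta> + \<eta> * (a p)\<^sup>2" by simp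
    have "(a p)\<^sup>2 - (b p)\<^sup>2 = 2 * ((a p - b p) * a p) - (a p - b p)\<^sup>2"
      by (simp add: power2_eq_square algebra_simps)
    hence "\<bar>(a p)\<^sup>2 - (b p)\<^sup>2\<bar> \<le> \<bar>2 * ((a p - b p) * a p)\<bar> + \<bar>(a p - b p)\<^sup>2\<bar>"
      by (metis abs_triangle_ineq4)
    also have "\<dots> = 2 * \<bar>a p - b p\<bar> * \<bar>a p\<bar> + (a p - b p)\<^sup>2" by (simp add: abs_mult)
    also have "\<dots> \<le> (a p - b p)\<^sup>2 / \<eta> + \<eta> * (a p)\<^sup>2 + (a p - b p)\<^sup>2" using 1 by simp
    also have "\<dots> = (1 + 1 / \<eta>) * (a p - b p)\<^sup>2 + \<eta> * (a p)\<^sup>2"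
      by (simp add: distrib_right)
    finally show ?thesis .
  qed
  have s: "(\<Sum>p\<in>I. \<bar>(a p)\<^sup>2 - (b p)\<^sup>2\<bar>) \<le> (1 + 1 / \<eta>) * r + \<eta> * A"
    unfolding r_def A_def sum_distrib_left sum.distrib[symmetric] by (intro sum_mono pt)
  have "\<bar>A - D\<bar> \<le> (\<Sum>p\<in>I. \<bar>(a p)\<^sup>2 - (b p)\<^sup>2\<bar>)"
    unfolding A_def D_def sum_subtractf[symmetric] by (rule sum_abs)
  with s have s2: "\<bar>A - D\<bar> \<le> (1 + 1 / \<eta>) * r + \<eta> * A" by linarith
  have "(\<Sum>p\<in>I. \<bar>(a p)\<^sup>2 / A - (b p)\<^sup>2 / D\<bar>)
      \<le> (\<Sum>p\<in>I. \<bar>(a p)\<^sup>2 - (b p)\<^sup>2\<bar> / A + \<bar>(b p)\<^sup>2 / A - (b p)\<^sup>2 / D\<bar>)"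
  proof (intro sum_mono)
    fix p
    have "(a p)\<^sup>2 / A - (b p)\<^sup>2 / D = ((a p)\<^sup>2 - (b p)\<^sup>2) / A + ((b p)\<^sup>2 / A - (b p)\<^sup>2 / D)"
      by (simp add: diff_divide_distrib)
    also have "\<bar>\<dots>\<bar> \<le> \<bar>((a p)\<^sup>2 - (b p)\<^sup>2) / A\<bar> + \<bar>(b p)\<^sup>2 / A - (b p)\<^sup>2 / D\<bar>"
      by (rule abs_triangle_ineq)
    finally show "\<bar>(a p)\<^sup>2 / A - (b p)\<^sup>2 / D\<bar> \<le> \<bar>(a p)\<^sup>2 - (b p)\<^sup>2\<bar> / A + \<bar>(b p)\<^sup>2 / A - (b p)\<^sup>2 / D\<bar>"
      using A by simp
  qed
  also have "\<dots> = (\<Sum>p\<in>I. \<bar>(a p)\<^sup>2 - (b p)\<^sup>2\<bar>) / A + (\<Sum>p\<in>I. \<bar>(b p)\<^sup>2 / A - (b p)\<^sup>2 / D\<bar>)"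
    by (simp add: sum.distrib sum_divide_distrib)
  also have "(\<Sum>p\<in>I. \<bar>(b p)\<^sup>2 / A - (b p)\<^sup>2 / D\<bar>) \<le> \<bar>A - D\<bar> / A"
  \<comment> \<open>If \<open>D = 0\<close>, all \<open>b p\<close> vanish and so does the left
    side. Otherwise the sum collapses to \<open>D * \<bar>1 / A - 1 / D\<bar>\<close>.\<close>
  proof (cases "D = 0")
    case True
    hence "\<forall>p\<in>I. (b p)\<^sup>2 = 0" using sum_nonneg_eq_0_iff[OF assms(1), of "\<lambda>p. (b p)\<^sup>2"] by (simp add: D_def)
    thus ?thesis using A by simp
  next
    case False
    have "(\<Sum>p\<in>I. \<bar>(b p)\<^sup>2 / A - (b p)\<^sup>2 / D\<bar>) = (\<Sum>p\<in>I. (b p)\<^sup>2 * \<bar>1 / A - 1 / D\<bar>)"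
    proof (intro sum.cong refl)
      fix p
      have "(b p)\<^sup>2 / A - (b p)\<^sup>2 / D = (b p)\<^sup>2 * (1 / A - 1 / D)" by (simp add: right_diff_distrib)
      thus "\<bar>(b p)\<^sup>2 / A - (b p)\<^sup>2 / D\<bar> = (b p)\<^sup>2 * \<bar>1 / A - 1 / D\<bar>" by (simp add: abs_mult)
    qed
    also have "\<dots> = D * \<bar>1 / A - 1 / D\<bar>" by (simp add: D_def sum_distrib_right)
    also have "\<dots> = \<bar>D * (1 / A - 1 / D)\<bar>" using D by (simp add: abs_mult)
    also have "D * (1 / A - 1 / D) = (D - A) / A" using False A by (simp add: field_simps)
    finally show ?thesis using A by (simp add: abs_minus_commute)
  qed
  also have "(\<Sum>p\<in>I. \<bar>(a p)\<^sup>2 - (b p)\<^sup>2\<bar>) / A + \<bar>A - D\<bar> / A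
      \<le> ((1 + 1 / \<eta>) * r + \<eta> * A) / A + ((1 + 1 / \<eta>) * r + \<eta> * A) / A"
    using s s2 A by (intro add_mono divide_right_mono) auto
  also have "\<dots> = 2 * \<eta> + 2 * (1 + 1 / \<eta>) * r / A" using A by (simp add: field_simps)
  also have "\<dots> \<le> 2 * \<eta> + 2 * (1 + 1 / \<eta>) * r / T"
    using A r assms by (intro add_left_mono divide_left_mono) auto
  finally show ?thesis unfolding A_def D_def r_def by simp
qed

text \<open>If the squared increments of \<open>u\<close> add up to at least \<open>T\<close>, the
  normalised squares are close, through comparison of both families with the increments of the joint
  event. Otherwise a Markov argument with \<open>avg_exp_inc_le\<close> applies. The last constant
  is \<open>32 * c\<close>: two comparisons worth \<open>8 * P\<close> each, both doubled in the
  triangle inequality for squares.\<close>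

lemma avg_max_wt_diff_le:
  assumes "finite B" "inj_on k B" "F \<subseteq> B" "F' \<subseteq> B"
    and u: "\<And>x. u x = 0 \<or> u x = 1" "local_on F u"
    and v: "\<And>x. v x = 0 \<or> v x = 1" "local_on F' v"
    and "avg B u x0 = P" "avg B v x0 = P" "T > 0" "\<eta> > 0"
  shows "avg B (\<lambda>x. v x * (\<Sum>p\<in>B. max 0 (wt k F u p x - wt k F' v p x))) x0
    \<le> exp T * P\<^sup>2 + (2 * \<eta> + 64 * (1 + 1 / \<eta>) / T) * P"
proof -
  \<comment> \<open>The joint event lies below both events, so the Hellinger bound applies to the
    pair \<open>u\<close>, \<open>w\<close> and to the pair \<open>v\<close>,
    \<open>w\<close>.\<close>
  define w where "w x = u x * v x" for x
  define c where "c = 2 * (1 + 1 / \<eta>) / T"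
  have c: "c \<ge> 0" using assms by (simp add: c_def)
  have w: "w x = 0 \<or> w x = 1" "w x \<le> u x" "w x \<le> v x" for x
    using u(1)[of x] v(1)[of x] by (auto simp: w_def)
  define a b d where "a = inc k B u" and "b = inc k B v" and "d = inc k B w"
  define A where "A x = (\<Sum>p\<in>B. (a p x)\<^sup>2)" for x
  have pt: "v x * (\<Sum>p\<in>B. max 0 (wt k F u p x - wt k F' v p x))
     \<le> exp T * (u x * exp (- A x)) + (2 * \<eta> * u x + (2 * c * (w x * (\<Sum>p\<in>B. (a p x - d p x)\<^sup>2))
        + 2 * c * (w x * (\<Sum>p\<in>B. (b p x - d p x)\<^sup>2))))" for x
  proof (cases "u x = 1 \<and> v x = 1")
    case False
    have nn: "0 \<le> exp T * (u x * exp (- A x)) + (2 * \<eta> * u x + (2 * c * (w x * (\<Sum>p\<in>B. (a p x - d p x)\<^sup>2))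
        + 2 * c * (w x * (\<Sum>p\<in>B. (b p x - d p x)\<^sup>2))))"
    proof -
      have "u x \<ge> 0" "w x \<ge> 0" using u(1)[of x] w(1)[of x] by auto
      thus ?thesis using c assms by (intro add_nonneg_nonneg mult_nonneg_nonneg sum_nonneg) auto
    qed
    have "wt k F u p x = 0" if "u x = 0" for p using that by (simp add: wt_def)
    moreover have "wt k F' v p x \<ge> 0" for p using v(1)[of x] by (intro wt_nonneg) auto
    ultimately have z: "v x * (\<Sum>p\<in>B. max 0 (wt k F u p x - wt k F' v p x)) = 0"
      using False u(1)[of x] v(1)[of x] by auto
    show ?thesis by (rule ord_eq_le_trans[OF z nn])
  next
    case True
    hence wx: "w x = 1" by (simp add: w_def)
    have wu: "wt k F u p x = (a p x)\<^sup>2 / A x" "wt k F' v p x = (b p x)\<^sup>2 / (\<Sum>p\<in>B. (b p x)\<^sup>2)" if "p \<in> B" for p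
      using that wt_local[OF assms(1) u(2) assms(3) that] wt_local[OF assms(1) v(2) assms(4) that] True
      by (simp_all add: wt_def a_def b_def A_def)
    have le: "(\<Sum>p\<in>B. (a p x - b p x)\<^sup>2) \<le> 2 * (\<Sum>p\<in>B. (a p x - d p x)\<^sup>2) + 2 * (\<Sum>p\<in>B. (b p x - d p x)\<^sup>2)"
      unfolding sum_distrib_left sum.distrib[symmetric]
    proof (intro sum_mono)
      fix p
      have "0 \<le> ((a p x - d p x) + (b p x - d p x))\<^sup>2" by simp
      thus "(a p x - b p x)\<^sup>2 \<le> 2 * (a p x - d p x)\<^sup>2 + 2 * (b p x - d p x)\<^sup>2"
        by (simp add: power2_eq_square algebra_simps)
    qed
    show ?thesis
    proof (cases "A x \<ge> T")
      case big: True
      have "(\<Sum>p\<in>B. max 0 (wt k F u p x - wt k F' v p x))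
         \<le> (\<Sum>p\<in>B. \<bar>(a p x)\<^sup>2 / A x - (b p x)\<^sup>2 / (\<Sum>p\<in>B. (b p x)\<^sup>2)\<bar>)"
        by (intro sum_mono) (simp add: wu)
      also have "\<dots> \<le> 2 * \<eta> + c * (\<Sum>p\<in>B. (a p x - b p x)\<^sup>2)"
        using sum_normalized_squares_diff_le[OF assms(1) \<open>T > 0\<close> \<open>\<eta> > 0\<close>, of "\<lambda>p. a p x" "\<lambda>p. b p x"] big
        by (simp add: A_def c_def)
      also have "\<dots> \<le> 2 * \<eta> + c * (2 * (\<Sum>p\<in>B. (a p x - d p x)\<^sup>2) + 2 * (\<Sum>p\<in>B. (b p x - d p x)\<^sup>2))"
        by (intro add_left_mono mult_left_mono le c)
      also have "\<dots> \<le> exp T * (u x * exp (- A x)) + \<dots>" using True by simp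
      finally show ?thesis using True wx by (simp add: algebra_simps)
    next
      case False
      \<comment> \<open>Few squares have accumulated: the trivial bound 1 on the total weight is
        raised to \<open>exp (T - A x)\<close>, whose mean over the event
        \<open>avg_exp_inc_le\<close> controls.\<close>
      have "(\<Sum>p\<in>B. max 0 (wt k F u p x - wt k F' v p x)) \<le> (\<Sum>p\<in>B. wt k F u p x)"
        using wt_nonneg[of v x k F'] wt_nonneg[of u x k F] True by (intro sum_mono) simp
      also have "\<dots> \<le> 1" using sum_wt[OF assms(1,3), of k u x] True by auto
      also have "\<dots> \<le> exp (T - A x)" using False by simp
      also have "\<dots> = exp T * (u x * exp (- A x))" using True by (simp add: exp_diff exp_minus divide_inverse)
      also have "\<dots> \<le> \<dots> + (2 * \<eta> * u x + (2 * c * (w x * (\<Sum>p\<in>B. (a p x - d p x)\<^sup>2))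
        + 2 * c * (w x * (\<Sum>p\<in>B. (b p x - d p x)\<^sup>2))))"
      proof -
        have "0 \<le> 2 * \<eta> * u x + (2 * c * (w x * (\<Sum>p\<in>B. (a p x - d p x)\<^sup>2))
          + 2 * c * (w x * (\<Sum>p\<in>B. (b p x - d p x)\<^sup>2)))"
          using c assms True wx by (intro add_nonneg_nonneg mult_nonneg_nonneg sum_nonneg) auto
        thus ?thesis by simp
      qed
      finally show ?thesis using True by simp
    qed
  qed
  have nn: "avg B u x0 \<ge> 0" "avg B w x0 \<ge> 0"
    by (rule avg_nonneg, metis u(1) w(1) zero_le_one order_refl)+
  \<comment> \<open>Uniform in the probability of the joint event, by AM-GM: the left side is at
    most 8 times \<open>P - avg B w x0\<close>.\<close>
  have root: "16 * (sqrt (avg B w x0 * P) - avg B w x0) \<le> 8 * P"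
  proof -
    have "sqrt (avg B w x0 * P) \<le> (avg B w x0 + P) / 2"
      using nn assms by (intro arith_geo_mean_sqrt) auto
    thus ?thesis using nn by (simp add: field_simps)
  qed
  have "avg B (\<lambda>x. v x * (\<Sum>p\<in>B. max 0 (wt k F u p x - wt k F' v p x))) x0
     \<le> avg B (\<lambda>x. exp T * (u x * exp (- A x)) + (2 * \<eta> * u x + (2 * c * (w x * (\<Sum>p\<in>B. (a p x - d p x)\<^sup>2))
        + 2 * c * (w x * (\<Sum>p\<in>B. (b p x - d p x)\<^sup>2))))) x0"
    by (intro avg_mono pt)
  also have "\<dots> = exp T * avg B (\<lambda>x. u x * exp (- A x)) x0 + (2 * \<eta> * P
      + (2 * c * avg B (\<lambda>x. w x * (\<Sum>p\<in>B. (a p x - d p x)\<^sup>2)) x0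
       + 2 * c * avg B (\<lambda>x. w x * (\<Sum>p\<in>B. (b p x - d p x)\<^sup>2)) x0))"
    by (simp only: avg_add avg_cmult assms)
  also have "\<dots> \<le> exp T * P\<^sup>2 + (2 * \<eta> * P + (2 * c * (8 * P) + 2 * c * (8 * P)))"
  proof (intro add_mono mult_left_mono)
    show "avg B (\<lambda>x. u x * exp (- A x)) x0 \<le> P\<^sup>2"
      using avg_exp_inc_le[of B k u x0] u(1) assms(1,2,9) by (simp add: A_def a_def)
    show "avg B (\<lambda>x. w x * (\<Sum>p\<in>B. (a p x - d p x)\<^sup>2)) x0 \<le> 8 * P"
      using avg_inc_diff_le[of B k u w x0, OF assms(1,2) u(1) w(1,2)] root assms(9) by (simp add: a_def d_def)
    show "avg B (\<lambda>x. w x * (\<Sum>p\<in>B. (b p x - d p x)\<^sup>2)) x0 \<le> 8 * P"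
      using avg_inc_diff_le[of B k v w x0, OF assms(1,2) v(1) w(1,3)] root assms(10) by (simp add: b_def d_def)
  qed (use c assms(12) in auto)
  also have "\<dots> = exp T * P\<^sup>2 + (2 * \<eta> + 64 * (1 + 1 / \<eta>) / T) * P"
    by (simp add: c_def distrib_right)
  finally show ?thesis .
qed

section \<open>Random orders and level sets\<close>

text \<open>Averages over the bits in \<open>W\<close> and over a uniform order of \<open>W\<close>
  at once: \<open>to_nat\<close> is a fixed injective ranking, and a uniform permutation in front of
  it makes the relative order on \<open>W\<close> uniform. Positions outside \<open>W\<close> carry
  the bit 0.\<close>

definition perm_avg :: "'p::countable set \<Rightarrow> (('p \<Rightarrow> nat) \<Rightarrow> 'p set \<Rightarrow> real) \<Rightarrow> real" where
  "perm_avg W \<phi> = (\<Sum>\<sigma> | \<sigma> permutes W. avg W (\<phi> (to_nat \<circ> \<sigma>)) {}) / fact (card W)"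

lemma perm_avg_diff: "perm_avg W (\<lambda>k x. \<phi> k x - \<psi> k x) = perm_avg W \<phi> - perm_avg W \<psi>"
  by (simp add: perm_avg_def avg_diff sum_subtractf diff_divide_distrib)

lemma perm_avg_cmult: "perm_avg W (\<lambda>k x. c * \<phi> k x) = c * perm_avg W \<phi>"
  by (simp add: perm_avg_def avg_cmult sum_distrib_left)

lemma perm_avg_sum: "perm_avg W (\<lambda>k x. \<Sum>i\<in>I. \<phi> i k x) = (\<Sum>i\<in>I. perm_avg W (\<phi> i))"
  unfolding perm_avg_def avg_sum by (subst sum.swap) (simp add: sum_divide_distrib)

lemma perm_avg_mono:
  assumes "\<And>k x. inj k \<Longrightarrow> \<phi> k x \<le> \<psi> k x"
  shows "perm_avg W \<phi> \<le> perm_avg W \<psi>"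
  unfolding perm_avg_def
  by (intro divide_right_mono sum_mono avg_mono assms inj_compose inj_to_nat) (auto dest: permutes_inj)

lemma perm_avg_nonneg:
  assumes "\<And>k x. \<phi> k x \<ge> 0"
  shows "perm_avg W \<phi> \<ge> 0"
  unfolding perm_avg_def
  by (intro divide_nonneg_nonneg sum_nonneg avg_nonneg assms) auto

lemma perm_avg_const:
  assumes "finite W"
  shows "perm_avg W (\<lambda>k. u) = avg W u {}"
  using card_permutations[OF refl assms] by (simp add: perm_avg_def)

lemma perm_avg_le:
  assumes "finite W" "\<And>k. inj k \<Longrightarrow> avg W (\<phi> k) {} \<le> c"
  shows "perm_avg W \<phi> \<le> c"
proof -
  have "(\<Sum>\<sigma> | \<sigma> permutes W. avg W (\<phi> (to_nat \<circ> \<sigma>)) {}) \<le> (\<Sum>\<sigma> | \<sigma> permutes W. c)"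
    by (intro sum_mono assms inj_compose inj_to_nat) (auto dest: permutes_inj)
  also have "\<dots> = c * fact (card W)"
    using card_permutations[OF refl assms(1)] by simp
  finally show ?thesis by (simp add: perm_avg_def field_simps)
qed

text \<open>The complements in \<open>W\<close> of \<open>J\<close> and of its image have the same
  cardinality.\<close>

lemma permutes_extend_inj:
  assumes "finite W" "J \<subseteq> W" "\<tau> ` J \<subseteq> W" "inj_on \<tau> J"
  obtains \<tau>' where "\<tau>' permutes W" "\<And>q. q \<in> J \<Longrightarrow> \<tau>' q = \<tau> q"
proof -
  have "card (W - J) = card (W - \<tau> ` J)"
    using assms finite_subset[OF assms(2)] by (simp add: card_Diff_subset card_image)
  then obtain h where h: "bij_betw h (W - J) (W - \<tau> ` J)"
    using assms(1) finite_same_card_bij by (metis finite_Diff)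
  define \<tau>' where "\<tau>' q = (if q \<in> J then \<tau> q else if q \<in> W then h q else q)" for q
  have 1: "bij_betw \<tau>' J (\<tau> ` J)"
    using assms(4) by (auto simp: bij_betw_def \<tau>'_def inj_on_def)
  have "bij_betw \<tau>' (W - J) (W - \<tau> ` J)"
    using h by (rule bij_betw_cong[THEN iffD1, rotated]) (auto simp: \<tau>'_def)
  hence "bij_betw \<tau>' (J \<union> (W - J)) (\<tau> ` J \<union> (W - \<tau> ` J))"
    by (intro bij_betw_combine 1) auto
  moreover have "J \<union> (W - J) = W" "\<tau> ` J \<union> (W - \<tau> ` J) = W" using assms by auto
  ultimately have "\<tau>' permutes W"
    using assms(2) by (intro bij_imp_permutes) (auto simp: \<tau>'_def)
  thus ?thesis by (rule that) (simp add: \<tau>'_def)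
qed

text \<open>A shift does not permute a finite window. But \<open>\<phi>\<close> reads ranks and bits
  in \<open>J\<close> only, so \<open>\<tau>\<close> can be replaced by a permutation of
  \<open>W\<close> that agrees with it on \<open>J\<close>, and the uniform laws of order and bits
  are invariant under that. This stands in for the shift invariance of a random order of all
  positions.\<close>

lemma perm_avg_reindex:
  assumes "finite W" "J \<subseteq> W" "\<tau> ` J \<subseteq> W" "inj_on \<tau> J"
    and loc: "\<And>k k' x y. (\<And>q. q \<in> J \<Longrightarrow> k q = k' q) \<Longrightarrow> x \<inter> J = y \<inter> J \<Longrightarrow> \<phi> k x = \<phi> k' y"
  shows "perm_avg W (\<lambda>k x. \<phi> (k \<circ> \<tau>) (\<tau> -` x)) = perm_avg W \<phi>"
proof -
  obtain \<tau>' where \<tau>': "\<tau>' permutes W" "\<And>q. q \<in> J \<Longrightarrow> \<tau>' q = \<tau> q"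
    using permutes_extend_inj[OF assms(1-4)] by metis
  have "perm_avg W (\<lambda>k x. \<phi> (k \<circ> \<tau>) (\<tau> -` x)) = perm_avg W (\<lambda>k x. \<phi> (k \<circ> \<tau>') (\<tau>' -` x))"
  proof -
    have "\<phi> (k \<circ> \<tau>) (\<tau> -` x) = \<phi> (k \<circ> \<tau>') (\<tau>' -` x)" for k x
      by (rule loc) (use \<tau>'(2) in auto)
    thus ?thesis by simp
  qed
  also have "\<dots> = (\<Sum>\<sigma> | \<sigma> permutes W. avg W (\<phi> (to_nat \<circ> (\<sigma> \<circ> \<tau>'))) {}) / fact (card W)"
  proof -
    have "avg W (\<lambda>x. \<psi> (\<tau>' -` x)) {} = avg W \<psi> {}" for \<psi>
      using avg_image[OF permutes_bij[OF \<tau>'(1)], of W "\<lambda>x. \<psi> (\<tau>' -` x)" "{}"]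
      by (simp add: permutes_image[OF \<tau>'(1)] inj_vimage_image_eq[OF permutes_inj[OF \<tau>'(1)]])
    thus ?thesis by (simp add: perm_avg_def comp_assoc)
  qed
  also have "\<dots> = perm_avg W \<phi>"
    unfolding perm_avg_def
    using sum_permutations_compose_right[OF \<tau>'(1), of "\<lambda>\<sigma>. avg W (\<phi> (to_nat \<circ> \<sigma>)) {}"]
    by simp
  finally show ?thesis .
qed

text \<open>The law of the level set \<open>{g. t \<le> q g}\<close> for uniform \<open>t\<close>.\<close>

definition level_mass :: "'g set \<Rightarrow> ('g \<Rightarrow> real) \<Rightarrow> 'g set \<Rightarrow> real" where
  "level_mass G q V = measure lborel {t. 0 < t \<and> t \<le> 1 \<and> {g \<in> G. t \<le> q g} = V}"

lemma level_mass_nonneg: "level_mass G q V \<ge> 0"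
  by (simp add: level_mass_def)

lemma sum_level_mass:
  assumes "finite G"
  shows "(\<Sum>V\<in>{V\<in>Pow G. P V}. level_mass G q V) = measure lborel {t. 0 < t \<and> t \<le> 1 \<and> P {g \<in> G. t \<le> q g}}"
proof -
  let ?A = "\<lambda>V. {t. 0 < t \<and> t \<le> 1 \<and> {g \<in> G. t \<le> q g} = V}"
  have m: "?A V \<in> sets lborel" if "V \<subseteq> G" for V
  proof -
    have "?A V = {0<..1} \<inter> (\<Inter>g\<in>G. {t. t \<le> q g \<longleftrightarrow> g \<in> V}) "
      using that by auto
    moreover have "(\<Inter>g\<in>G. {t. t \<le> q g \<longleftrightarrow> g \<in> V}) \<in> sets borel"
    proof (cases "G = {}")
      case False
      have "{t. t \<le> q g \<longleftrightarrow> g \<in> V} \<in> sets borel" for g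
        by (cases "g \<in> V") (simp_all add: not_le)
      thus ?thesis using assms False by (intro sets.finite_INT) auto
    qed simp
    ultimately show ?thesis by simp
  qed
  have fin: "emeasure lborel (?A V) \<noteq> \<infinity>" for V
  proof -
    have "emeasure lborel (?A V) \<le> emeasure lborel {0..1::real}" by (intro emeasure_mono) auto
    thus ?thesis by (auto simp: top_unique)
  qed
  have "(\<Sum>V\<in>{V\<in>Pow G. P V}. level_mass G q V) = measure lborel (\<Union>V\<in>{V\<in>Pow G. P V}. ?A V)"
    unfolding level_mass_def
    using assms m fin
    by (intro measure_finite_Union[symmetric]) (auto simp: disjoint_family_on_def)
  also have "(\<Union>V\<in>{V\<in>Pow G. P V}. ?A V) = {t. 0 < t \<and> t \<le> 1 \<and> P {g \<in> G. t \<le> q g}}" by auto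
  finally show ?thesis .
qed

lemma sum_level_mass_containing:
  assumes "finite G" "g \<in> G" "0 \<le> q g" "q g \<le> 1"
  shows "(\<Sum>V\<in>{V\<in>Pow G. g \<in> V}. level_mass G q V) = q g"
proof -
  have "{t. 0 < t \<and> t \<le> 1 \<and> g \<in> {g \<in> G. t \<le> q g}} = {0<..q g}" using assms by auto
  thus ?thesis unfolding sum_level_mass[OF assms(1)] using assms by simp
qed

text \<open>A level set contains \<open>g\<close> and misses \<open>h\<close> only for levels
  \<open>t\<close> with \<open>q h < t \<le> q g\<close>.\<close>

lemma sum_level_mass_separating:
  assumes "finite G" "\<And>g. 0 \<le> q g" "\<And>g. g \<notin> G \<Longrightarrow> q g = 0"
  shows "(\<Sum>V\<in>{V\<in>Pow G. g \<in> V \<and> h \<notin> V}. level_mass G q V) \<le> max 0 (q g - q h)"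
proof -
  have "measure lborel {t. 0 < t \<and> t \<le> 1 \<and> g \<in> {g \<in> G. t \<le> q g} \<and> h \<notin> {g \<in> G. t \<le> q g}}
    \<le> measure lborel {q h<..q g}"
  proof (rule measure_mono_fmeasurable)
    show "{t. 0 < t \<and> t \<le> 1 \<and> g \<in> {g \<in> G. t \<le> q g} \<and> h \<notin> {g \<in> G. t \<le> q g}} \<subseteq> {q h<..q g}"
      using assms(3) by force
    have "{t. 0 < t \<and> t \<le> 1 \<and> g \<in> {g \<in> G. t \<le> q g} \<and> h \<notin> {g \<in> G. t \<le> q g}}
      = (if g \<in> G then {0<..1} \<inter> {..q g} \<inter> (if h \<in> G then {q h<..} else UNIV) else {})" by auto
    thus "{t. 0 < t \<and> t \<le> 1 \<and> g \<in> {g \<in> G. t \<le> q g} \<and> h \<notin> {g \<in> G. t \<le> q g}} \<in> sets lborel" by simp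
    show "{q h<..q g} \<in> fmeasurable lborel"
      by (cases "q h \<le> q g") (auto simp: fmeasurable_def)
  qed
  also have "\<dots> = max 0 (q g - q h)"
    by (cases "q h \<le> q g") auto
  finally show ?thesis unfolding sum_level_mass[OF assms(1)] .
qed

lemma mem_translate_set: "h \<in> translate_set g E \<longleftrightarrow> g + h \<in> E"
  unfolding translate_set_def by (force simp flip: add.assoc intro: image_eqI[of _ _ "g + h"])

text \<open>Up to mass 0 the level set \<open>V\<close> lies in \<open>E\<close>. Seen from
  \<open>g\<close> in \<open>V\<close>, the two sets thus differ within the window only if some
  \<open>g + s\<close> in \<open>E\<close> is missing from \<open>V\<close>;
  \<open>sum_level_mass_separating\<close> bounds the mass of such \<open>V\<close>, and
  \<open>f\<close> changes by at most 2.\<close>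

lemma level_mass_rooted_sum:
  fixes q :: "'g::group_add \<Rightarrow> real"
  assumes "finite G" "finite S" and q: "\<And>g. 0 \<le> q g" "\<And>g. q g \<le> 1" "\<And>g. g \<notin> G \<Longrightarrow> q g = 0"
    and E: "\<And>g. g \<notin> E \<Longrightarrow> q g = 0"
    and f: "local_on S f" "\<And>E. \<bar>f E\<bar> \<le> (1::real)"
  shows "\<bar>(\<Sum>V\<in>Pow G - {{}}. level_mass G q V * (\<Sum>g\<in>V. f (translate_set g V)))
          - (\<Sum>g\<in>G. q g * f (translate_set g E))\<bar>
    \<le> 2 * (\<Sum>g\<in>G. \<Sum>s\<in>S. indicat_real E (g + s) * max 0 (q g - q (g + s)))"
proof -
  let ?m = "level_mass G q"
  have fin: "finite (Pow G)" using assms by simp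
  have swap: "(\<Sum>V\<in>Pow G. ?m V * (\<Sum>g\<in>V. h g V)) = (\<Sum>g\<in>G. \<Sum>V\<in>{V\<in>Pow G. g \<in> V}. ?m V * h g V)" for h
  proof -
    have "(\<Sum>V\<in>Pow G. ?m V * (\<Sum>g\<in>V. h g V)) = (\<Sum>V\<in>Pow G. \<Sum>g\<in>{g\<in>G. g \<in> V}. ?m V * h g V)"
      by (intro sum.cong refl) (auto simp: sum_distrib_left intro!: sum.cong)
    also have "\<dots> = (\<Sum>g\<in>G. \<Sum>V\<in>{V\<in>Pow G. g \<in> V}. ?m V * h g V)"
      using fin assms(1) by (rule sum.swap_restrict)
    finally show ?thesis .
  qed
  have "(\<Sum>V\<in>Pow G - {{}}. ?m V * (\<Sum>g\<in>V. f (translate_set g V)))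
      = (\<Sum>V\<in>Pow G. ?m V * (\<Sum>g\<in>V. f (translate_set g V)))"
    using fin by (intro sum.mono_neutral_left) auto
  also have "\<dots> = (\<Sum>g\<in>G. \<Sum>V\<in>{V\<in>Pow G. g \<in> V}. ?m V * f (translate_set g V))" by (rule swap)
  finally have 1: "(\<Sum>V\<in>Pow G - {{}}. ?m V * (\<Sum>g\<in>V. f (translate_set g V))) = \<dots>" .
  have 2: "(\<Sum>g\<in>G. q g * f (translate_set g E)) = (\<Sum>g\<in>G. \<Sum>V\<in>{V\<in>Pow G. g \<in> V}. ?m V * f (translate_set g E))"
    by (intro sum.cong refl)
       (simp only: sum_distrib_right[symmetric] sum_level_mass_containing[OF assms(1) _ q(1,2)])
  \<comment> \<open>Off \<open>E\<close> the weight is 0, so no level \<open>t > 0\<close> admits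
    such a point.\<close>
  have in0: "?m V = 0" if "V \<subseteq> G" "h \<in> V" "h \<notin> E" for V h
  proof -
    have "h \<in> G" using that by auto
    have "?m V \<le> (\<Sum>V\<in>{V\<in>Pow G. h \<in> V}. ?m V)"
      using that fin by (intro member_le_sum level_mass_nonneg) auto
    also have "\<dots> = 0"
      unfolding sum_level_mass_containing[OF assms(1) \<open>h \<in> G\<close> q(1,2)] by (rule E[OF that(3)])
    finally show ?thesis using level_mass_nonneg[of G q V] by simp
  qed
  have pt: "\<bar>?m V * f (translate_set g V) - ?m V * f (translate_set g E)\<bar>
      \<le> 2 * (\<Sum>s\<in>S. indicat_real E (g + s) * (if g + s \<notin> V then ?m V else 0))"
    if V: "V \<subseteq> G" "g \<in> V" for V g
  proof (cases "translate_set g V \<inter> S = translate_set g E \<inter> S \<or> ?m V = 0")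
    case True
    hence z: "\<bar>?m V * f (translate_set g V) - ?m V * f (translate_set g E)\<bar> = 0"
      using local_onD[OF f(1), of "translate_set g V" "translate_set g E"] by fastforce
    show ?thesis unfolding z by (simp add: sum_nonneg level_mass_nonneg)
  next
    case False
    hence "\<exists>s\<in>S. (g + s \<in> V) \<noteq> (g + s \<in> E)"
      unfolding set_eq_iff by (auto simp: mem_translate_set)
    then obtain s where s: "s \<in> S" "(g + s \<in> V) \<noteq> (g + s \<in> E)" by blast
    with False in0[OF V(1)] have s': "g + s \<in> E" "g + s \<notin> V" by auto
    have "\<bar>?m V * f (translate_set g V) - ?m V * f (translate_set g E)\<bar>
        = ?m V * \<bar>f (translate_set g V) - f (translate_set g E)\<bar>"
      by (simp add: abs_mult level_mass_nonneg flip: right_diff_distrib)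
    also have "\<dots> \<le> ?m V * 2"
      using f(2)[of "translate_set g V"] f(2)[of "translate_set g E"]
      by (intro mult_left_mono level_mass_nonneg) auto
    also have "\<dots> = 2 * (indicat_real E (g + s) * (if g + s \<notin> V then ?m V else 0))" using s' by simp
    also have "\<dots> \<le> 2 * (\<Sum>s\<in>S. indicat_real E (g + s) * (if g + s \<notin> V then ?m V else 0))"
      using s(1) assms(2)
      by (intro mult_left_mono member_le_sum[where f="\<lambda>s. indicat_real E (g + s) * (if g + s \<notin> V then ?m V else 0)"])
         (auto simp: level_mass_nonneg)
    finally show ?thesis .
  qed
  have "\<bar>(\<Sum>V\<in>Pow G - {{}}. ?m V * (\<Sum>g\<in>V. f (translate_set g V))) - (\<Sum>g\<in>G. q g * f (translate_set g E))\<bar>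
     = \<bar>\<Sum>g\<in>G. \<Sum>V\<in>{V\<in>Pow G. g \<in> V}. ?m V * f (translate_set g V) - ?m V * f (translate_set g E)\<bar>"
    unfolding 1 2 by (simp add: sum_subtractf)
  also have "\<dots> \<le> (\<Sum>g\<in>G. \<Sum>V\<in>{V\<in>Pow G. g \<in> V}. \<bar>?m V * f (translate_set g V) - ?m V * f (translate_set g E)\<bar>)"
    by (intro order.trans[OF sum_abs] sum_mono sum_abs)
  also have "\<dots> \<le> (\<Sum>g\<in>G. \<Sum>V\<in>{V\<in>Pow G. g \<in> V}. 2 * (\<Sum>s\<in>S. indicat_real E (g + s) * (if g + s \<notin> V then ?m V else 0)))"
    by (intro sum_mono pt) auto
  also have "\<dots> = 2 * (\<Sum>g\<in>G. \<Sum>V\<in>{V\<in>Pow G. g \<in> V}. \<Sum>s\<in>S. indicat_real E (g + s) * (if g + s \<notin> V then ?m V else 0))"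
    by (simp only: sum_distrib_left)
  also have "\<dots> = 2 * (\<Sum>g\<in>G. \<Sum>s\<in>S. indicat_real E (g + s) * (\<Sum>V\<in>{V\<in>Pow G. g \<in> V \<and> g + s \<notin> V}. ?m V))"
  proof -
    have "(\<Sum>V\<in>{V\<in>Pow G. g \<in> V}. \<Sum>s\<in>S. indicat_real E (g + s) * (if g + s \<notin> V then ?m V else 0))
       = (\<Sum>s\<in>S. indicat_real E (g + s) * (\<Sum>V\<in>{V\<in>Pow G. g \<in> V \<and> g + s \<notin> V}. ?m V))" for g
    proof -
      have "(\<Sum>V\<in>{V\<in>Pow G. g \<in> V}. if g + s \<notin> V then ?m V else 0)
         = (\<Sum>V\<in>{V\<in>Pow G. g \<in> V \<and> g + s \<notin> V}. ?m V)" for s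
        using fin by (intro sum.mono_neutral_cong_right) auto
      thus ?thesis by (subst sum.swap) (simp only: sum_distrib_left[symmetric])
    qed
    thus ?thesis by simp
  qed
  also have "\<dots> \<le> 2 * (\<Sum>g\<in>G. \<Sum>s\<in>S. indicat_real E (g + s) * max 0 (q g - q (g + s)))"
    using assms(1) q
    by (intro mult_left_mono sum_mono sum_level_mass_separating) auto
  finally show ?thesis .
qed

section \<open>Finite unimodular models of cylinder sets\<close>

definition shift_pos :: "'g::group_add \<Rightarrow> 'g \<times> nat \<Rightarrow> 'g \<times> nat" where
  "shift_pos g p = (g + fst p, snd p)"

lemma shift_pos_add: "shift_pos g (shift_pos h p) = shift_pos (g + h) p"
  by (simp add: shift_pos_def add.assoc)

lemma shift_pos_0 [simp]: "shift_pos 0 p = p"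
  by (simp add: shift_pos_def)

lemma bij_shift_pos: "bij (shift_pos g)"
  by (rule bij_betw_byWitness[where f'="shift_pos (- g)"]) (auto simp: shift_pos_add)

lemma inj_shift_pos: "inj (shift_pos g)"
  using bij_shift_pos by (rule bij_is_inj)

lemma vimage_shift_pos_add: "shift_pos h -` (shift_pos g -` x) = shift_pos (g + h) -` x"
  by (simp add: vimage_def shift_pos_add)

text \<open>The counterpart of \<open>iota\<close> for bit configurations, as
  \<open>bits_shift_inv\<close> will show.\<close>

definition occ :: "('g::group_add \<times> nat) set set \<Rightarrow> ('g \<times> nat) set \<Rightarrow> 'g set" where
  "occ C x = {g. shift_pos g -` x \<in> C}"

lemma translate_occ: "translate_set g (occ C x) = occ C (shift_pos g -` x)"
  by (rule set_eqI) (simp add: mem_translate_set occ_def vimage_shift_pos_add)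

lemma local_on_indicator: "local_on F (\<lambda>x. x \<in> C) \<Longrightarrow> local_on F (indicat_real C)"
  by (simp add: local_on_def indicator_def)

lemma local_on_mono: "local_on F u \<Longrightarrow> F \<subseteq> F' \<Longrightarrow> local_on F' u"
  unfolding local_on_def by (metis Int_assoc Int_absorb1)

lemma local_on_shift:
  assumes "local_on F u"
  shows "local_on (shift_pos g ` F) (\<lambda>x. u (shift_pos g -` x))"
  unfolding local_on_def
proof
  fix x
  show "u (shift_pos g -` x) = u (shift_pos g -` (x \<inter> shift_pos g ` F))"
    by (rule local_onD[OF assms]) (auto simp: inj_image_mem_iff[OF inj_shift_pos])
qed

lemma local_on_occ:
  assumes "local_on F (\<lambda>x. x \<in> C)" "local_on S f"
  shows "local_on (\<Union>s\<in>S. shift_pos s ` F) (\<lambda>x. f (occ C x))"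
  unfolding local_on_def
proof
  fix x
  let ?J = "\<Union>s\<in>S. shift_pos s ` F"
  have "(s \<in> occ C x) = (s \<in> occ C (x \<inter> ?J))" if "s \<in> S" for s
    unfolding occ_def mem_Collect_eq
    by (rule local_onD[OF assms(1)]) (use that in auto)
  thus "f (occ C x) = f (occ C (x \<inter> ?J))"
    by (intro local_onD[OF assms(2)]) auto
qed

lemma avg_shift:
  assumes "local_on F u" "finite W" "F \<subseteq> W" "shift_pos g ` F \<subseteq> W"
  shows "avg W (\<lambda>x. u (shift_pos g -` x)) {} = avg W u {}"
proof -
  have "avg W (\<lambda>x. u (shift_pos g -` x)) {} = avg (shift_pos g ` F) (\<lambda>x. u (shift_pos g -` x)) {}"
    using avg_local[OF assms(2) local_on_shift[OF assms(1)]] assms(4) by (simp add: Int_absorb1)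
  also have "\<dots> = avg F u {}"
    by (simp add: avg_image[OF bij_shift_pos] inj_vimage_image_eq[OF inj_shift_pos])
  also have "\<dots> = avg W u {}"
    using avg_local[OF assms(2,1)] assms(3) by (simp add: Int_absorb1)
  finally show ?thesis .
qed

text \<open>\<open>m V\<close> is the mass, summed over \<open>i\<close>, with which
  \<open>V\<close> is the level set of the weights put on the position \<open>(0, i)\<close>.
  Rooting at \<open>g\<close> amounts after a shift to weighing the position \<open>(- g, i)\<close>
  for the event at the identity; summed over \<open>g\<close> and \<open>i\<close>, these weights
  give back \<open>C\<close> up to degenerate configurations. The other error comes from the pairs
  broken by the level set, one term for each \<open>s\<close>.\<close>

lemma finite_model:
  fixes C :: "('g::{group_add,countable} \<times> nat) set set"
  assumes "finite F" "finite S" "0 \<in> S" and C: "local_on F (\<lambda>x. x \<in> C)" and "T > 0" "\<eta> > 0"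
  defines "P \<equiv> avg F (indicat_real C) {}" and "J \<equiv> \<Union>s\<in>S. shift_pos s ` F"
  shows "\<exists>G m. finite G \<and> (\<forall>V. m V \<ge> 0) \<and> (\<forall>f. local_on S f \<longrightarrow> (\<forall>E. \<bar>f E\<bar> \<le> 1) \<longrightarrow>
     \<bar>(\<Sum>V\<in>Pow G - {{}}. m V * (\<Sum>g\<in>V. f (translate_set g V)))
       - avg J (\<lambda>x. indicat_real C x * f (occ C x)) {}\<bar>
     \<le> exp T * P\<^sup>2 + 2 * card S * (exp T * P\<^sup>2 + (2 * \<eta> + 64 * (1 + 1 / \<eta>) / T) * P))"
proof -
  define u where "u = indicat_real C"
  define H K where "H = fst ` F" and "K = snd ` F"
  \<comment> \<open>The event at \<open>g\<close> reads a position over the identity only if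
    \<open>- g\<close> is in \<open>H\<close>; hence the level sets are finite.\<close>
  define G where "G = uminus ` H"
  \<comment> \<open>Besides \<open>J\<close> its translates by \<open>G\<close>, so that every shift
    in use injects \<open>J\<close> into \<open>W\<close>, as \<open>perm_avg_reindex\<close>
    demands.\<close>
  define W where "W = J \<union> (\<Union>g\<in>G. shift_pos g ` J)"
  \<comment> \<open>By \<open>wt_image\<close> this is the weight of the position
    \<open>(0, i)\<close> for the event at \<open>g\<close>, written in coordinates centred at
    \<open>g\<close>.\<close>
  define q where "q k x i g = wt (k \<circ> shift_pos g) F u (- g, i) (shift_pos g -` x)" for k x i g
  define m where "m V = (\<Sum>i\<in>K. perm_avg W (\<lambda>k x. level_mass G (q k x i) V))" for V
  \<comment> \<open>The error term of \<open>level_mass_rooted_sum\<close> re-rooted at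
    \<open>g\<close>: the excess at \<open>p\<close> of the weight for the event at the identity
    over that for the event at \<open>s\<close>, when the latter occurs.\<close>
  define e where "e s k p x = indicat_real (occ C x) s *
     max 0 (wt k F u p x - wt (k \<circ> shift_pos s) F u (shift_pos (- s) p) (shift_pos s -` x))" for s k p x

  have fin: "finite G" "finite H" "finite K" "finite J" "finite W"
    using assms by (auto simp: G_def H_def K_def W_def)
  have u01: "u x = 0 \<or> u x = 1" for x by (auto simp: u_def indicator_def)
  have uloc: "local_on F u" unfolding u_def by (rule local_on_indicator[OF C])
  have sFJ: "shift_pos s ` F \<subseteq> J" if "s \<in> S" for s using that by (auto simp: J_def)
  have FJ: "F \<subseteq> J" using sFJ[OF \<open>0 \<in> S\<close>] by simp
  have JW: "J \<subseteq> W" and gJW: "\<And>g. g \<in> G \<Longrightarrow> shift_pos g ` J \<subseteq> W" by (auto simp: W_def)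
  have WF: "W \<inter> F = F" and WJ: "W \<inter> J = J" using FJ JW by auto
  have PW: "avg W u {} = P"
    using avg_local[OF fin(5) uloc] FJ JW by (simp add: P_def u_def Int_absorb1 subset_trans[OF FJ JW])
  have FHK: "F \<subseteq> H \<times> K" by (force simp: H_def K_def)
  have q: "0 \<le> q k x i g" "q k x i g \<le> 1" for k x i g
    unfolding q_def using u01[of "shift_pos g -` x"] by (auto intro!: wt_nonneg wt_le_1 assms(1))
  have qG: "q k x i g = 0" if "g \<notin> G" for k x i g
  proof -
    have "(- g, i) \<notin> F" using that by (force simp: G_def H_def image_iff)
    thus ?thesis by (simp add: q_def wt_def)
  qed
  have qE: "q k x i g = 0" if "g \<notin> occ C x" for k x i g
    using that by (simp add: q_def wt_def occ_def u_def)

  have reindex: "(\<Sum>i\<in>K. \<Sum>g\<in>G. h (- g, i)) = (\<Sum>p\<in>H \<times> K. h p)" for h :: "'g \<times> nat \<Rightarrow> real"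
  proof -
    have "(\<Sum>g\<in>G. h (- g, i)) = (\<Sum>a\<in>H. h (a, i))" for i
      unfolding G_def by (subst sum.reindex) auto
    thus ?thesis by (simp add: sum.cartesian_product') (rule sum.swap)
  qed

  \<comment> \<open>The shift takes the root \<open>g\<close> to the identity and the position
    \<open>(0, i)\<close> to \<open>(- g, i)\<close>; random order and bits do not notice
    it.\<close>
  have inv_main: "perm_avg W (\<lambda>k x. q k x i g * f (translate_set g (occ C x)))
      = perm_avg W (\<lambda>k x. wt k F u (- g, i) x * f (occ C x))"
    if "g \<in> G" "local_on S f" for f i g
    unfolding q_def translate_occ
  proof (rule perm_avg_reindex[OF fin(5) JW gJW[OF that(1)] inj_on_subset[OF inj_shift_pos subset_UNIV]])
    fix k k' :: "'g \<times> nat \<Rightarrow> nat" and x y :: "('g \<times> nat) set"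
    assume k: "\<And>q. q \<in> J \<Longrightarrow> k q = k' q" and xy: "x \<inter> J = y \<inter> J"
    have "wt k F u (- g, i) x = wt k' F u (- g, i) y"
      using k xy FJ by (intro wt_cong[OF uloc]) auto
    moreover have "f (occ C x) = f (occ C y)"
      using local_onD[OF local_on_occ[OF C that(2)]] xy unfolding J_def by blast
    ultimately show "wt k F u (- g, i) x * f (occ C x) = wt k' F u (- g, i) y * f (occ C y)" by simp
  qed

  have inv_err: "perm_avg W (\<lambda>k x. indicat_real (occ C x) (g + s) * max 0 (q k x i g - q k x i (g + s)))
      = perm_avg W (\<lambda>k x. e s k (- g, i) x)"
    if "g \<in> G" "s \<in> S" for i g s
  proof -
    have "indicat_real (occ C x) (g + s) * max 0 (q k x i g - q k x i (g + s))
        = e s (k \<circ> shift_pos g) (- g, i) (shift_pos g -` x)" for k x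
    proof -
      have "shift_pos g \<circ> shift_pos s = shift_pos (g + s)" by (auto simp: shift_pos_add)
      moreover have "shift_pos (- s) (- g, i) = (- (g + s), i)"
        by (simp add: shift_pos_def minus_add)
      moreover have "indicat_real (occ C (shift_pos g -` x)) s = indicat_real (occ C x) (g + s)"
        by (simp add: indicator_def occ_def vimage_shift_pos_add)
      ultimately show ?thesis
        by (simp add: e_def q_def comp_assoc vimage_shift_pos_add)
    qed
    moreover have "perm_avg W (\<lambda>k x. e s (k \<circ> shift_pos g) (- g, i) (shift_pos g -` x))
        = perm_avg W (\<lambda>k x. e s k (- g, i) x)"
    proof (rule perm_avg_reindex[OF fin(5) JW gJW[OF that(1)] inj_on_subset[OF inj_shift_pos subset_UNIV]])
      fix k k' :: "'g \<times> nat \<Rightarrow> nat" and x y :: "('g \<times> nat) set"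
      assume k: "\<And>q. q \<in> J \<Longrightarrow> k q = k' q" and xy: "x \<inter> J = y \<inter> J"
      have sxy: "shift_pos s -` x \<inter> F = shift_pos s -` y \<inter> F"
        using xy sFJ[OF that(2)] by blast
      have "wt k F u (- g, i) x = wt k' F u (- g, i) y"
        using k xy FJ by (intro wt_cong[OF uloc]) auto
      moreover have "wt (k \<circ> shift_pos s) F u p (shift_pos s -` x) = wt (k' \<circ> shift_pos s) F u p (shift_pos s -` y)" for p
        unfolding comp_def
        by (intro wt_cong[OF uloc sxy] k subsetD[OF sFJ[OF that(2)]] imageI)
      moreover have "indicat_real (occ C x) s = indicat_real (occ C y) s"
        using local_onD[OF C sxy] by (simp add: indicator_def occ_def)
      ultimately show "e s k (- g, i) x = e s k' (- g, i) y" by (simp add: e_def)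
    qed
    ultimately show ?thesis by simp
  qed

  have e_le: "perm_avg W (\<lambda>k x. \<Sum>p\<in>H \<times> K. e s k p x)
      \<le> exp T * P\<^sup>2 + (2 * \<eta> + 64 * (1 + 1 / \<eta>) / T) * P" if s: "s \<in> S" for s
  proof (rule perm_avg_le[OF fin(5)])
    fix k :: "'g \<times> nat \<Rightarrow> nat" assume k: "inj k"
    define v where "v x = u (shift_pos s -` x)" for x
    let ?F' = "shift_pos s ` F"
    have v01: "v x = 0 \<or> v x = 1" for x using u01 by (simp add: v_def)
    have vloc: "local_on ?F' v" unfolding v_def by (rule local_on_shift[OF uloc])
    have PWv: "avg W v {} = P"
      unfolding v_def using avg_shift[OF uloc fin(5)] FJ JW sFJ[OF s] PW by blast
    \<comment> \<open>Transported by \<open>shift_pos s\<close>, both weights refer to the same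
      order and the same position, as in \<open>avg_max_wt_diff_le\<close>.\<close>
    have e_eq: "e s k p x = v x * max 0 (wt k F u p x - wt k ?F' v p x)" for p x
    proof -
      have "wt k ?F' v (shift_pos s (shift_pos (- s) p)) x
          = wt (k \<circ> shift_pos s) F (\<lambda>x. v (shift_pos s ` x)) (shift_pos (- s) p) (shift_pos s -` x)"
        by (rule wt_image[OF bij_shift_pos])
      moreover have "(\<lambda>x. v (shift_pos s ` x)) = u"
        by (simp add: v_def inj_vimage_image_eq[OF inj_shift_pos])
      ultimately show ?thesis
        by (simp add: e_def shift_pos_add v_def u_def indicator_def occ_def)
    qed
    have "(\<Sum>p\<in>H \<times> K. e s k p x) \<le> v x * (\<Sum>p\<in>W. max 0 (wt k F u p x - wt k ?F' v p x))" for x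
    proof -
      have vn: "v x \<ge> 0" "wt k ?F' v p x \<ge> 0" for p using v01[of x] by (auto intro!: wt_nonneg)
      have "(\<Sum>p\<in>H \<times> K. e s k p x) = (\<Sum>p\<in>F. e s k p x)"
        using FHK fin vn by (intro sum.mono_neutral_right) (auto simp: e_eq wt_def[of k F u])
      also have "\<dots> \<le> (\<Sum>p\<in>W. e s k p x)"
        using FJ JW fin vn by (intro sum_mono2) (auto simp: e_eq)
      finally show ?thesis by (simp add: e_eq sum_distrib_left)
    qed
    hence "avg W (\<lambda>x. \<Sum>p\<in>H \<times> K. e s k p x) {}
        \<le> avg W (\<lambda>x. v x * (\<Sum>p\<in>W. max 0 (wt k F u p x - wt k ?F' v p x))) {}"
      by (intro avg_mono)
    also have "\<dots> \<le> exp T * P\<^sup>2 + (2 * \<eta> + 64 * (1 + 1 / \<eta>) / T) * P"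
      using FJ JW sFJ[OF s] assms
      by (intro avg_max_wt_diff_le[OF fin(5) inj_on_subset[OF k subset_UNIV] _ _ u01 uloc v01 vloc PW PWv]) auto
    finally show "avg W (\<lambda>x. \<Sum>p\<in>H \<times> K. e s k p x) {} \<le> exp T * P\<^sup>2 + (2 * \<eta> + 64 * (1 + 1 / \<eta>) / T) * P" .
  qed

  \<comment> \<open>When all increments vanish, the exponential in \<open>avg_exp_inc_le\<close>
    equals 1, so such configurations of the event cost at most \<open>P\<^sup>2\<close>. The factor
    \<open>exp T\<close> gives the error terms a common shape.\<close>
  have degenerate: "perm_avg W (\<lambda>k x. if (\<Sum>q\<in>F. (inc k F u q x)\<^sup>2) = 0 then u x else 0) \<le> exp T * P\<^sup>2"
  proof (rule perm_avg_le[OF fin(5)])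
    fix k :: "'g \<times> nat \<Rightarrow> nat" assume k: "inj k"
    let ?\<psi> = "\<lambda>x. if (\<Sum>q\<in>F. (inc k F u q x)\<^sup>2) = 0 then u x else 0"
    have lp: "local_on F ?\<psi>"
      unfolding local_on_def
    proof
      fix x
      have "inc k F u q x = inc k F u q (x \<inter> F)" if "q \<in> F" for q
        by (rule inc_cong[OF uloc]) (use that in auto)
      moreover have "u x = u (x \<inter> F)" by (rule local_onD[OF uloc]) auto
      ultimately show "?\<psi> x = ?\<psi> (x \<inter> F)" by simp
    qed
    have "avg W ?\<psi> {} = avg F ?\<psi> {}"
      using avg_local[OF fin(5) lp, of "{}"] unfolding WF .
    also have "\<dots> \<le> avg F (\<lambda>x. u x * exp (- (\<Sum>q\<in>F. (inc k F u q x)\<^sup>2))) {}"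
    proof (rule avg_mono)
      fix x show "?\<psi> x \<le> u x * exp (- (\<Sum>q\<in>F. (inc k F u q x)\<^sup>2))"
        using u01[of x] by auto
    qed
    also have "\<dots> \<le> P\<^sup>2"
      using avg_exp_inc_le[of F k u "{}"] assms(1) inj_on_subset[OF k subset_UNIV] u01
      by (simp add: P_def u_def)
    also have "\<dots> \<le> exp T * P\<^sup>2" using \<open>T > 0\<close> by (simp add: mult_le_cancel_right1)
    finally show "avg W ?\<psi> {} \<le> exp T * P\<^sup>2" .
  qed

  have "\<bar>(\<Sum>V\<in>Pow G - {{}}. m V * (\<Sum>g\<in>V. f (translate_set g V)))
       - avg J (\<lambda>x. indicat_real C x * f (occ C x)) {}\<bar>
     \<le> exp T * P\<^sup>2 + 2 * card S * (exp T * P\<^sup>2 + (2 * \<eta> + 64 * (1 + 1 / \<eta>) / T) * P)"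
    if f: "local_on S f" "\<And>E. \<bar>f E\<bar> \<le> 1" for f
  proof -
    let ?N = "\<lambda>i k x. \<Sum>V\<in>Pow G - {{}}. level_mass G (q k x i) V * (\<Sum>g\<in>V. f (translate_set g V))"
    let ?M = "\<lambda>i k x. \<Sum>g\<in>G. q k x i g * f (translate_set g (occ C x))"
    let ?R = "\<lambda>i k x. \<Sum>g\<in>G. \<Sum>s\<in>S. indicat_real (occ C x) (g + s) * max 0 (q k x i g - q k x i (g + s))"
    have N: "(\<Sum>V\<in>Pow G - {{}}. m V * (\<Sum>g\<in>V. f (translate_set g V))) = (\<Sum>i\<in>K. perm_avg W (?N i))"
    proof -
      have "(\<Sum>V\<in>Pow G - {{}}. m V * (\<Sum>g\<in>V. f (translate_set g V)))
        = (\<Sum>V\<in>Pow G - {{}}. \<Sum>i\<in>K. perm_avg W (\<lambda>k x. level_mass G (q k x i) V * (\<Sum>g\<in>V. f (translate_set g V))))"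
        unfolding m_def sum_distrib_right
        by (intro sum.cong refl) (simp add: perm_avg_cmult[symmetric] mult.commute)
      also have "\<dots> = (\<Sum>i\<in>K. perm_avg W (?N i))"
        by (subst sum.swap) (simp add: perm_avg_sum)
      finally show ?thesis .
    qed
    have NM: "\<bar>(\<Sum>i\<in>K. perm_avg W (?N i)) - (\<Sum>i\<in>K. perm_avg W (?M i))\<bar>
        \<le> (\<Sum>i\<in>K. perm_avg W (\<lambda>k x. 2 * ?R i k x))"
    proof -
      have pt: "\<bar>?N i k x - ?M i k x\<bar> \<le> 2 * ?R i k x" for i k x
        by (rule level_mass_rooted_sum[OF fin(1) assms(2) q qG qE f])
      have pt': "?N i k x - ?M i k x \<le> 2 * ?R i k x" "?M i k x - ?N i k x \<le> 2 * ?R i k x" for i k x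
        using pt[where i=i and k=k and x=x] by (simp_all only: abs_le_iff minus_diff_eq)
      have "perm_avg W (?N i) - perm_avg W (?M i) \<le> perm_avg W (\<lambda>k x. 2 * ?R i k x)" for i
        unfolding perm_avg_diff[symmetric] by (intro perm_avg_mono pt')
      moreover have "perm_avg W (?M i) - perm_avg W (?N i) \<le> perm_avg W (\<lambda>k x. 2 * ?R i k x)" for i
        unfolding perm_avg_diff[symmetric] by (intro perm_avg_mono pt')
      ultimately have "\<bar>perm_avg W (?N i) - perm_avg W (?M i)\<bar> \<le> perm_avg W (\<lambda>k x. 2 * ?R i k x)" for i
        unfolding abs_le_iff minus_diff_eq by blast
      thus ?thesis unfolding sum_subtractf[symmetric] by (intro order.trans[OF sum_abs] sum_mono)
    qed
    have R: "(\<Sum>i\<in>K. perm_avg W (\<lambda>k x. 2 * ?R i k x))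
        \<le> 2 * card S * (exp T * P\<^sup>2 + (2 * \<eta> + 64 * (1 + 1 / \<eta>) / T) * P)"
    proof -
      have "(\<Sum>i\<in>K. perm_avg W (\<lambda>k x. 2 * ?R i k x)) = 2 * (\<Sum>i\<in>K. \<Sum>g\<in>G. \<Sum>s\<in>S. perm_avg W (\<lambda>k x. e s k (- g, i) x))"
        unfolding perm_avg_cmult perm_avg_sum sum_distrib_left
        by (intro sum.cong refl arg_cong[where f="(*) 2"] inv_err)
      also have "(\<Sum>i\<in>K. \<Sum>g\<in>G. \<Sum>s\<in>S. perm_avg W (\<lambda>k x. e s k (- g, i) x))
          = (\<Sum>p\<in>H \<times> K. \<Sum>s\<in>S. perm_avg W (\<lambda>k x. e s k p x))"
        by (rule reindex)
      also have "\<dots> = (\<Sum>s\<in>S. perm_avg W (\<lambda>k x. \<Sum>p\<in>H \<times> K. e s k p x))"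
        unfolding perm_avg_sum by (rule sum.swap)
      also have "\<dots> \<le> (\<Sum>s\<in>S. exp T * P\<^sup>2 + (2 * \<eta> + 64 * (1 + 1 / \<eta>) / T) * P)"
        by (intro sum_mono e_le)
      finally show ?thesis by simp
    qed
    \<comment> \<open>Mass transport: the sum over roots \<open>g\<close> has become a sum over all
      positions of the event at the identity, where the weights add up.\<close>
    have M: "(\<Sum>i\<in>K. perm_avg W (?M i))
       = perm_avg W (\<lambda>k x. (if (\<Sum>q\<in>F. (inc k F u q x)\<^sup>2) = 0 then 0 else u x) * f (occ C x))"
    proof -
      have "(\<Sum>i\<in>K. perm_avg W (?M i)) = (\<Sum>i\<in>K. \<Sum>g\<in>G. perm_avg W (\<lambda>k x. wt k F u (- g, i) x * f (occ C x)))"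
        unfolding perm_avg_sum by (intro sum.cong refl inv_main f)
      also have "\<dots> = (\<Sum>p\<in>H \<times> K. perm_avg W (\<lambda>k x. wt k F u p x * f (occ C x)))" by (rule reindex)
      also have "\<dots> = perm_avg W (\<lambda>k x. (\<Sum>p\<in>H \<times> K. wt k F u p x) * f (occ C x))"
        unfolding sum_distrib_right perm_avg_sum ..
      finally show ?thesis using fin FHK by (simp add: sum_wt)
    qed
    have A: "avg J (\<lambda>x. u x * f (occ C x)) {} = perm_avg W (\<lambda>k x. u x * f (occ C x))"
    proof -
      have lp: "local_on J (\<lambda>x. u x * f (occ C x))"
        unfolding local_on_def
      proof
        fix x
        have "u x = u (x \<inter> J)" by (rule local_onD[OF local_on_mono[OF uloc FJ]]) auto
        moreover have "f (occ C x) = f (occ C (x \<inter> J))"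
          by (rule local_onD[OF local_on_occ[OF C f(1), folded J_def]]) auto
        ultimately show "u x * f (occ C x) = u (x \<inter> J) * f (occ C (x \<inter> J))" by simp
      qed
      have "avg W (\<lambda>x. u x * f (occ C x)) {} = avg J (\<lambda>x. u x * f (occ C x)) {}"
        using avg_local[OF fin(5) lp, of "{}"] unfolding WJ .
      thus ?thesis unfolding perm_avg_const[OF fin(5)] ..
    qed
    have MA: "\<bar>(\<Sum>i\<in>K. perm_avg W (?M i)) - avg J (\<lambda>x. u x * f (occ C x)) {}\<bar> \<le> exp T * P\<^sup>2"
    proof -
      let ?D = "\<lambda>k x. if (\<Sum>q\<in>F. (inc k F u q x)\<^sup>2) = 0 then u x else 0"
      let ?L = "\<lambda>k x. (if (\<Sum>q\<in>F. (inc k F u q x)\<^sup>2) = 0 then 0 else u x) * f (occ C x)"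
      have pt: "?L k x - u x * f (occ C x) \<le> ?D k x" "u x * f (occ C x) - ?L k x \<le> ?D k x" for k x
        using f(2)[of "occ C x"] u01[of x] by auto
      have "perm_avg W ?L - perm_avg W (\<lambda>k x. u x * f (occ C x)) \<le> perm_avg W ?D"
        unfolding perm_avg_diff[symmetric] by (intro perm_avg_mono pt)
      moreover have "perm_avg W (\<lambda>k x. u x * f (occ C x)) - perm_avg W ?L \<le> perm_avg W ?D"
        unfolding perm_avg_diff[symmetric] by (intro perm_avg_mono pt)
      ultimately show ?thesis unfolding M A using degenerate by linarith
    qed
    show ?thesis unfolding N using NM R MA unfolding u_def by linarith
  qed
  moreover have "m V \<ge> 0" for V
    unfolding m_def by (intro sum_nonneg perm_avg_nonneg level_mass_nonneg)
  ultimately show ?thesis using fin(1) by blast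
qed

section \<open>The space of rooted subsets\<close>

lemma topspace_subsets_top [simp]: "topspace subsets_top = UNIV"
  by (auto simp: subsets_top_def)

lemma openin_subsets_top_window:
  assumes "openin subsets_top U" "E \<in> U"
  shows "\<exists>S. finite S \<and> (\<forall>E'. E' \<inter> S = E \<inter> S \<longrightarrow> E' \<in> U)"
proof -
  have "generate_topology_on (\<Union>g. {{E. g \<in> E}, {E. g \<notin> E}}) U"
    using assms(1) unfolding subsets_top_def by (simp add: openin_topology_generated_by)
  from this assms(2) show ?thesis
  proof (induction arbitrary: E)
    case (Int a b)
    then obtain S1 S2 where "finite S1" "\<forall>E'. E' \<inter> S1 = E \<inter> S1 \<longrightarrow> E' \<in> a"
      "finite S2" "\<forall>E'. E' \<inter> S2 = E \<inter> S2 \<longrightarrow> E' \<in> b" by (metis IntD1 IntD2)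
    note S = this
    show ?case
    proof (intro exI[of _ "S1 \<union> S2"] conjI allI impI)
      fix E' assume "E' \<inter> (S1 \<union> S2) = E \<inter> (S1 \<union> S2)"
      hence "E' \<inter> S1 = E \<inter> S1" "E' \<inter> S2 = E \<inter> S2" by blast+
      with S show "E' \<in> a \<inter> b" by simp
    qed (use S in simp)
  next
    case (UN K)
    then obtain k where "k \<in> K" "E \<in> k" by blast
    from UN.IH[OF this] obtain S where S: "finite S" "\<forall>E'. E' \<inter> S = E \<inter> S \<longrightarrow> E' \<in> k" by (elim exE conjE)
    show ?case
    proof (intro exI[of _ S] conjI allI impI S(1))
      fix E' assume "E' \<inter> S = E \<inter> S"
      hence "E' \<in> k" using S(2) by simp
      thus "E' \<in> \<Union> K" using \<open>k \<in> K\<close> by blast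
    qed
  next
    case (Basis s)
    then obtain g where g: "s = {E. g \<in> E} \<or> s = {E. g \<notin> E}" by blast
    show ?case
    proof (intro exI[of _ "{g}"] conjI allI impI)
      fix E' assume "E' \<inter> {g} = E \<inter> {g}"
      hence "g \<in> E' \<longleftrightarrow> g \<in> E" by blast
      thus "E' \<in> s" using \<open>E \<in> s\<close> g by auto
    qed simp
  qed simp
qed

lemma openin_Mo_top_window:
  assumes "openin Mo_top U" "E \<in> U"
  shows "\<exists>S. finite S \<and> (\<forall>E'\<in>Mo_space. E' \<inter> S = E \<inter> S \<longrightarrow> E' \<in> U)"
proof -
  obtain V where "openin subsets_top V" "U = V \<inter> Mo_space"
    using assms(1) by (auto simp: Mo_top_def openin_subtopology)
  with openin_subsets_top_window[of V E] assms(2) show ?thesis by auto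
qed

lemma openin_Mo_top_subset: "openin Mo_top U \<Longrightarrow> U \<subseteq> Mo_space"
  by (auto simp: Mo_top_def openin_subtopology)

lemma topspace_Mo_top [simp]: "topspace Mo_top = Mo_space"
  by (simp add: Mo_top_def)

lemma space_Mo_borel [simp]: "space Mo_borel = Mo_space"
  unfolding Mo_borel_def by (rule space_measure_of) (auto dest: openin_Mo_top_subset)

lemma sets_Mo_borel: "sets Mo_borel = sigma_sets Mo_space {U. openin Mo_top U}"
  unfolding Mo_borel_def by (rule sets_measure_of) (auto dest: openin_Mo_top_subset)

lemma sets_Mo_borel_mem: "{E \<in> Mo_space. g \<in> E} \<in> sets Mo_borel"
proof -
  have "openin subsets_top {E. g \<in> E}"
    unfolding subsets_top_def by (rule topology_generated_by_Basis) auto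
  hence "openin Mo_top ({E. g \<in> E} \<inter> Mo_space)"
    unfolding Mo_top_def openin_subtopology by blast
  moreover have "{E. g \<in> E} \<inter> Mo_space = {E \<in> Mo_space. g \<in> E}" by auto
  ultimately show ?thesis by (auto simp: sets_Mo_borel)
qed

lemma sets_Collect_iff_const:
  assumes "{x \<in> space M. P x} \<in> sets M"
  shows "{x \<in> space M. P x \<longleftrightarrow> b} \<in> sets M"
  using assms sets.sets_Collect_neg[OF assms] by (cases b) simp_all

lemma sets_Mo_borel_window:
  fixes S T :: "'g::group_add set"
  assumes "finite S"
  shows "{E \<in> Mo_space. E \<inter> S = T} \<in> sets Mo_borel"
proof (cases "T \<subseteq> S")
  case True
  have "{E \<in> space Mo_borel. \<forall>g\<in>S. g \<in> E \<longleftrightarrow> g \<in> T} \<in> sets Mo_borel"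
  proof (intro sets.sets_Collect_finite_All assms)
    fix g :: 'g
    show "{E \<in> space Mo_borel. g \<in> E \<longleftrightarrow> g \<in> T} \<in> sets Mo_borel"
      using sets_Mo_borel_mem by (intro sets_Collect_iff_const) simp
  qed
  moreover have "{E \<in> space Mo_borel. \<forall>g\<in>S. g \<in> E \<longleftrightarrow> g \<in> T} = {E \<in> Mo_space. E \<inter> S = T}"
    using True by auto
  ultimately show ?thesis by simp
next
  case False
  hence eq: "{E \<in> Mo_space. E \<inter> S = T} = {}" by auto
  show ?thesis unfolding eq by simp
qed

text \<open>A countable group has countably many finite subsets, so an open set is a countable union
  of finite-window cylinders and the coordinates decide measurability.\<close>

lemma measurable_Mo_borel:
  fixes f :: "'a \<Rightarrow> 'g::{group_add,countable} set"
  assumes "\<And>x. x \<in> space M \<Longrightarrow> f x \<in> Mo_space" "\<And>g. {x \<in> space M. g \<in> f x} \<in> sets M"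
  shows "f \<in> measurable M Mo_borel"
  unfolding Mo_borel_def
proof (rule measurable_sigma_sets[OF sets_measure_of])
  show "{U::'g set set. openin Mo_top U} \<subseteq> Pow Mo_space" by (auto dest: openin_Mo_top_subset)
  show "{U::'g set set. openin Mo_top U} \<subseteq> Pow Mo_space" by (auto dest: openin_Mo_top_subset)
  show "f \<in> space M \<rightarrow> Mo_space" using assms(1) by auto
  fix U :: "'g set set" assume "U \<in> {U. openin Mo_top U}"
  hence U: "openin Mo_top U" by simp
  let ?I = "{(S, T). finite S \<and> finite T \<and> (\<forall>E\<in>Mo_space. E \<inter> S = T \<longrightarrow> E \<in> U)}"
  have "f -` U \<inter> space M = (\<Union>(S, T)\<in>?I. {x \<in> space M. f x \<inter> S = T})"
  proof (intro equalityI subsetI)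
    fix x assume x: "x \<in> f -` U \<inter> space M"
    then obtain S where "finite S" "\<forall>E'\<in>Mo_space. E' \<inter> S = f x \<inter> S \<longrightarrow> E' \<in> U"
      using openin_Mo_top_window[OF U, of "f x"] by auto
    hence "(S, f x \<inter> S) \<in> ?I" by auto
    thus "x \<in> (\<Union>(S, T)\<in>?I. {x \<in> space M. f x \<inter> S = T})" using x by blast
  qed (use assms(1) in auto)
  also have "\<dots> \<in> sets M"
  proof (rule sets.countable_UN'')
    have "countable ({S::'g set. finite S} \<times> {T::'g set. finite T})"
      by (intro countable_SIGMA countable_Collect_finite)
    thus "countable ?I" by (rule countable_subset[rotated]) auto
    have "{x \<in> space M. f x \<inter> S = T} \<in> sets M" if "finite S" for S T
    proof (cases "T \<subseteq> S")
      case True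
      have "{x \<in> space M. \<forall>g\<in>S. g \<in> f x \<longleftrightarrow> g \<in> T} \<in> sets M"
      proof (intro sets.sets_Collect_finite_All that)
        fix g show "{x \<in> space M. g \<in> f x \<longleftrightarrow> g \<in> T} \<in> sets M"
          by (intro sets_Collect_iff_const assms(2))
      qed
      moreover have "{x \<in> space M. \<forall>g\<in>S. g \<in> f x \<longleftrightarrow> g \<in> T} = {x \<in> space M. f x \<inter> S = T}"
        using True by auto
      ultimately show ?thesis by simp
    next
      case False
      hence eq: "{x \<in> space M. f x \<inter> S = T} = {}" by auto
      show ?thesis unfolding eq by simp
    qed
    thus "(case i of (S, T) \<Rightarrow> {x \<in> space M. f x \<inter> S = T}) \<in> sets M" if "i \<in> ?I" for i
      using that by auto
  qed
  finally show "f -` U \<inter> space M \<in> sets M" .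
qed

lemma borel_measurable_local:
  fixes f :: "'g::group_add set \<Rightarrow> real"
  assumes "finite S" "local_on S f"
  shows "f \<in> borel_measurable Mo_borel"
proof -
  have "(\<lambda>E. \<Sum>T\<in>Pow S. f T * indicator {E \<in> Mo_space. E \<inter> S = T} E) \<in> borel_measurable Mo_borel"
    using sets_Mo_borel_window[OF assms(1)] by (intro borel_measurable_sum borel_measurable_times) auto
  moreover have "(\<Sum>T\<in>Pow S. f T * indicator {E \<in> Mo_space. E \<inter> S = T} E) = f E" if "E \<in> Mo_space" for E
  proof -
    have "(\<Sum>T\<in>Pow S. f T * indicator {E \<in> Mo_space. E \<inter> S = T} E) = (\<Sum>T\<in>{E \<inter> S}. f T)"
      using that assms(1) by (intro sum.mono_neutral_cong_right) (auto simp: indicator_def split: if_splits)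
    also have "\<dots> = f E" using local_onD[OF assms(2), of "E \<inter> S" E] by auto
    finally show ?thesis .
  qed
  ultimately show ?thesis
    by (subst measurable_cong[where g="\<lambda>E. \<Sum>T\<in>Pow S. f T * indicator {E \<in> Mo_space. E \<inter> S = T} E"]) auto
qed

lemma borel_measurable_continuous_Mo:
  assumes "continuous_map Mo_top euclideanreal f"
  shows "f \<in> borel_measurable Mo_borel"
proof (rule borel_measurableI)
  fix B :: "real set" assume "open B"
  hence "openin Mo_top {E \<in> topspace Mo_top. f E \<in> B}"
    using assms by (auto simp: continuous_map_def)
  moreover have "{E \<in> topspace Mo_top. f E \<in> B} = f -` B \<inter> space Mo_borel" by auto
  ultimately show "f -` B \<inter> space Mo_borel \<in> sets Mo_borel" by (auto simp: sets_Mo_borel)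
qed

text \<open>Compactness of the space of rooted subsets, as a branch of a binary tree: the cylinders on which
  no finite window controls the oscillation of \<open>f\<close> up to \<open>\<epsilon>\<close>
  would otherwise shrink to a point where \<open>f\<close> is discontinuous.\<close>

lemma continuous_Mo_uniform_window:
  fixes f :: "'g::{group_add,countable} set \<Rightarrow> real"
  assumes f: "continuous_map Mo_top euclideanreal f" and "\<epsilon> > 0"
  shows "\<exists>S. finite S \<and> (\<forall>E\<in>Mo_space. \<forall>E'\<in>Mo_space. E \<inter> S = E' \<inter> S \<longrightarrow> \<bar>f E - f E'\<bar> < \<epsilon>)"
proof (rule ccontr)
  assume no: "\<not> ?thesis"
  define W :: "nat \<Rightarrow> 'g set" where "W n = {g. to_nat g < n}" for n
  define good where "good n T \<longleftrightarrow> (\<exists>S. finite S \<and> (\<forall>E\<in>Mo_space. \<forall>E'\<in>Mo_space.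
      E \<inter> W n = T \<longrightarrow> E' \<inter> W n = T \<longrightarrow> E \<inter> S = E' \<inter> S \<longrightarrow> \<bar>f E - f E'\<bar> < \<epsilon>))" for n T
  \<comment> \<open>At most one element, as \<open>to_nat\<close> is injective, and none if
    \<open>n\<close> is not a code. Level \<open>n\<close> of the tree decides about it.\<close>
  define D where "D n = {g::'g. to_nat g = n}" for n
  have WS: "W (Suc n) = W n \<union> D n" for n by (auto simp: W_def D_def)
  have D1: "X \<inter> D n = {} \<or> X \<inter> D n = D n" for n X by (auto simp: D_def)
  have step: "good n T" if g: "good (Suc n) T" "good (Suc n) (T \<union> D n)" for n T
  proof -
    obtain S1 S2 where S1: "finite S1" "\<And>E E'. E\<in>Mo_space \<Longrightarrow> E'\<in>Mo_space \<Longrightarrow> E \<inter> W (Suc n) = T \<Longrightarrow> E' \<inter> W (Suc n) = T \<Longrightarrow>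
          E \<inter> S1 = E' \<inter> S1 \<Longrightarrow> \<bar>f E - f E'\<bar> < \<epsilon>"
      and S2: "finite S2" "\<And>E E'. E\<in>Mo_space \<Longrightarrow> E'\<in>Mo_space \<Longrightarrow> E \<inter> W (Suc n) = T \<union> D n \<Longrightarrow> E' \<inter> W (Suc n) = T \<union> D n \<Longrightarrow>
          E \<inter> S2 = E' \<inter> S2 \<Longrightarrow> \<bar>f E - f E'\<bar> < \<epsilon>"
      using g unfolding good_def by metis
    have finD: "finite (D n)"
    proof -
      have "D n \<subseteq> {from_nat n}" by (auto simp: D_def)
      thus ?thesis by (rule finite_subset) simp
    qed
    show ?thesis
      unfolding good_def
    proof (intro exI[of _ "S1 \<union> S2 \<union> D n"] conjI ballI impI)
      show "finite (S1 \<union> S2 \<union> D n)" using S1 S2 finD by auto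
      fix E E' assume E: "E \<in> Mo_space" "E' \<in> Mo_space" "E \<inter> W n = T" "E' \<inter> W n = T"
        "E \<inter> (S1 \<union> S2 \<union> D n) = E' \<inter> (S1 \<union> S2 \<union> D n)"
      have eq: "E \<inter> S1 = E' \<inter> S1" "E \<inter> S2 = E' \<inter> S2" "E \<inter> D n = E' \<inter> D n" using E(5) by blast+
      show "\<bar>f E - f E'\<bar> < \<epsilon>"
        using D1[of E n]
      proof
        assume "E \<inter> D n = {}"
        hence "E \<inter> W (Suc n) = T" "E' \<inter> W (Suc n) = T" using E(3,4) eq(3) unfolding WS Int_Un_distrib by auto
        thus ?thesis using S1(2) E(1,2) eq(1) by blast
      next
        assume "E \<inter> D n = D n"
        hence "E \<inter> W (Suc n) = T \<union> D n" "E' \<inter> W (Suc n) = T \<union> D n"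
          using E(3,4) eq(3) unfolding WS Int_Un_distrib by auto
        thus ?thesis using S2(2) E(1,2) eq(2) by blast
      qed
    qed
  qed
  \<comment> \<open>The element stays out unless that child is good; then the other child is not, by
    \<open>step\<close>, so the branch remains bad.\<close>
  define T where "T = rec_nat {} (\<lambda>n t. if good (Suc n) t then t \<union> D n else t)"
  have T0: "T 0 = {}" and TS: "T (Suc n) = (if good (Suc n) (T n) then T n \<union> D n else T n)" for n
    by (auto simp: T_def)
  have bad: "\<not> good n (T n)" for n
  proof (induction n)
    case 0
    have "\<not> good 0 {}" using no unfolding good_def W_def by simp
    thus ?case by (simp add: T0)
  next
    case (Suc n)
    thus ?case using step[of n "T n"] by (auto simp: TS)
  qed
  have TW: "T n \<subseteq> W n" for n
    by (induction n) (auto simp: T0 TS WS)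
  define E where "E = (\<Union>n. T n)"
  have EW: "E \<inter> W n = T n" for n
  proof -
    have "T m \<inter> W n \<subseteq> T n" for m
    proof (induction m)
      case (Suc m)
      show ?case
      proof (cases "m < n")
        case True
        hence "Suc m \<le> n" by simp
        moreover have "T i \<subseteq> T j" if "i \<le> j" for i j
          using that by (rule lift_Suc_mono_le[rotated]) (simp add: TS)
        ultimately show ?thesis by blast
      next
        case False
        hence "D m \<inter> W n = {}" by (auto simp: D_def W_def)
        thus ?thesis using Suc by (auto simp: TS)
      qed
    qed (simp add: T0)
    hence "E \<inter> W n \<subseteq> T n" unfolding E_def by blast
    moreover have "T n \<subseteq> E \<inter> W n" using TW[of n] unfolding E_def by blast
    ultimately show ?thesis by (rule equalityI)
  qed
  \<comment> \<open>The tree branches over all subsets, rooted or not. A cylinder without rooted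
    sets would be vacuously good, which forces the limit to contain the identity.\<close>
  have ex: "\<exists>E1\<in>Mo_space. E1 \<inter> W n = T n" for n
  proof (rule ccontr)
    assume "\<not> ?thesis"
    hence "good n (T n)" unfolding good_def by (intro exI[of _ "{}"]) simp
    thus False using bad by blast
  qed
  have "E \<in> Mo_space"
  proof -
    obtain E1 where "E1 \<in> Mo_space" "E1 \<inter> W (Suc (to_nat (0::'g))) = T (Suc (to_nat (0::'g)))" using ex by blast
    moreover have "0 \<in> W (Suc (to_nat (0::'g)))" by (simp add: W_def)
    ultimately have "0 \<in> T (Suc (to_nat (0::'g)))" unfolding Mo_space_def by blast
    thus ?thesis by (auto simp: E_def Mo_space_def)
  qed
  have "openin Mo_top {E' \<in> topspace Mo_top. f E' \<in> ball (f E) (\<epsilon> / 2)}"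
    using f unfolding continuous_map_def by (meson open_ball open_openin)
  moreover have "E \<in> {E' \<in> topspace Mo_top. f E' \<in> ball (f E) (\<epsilon> / 2)}"
    using \<open>E \<in> Mo_space\<close> \<open>\<epsilon> > 0\<close> by simp
  ultimately obtain S where S: "finite S"
    "\<forall>E'\<in>Mo_space. E' \<inter> S = E \<inter> S \<longrightarrow> E' \<in> {E' \<in> topspace Mo_top. f E' \<in> ball (f E) (\<epsilon> / 2)}"
    using openin_Mo_top_window by metis
  obtain n where n: "S \<subseteq> W n"
  proof -
    have "S \<subseteq> W (Suc (Max (to_nat ` S)))" using S(1) by (auto simp: W_def less_Suc_eq_le)
    thus ?thesis by (rule that)
  qed
  have close: "\<bar>f E' - f E\<bar> < \<epsilon> / 2" if "E' \<in> Mo_space" "E' \<inter> W n = T n" for E'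
  proof -
    have "E' \<inter> S = E \<inter> S" using that(2) EW[of n] n by blast
    hence "f E' \<in> ball (f E) (\<epsilon> / 2)" using S(2) that(1) by blast
    thus ?thesis by (simp add: dist_real_def abs_minus_commute)
  qed
  have "good n (T n)"
    unfolding good_def
  proof (intro exI[of _ "{}"] conjI ballI impI)
    fix E1 E2 assume "E1 \<in> Mo_space" "E2 \<in> Mo_space" "E1 \<inter> W n = T n" "E2 \<inter> W n = T n"
    thus "\<bar>f E1 - f E2\<bar> < \<epsilon>" using close[of E1] close[of E2] by linarith
  qed simp
  thus False using bad by blast
qed

section \<open>Unimodular measures from weighted finite sets\<close>

lemma translate_set_add: "translate_set h (translate_set g V) = translate_set (g + h) V"
  by (rule set_eqI) (simp add: mem_translate_set add.assoc)

text \<open>Choose \<open>V\<close> with probability proportional to \<open>m V * card V\<close>,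
  then a uniform root in it: every pair \<open>(V, g)\<close> has mass \<open>m V / Z\<close>, which
  does not depend on the root. A re-rooting moves the root inside the same \<open>V\<close>, so it
  acts on pairs injectively and keeps masses.\<close>

lemma unimodular_of_weights:
  fixes m :: "'g::{group_add,countable} set \<Rightarrow> real"
  assumes "finite G" "\<And>V. m V \<ge> 0"
  defines "Z \<equiv> \<Sum>V\<in>Pow G - {{}}. m V * card V"
  assumes "Z > 0"
  shows "\<exists>Q. unimodular Q \<and> (AE E in Q. finite E) \<and>
    (\<forall>f::'g set \<Rightarrow> real. f \<in> borel_measurable Mo_borel \<longrightarrow>
       (\<integral>E. f E \<partial>Q) = (\<Sum>V\<in>Pow G - {{}}. m V * (\<Sum>g\<in>V. f (translate_set g V))) / Z)"
proof -
  define D where "D = Sigma (Pow G - {{}}) (\<lambda>V. V)"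
  define t :: "'g set \<times> 'g \<Rightarrow> 'g set" where "t = (\<lambda>(V, g). translate_set g V)"
  define M where "M = point_measure D (\<lambda>p. ennreal (m (fst p) / Z))"
  define Q where "Q = distr M Mo_borel t"
  have finV: "finite V" if "V \<in> Pow G - {{}}" for V using that assms(1) finite_subset by auto
  have finD: "finite D" unfolding D_def using assms(1) finV by (intro finite_SigmaI) auto
  have tMo: "t p \<in> Mo_space" if "p \<in> D" for p
    using that by (auto simp: D_def t_def Mo_space_def mem_translate_set)
  have t_meas: "t \<in> measurable M Mo_borel" unfolding M_def using tMo by auto
  have spM: "space M = D" by (simp add: M_def space_point_measure)
  have sumD: "(\<Sum>(V, g)\<in>D. h V g) = (\<Sum>V\<in>Pow G - {{}}. \<Sum>g\<in>V. h V g)" for h :: "'g set \<Rightarrow> 'g \<Rightarrow> real"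
    unfolding D_def using assms(1) finV by (subst sum.Sigma) auto
  have prob: "prob_space M"
  proof
    have "emeasure M (space M) = (\<Sum>p\<in>D. ennreal (m (fst p) / Z))"
      unfolding spM unfolding M_def using finD by (simp add: emeasure_point_measure_finite)
    also have "\<dots> = ennreal (\<Sum>p\<in>D. m (fst p) / Z)"
      using assms by (intro sum_ennreal) auto
    also have "(\<Sum>p\<in>D. m (fst p) / Z) = (\<Sum>V\<in>Pow G - {{}}. m V * card V) / Z"
      using sumD[of "\<lambda>V g. m V / Z"] by (simp add: case_prod_beta sum_divide_distrib mult.commute)
    also have "\<dots> = 1" using \<open>Z > 0\<close> by (simp add: Z_def)
    finally show "emeasure M (space M) = 1" by simp
  qed
  have emQ: "emeasure Q A = (\<Sum>p\<in>{p\<in>D. t p \<in> A}. ennreal (m (fst p) / Z))" if "A \<in> sets Mo_borel" for A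
  proof -
    have "emeasure Q A = emeasure M (t -` A \<inter> D)"
      unfolding Q_def using that t_meas by (simp add: emeasure_distr spM)
    also have "t -` A \<inter> D = {p\<in>D. t p \<in> A}" by auto
    finally show ?thesis unfolding M_def using finD
      by (simp add: emeasure_point_measure_finite case_prod_beta)
  qed
  have "rel_invariant Q rerooting"
    unfolding rel_invariant_def
  proof (intro allI impI, elim conjE)
    fix A :: "'g set set" and \<phi>
    assume A: "A \<in> sets Q" "\<phi> ` A \<in> sets Q" "inj_on \<phi> A" and R: "\<forall>x\<in>A. (x, \<phi> x) \<in> rerooting"
    have sQ: "A \<in> sets Mo_borel" "\<phi> ` A \<in> sets Mo_borel" using A by (auto simp: Q_def)
    have "\<forall>E\<in>A. \<exists>g. 0 \<in> E \<and> g \<in> E \<and> \<phi> E = translate_set g E"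
      using R unfolding rerooting_def by blast
    \<comment> \<open>Several elements may produce the same \<open>\<phi> E\<close> if
      \<open>E\<close> has symmetries. Any choice will do, because it depends on \<open>E\<close>
      alone and can be undone once \<open>E\<close> is known.\<close>
    then obtain \<gamma> where \<gamma>: "\<And>E. E \<in> A \<Longrightarrow> 0 \<in> E \<and> \<gamma> E \<in> E \<and> \<phi> E = translate_set (\<gamma> E) E" by metis
    define \<theta> where "\<theta> p = (fst p, snd p + \<gamma> (t p))" for p
    have t\<theta>: "t (\<theta> p) = \<phi> (t p)" if "t p \<in> A" for p
      using \<gamma>[OF that] by (simp add: \<theta>_def t_def case_prod_beta translate_set_add)
    have "bij_betw \<theta> {p\<in>D. t p \<in> A} {p\<in>D. t p \<in> \<phi> ` A}"
    proof (intro bij_betw_imageI equalityI subsetI)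
      show "inj_on \<theta> {p\<in>D. t p \<in> A}"
      proof (rule inj_onI)
        fix p p' assume p: "p \<in> {p\<in>D. t p \<in> A}" "p' \<in> {p\<in>D. t p \<in> A}" "\<theta> p = \<theta> p'"
        hence "\<phi> (t p) = \<phi> (t p')" using t\<theta> by (metis (mono_tags, lifting) mem_Collect_eq)
        hence "t p = t p'" using A(3) p by (auto dest: inj_onD)
        thus "p = p'" using p(3) by (auto simp: \<theta>_def prod_eq_iff)
      qed
    next
      fix r assume "r \<in> \<theta> ` {p\<in>D. t p \<in> A}"
      then obtain p where p: "p \<in> D" "t p \<in> A" "r = \<theta> p" by auto
      have "\<gamma> (t p) \<in> t p" using \<gamma>[OF p(2)] by simp
      hence "snd p + \<gamma> (t p) \<in> fst p" by (simp add: t_def case_prod_beta mem_translate_set)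
      hence "\<theta> p \<in> D" using p(1) by (auto simp: D_def \<theta>_def)
      thus "r \<in> {p\<in>D. t p \<in> \<phi> ` A}" using p t\<theta>[OF p(2)] by auto
    next
      fix r assume "r \<in> {p\<in>D. t p \<in> \<phi> ` A}"
      then obtain E where r: "r \<in> D" "t r = \<phi> E" "E \<in> A" by auto
      define p where "p = (fst r, snd r - \<gamma> E)"
      have "t p = translate_set (- \<gamma> E) (t r)"
        by (simp add: p_def t_def case_prod_beta translate_set_add)
      also have "\<dots> = translate_set (- \<gamma> E) (translate_set (\<gamma> E) E)" using r \<gamma> by simp
      also have "\<dots> = E" by (rule set_eqI) (simp add: mem_translate_set)
      finally have tp: "t p = E" .
      have "0 \<in> t p" using tp \<gamma>[OF r(3)] by simp
      hence "snd p \<in> fst p" by (simp add: t_def case_prod_beta mem_translate_set)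
      hence "p \<in> D" using r(1) by (auto simp: D_def p_def)
      moreover have "\<theta> p = r" by (simp add: \<theta>_def tp) (simp add: p_def)
      ultimately show "r \<in> \<theta> ` {p\<in>D. t p \<in> A}" using tp r(3) by force
    qed
    hence "(\<Sum>p\<in>{p\<in>D. t p \<in> A}. ennreal (m (fst (\<theta> p)) / Z)) = (\<Sum>p\<in>{p\<in>D. t p \<in> \<phi> ` A}. ennreal (m (fst p) / Z))"
      by (rule sum.reindex_bij_betw)
    thus "emeasure Q (\<phi> ` A) = emeasure Q A"
      unfolding emQ[OF sQ(1)] emQ[OF sQ(2)] by (simp add: \<theta>_def)
  qed
  moreover have "random_rooted_subset Q"
    unfolding random_rooted_subset_def Q_def using prob_space.prob_space_distr[OF prob t_meas] by simp
  moreover have "AE E in Q. finite E"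
  proof -
    have "{E \<in> space Mo_borel. finite E} = (\<Union>T\<in>{T. finite T}. {E \<in> Mo_space. E = T})" by auto
    also have "\<dots> \<in> sets (Mo_borel :: 'g set measure)"
    proof (rule sets.countable_UN'')
      show "countable {T::'g set. finite T}" by (rule countable_Collect_finite)
      fix T :: "'g set"
      have "{E \<in> space Mo_borel. \<forall>g. g \<in> E \<longleftrightarrow> g \<in> T} \<in> sets Mo_borel"
      proof (rule sets.sets_Collect_countable_All)
        fix g
        show "{E \<in> space Mo_borel. g \<in> E \<longleftrightarrow> g \<in> T} \<in> sets Mo_borel"
          using sets_Mo_borel_mem by (intro sets_Collect_iff_const) simp
      qed
      moreover have "{E \<in> space Mo_borel. \<forall>g. g \<in> E \<longleftrightarrow> g \<in> T} = {E \<in> Mo_space. E = T}" by auto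
      ultimately show "{E \<in> Mo_space. E = T} \<in> sets Mo_borel" by simp
    qed
    finally have "(AE E in Q. finite E) = (AE p in M. finite (t p))"
      unfolding Q_def using t_meas by (intro AE_distr_iff) auto
    also have "\<dots>"
      by (rule AE_I2) (auto simp: spM D_def t_def translate_set_def intro: finV)
    finally show ?thesis by simp
  qed
  moreover have "(\<integral>E. f E \<partial>Q) = (\<Sum>V\<in>Pow G - {{}}. m V * (\<Sum>g\<in>V. f (translate_set g V))) / Z"
    if "f \<in> borel_measurable Mo_borel" for f :: "'g set \<Rightarrow> real"
  proof -
    have "(\<integral>E. f E \<partial>Q) = (\<integral>p. f (t p) \<partial>M)"
      unfolding Q_def using that t_meas by (simp add: integral_distr)
    also have "\<dots> = (\<Sum>(V, g)\<in>D. m V / Z * f (translate_set g V))"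
      unfolding M_def using finD assms
      by (simp add: lebesgue_integral_point_measure_finite case_prod_beta t_def)
    also have "\<dots> = (\<Sum>V\<in>Pow G - {{}}. m V * (\<Sum>g\<in>V. f (translate_set g V))) / Z"
      unfolding sumD by (simp add: sum_divide_distrib sum_distrib_left)
    finally show ?thesis .
  qed
  ultimately show ?thesis unfolding unimodular_def by blast
qed

section \<open>Binary digits of the Bernoulli shift\<close>

lemma prob_space_unit: "prob_space (restrict_space lborel {0..1::real})"
  by (rule prob_spaceI) (simp add: emeasure_restrict_space space_restrict_space)

lemma prob_space_bernoulli: "prob_space bernoulli"
  unfolding bernoulli_def by (rule prob_space_PiM) (rule prob_space_unit)

lemma space_bernoulli: "space bernoulli = {y. \<forall>h. 0 \<le> y h \<and> y h \<le> 1}"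
  by (auto simp: bernoulli_def space_PiM space_restrict_space PiE_def Pi_def)

lemma distr_shift_inv: "distr bernoulli bernoulli (shift_inv g) = bernoulli"
proof -
  have "distr (Pi\<^sub>M UNIV (\<lambda>_. restrict_space lborel {0..1::real})) (Pi\<^sub>M UNIV (\<lambda>_. restrict_space lborel {0..1}))
      (\<lambda>\<omega>. \<lambda>n\<in>UNIV. \<omega> (g + n)) = Pi\<^sub>M UNIV (\<lambda>_. restrict_space lborel {0..1})"
    using distr_PiM_reindex[of UNIV "\<lambda>_. restrict_space lborel {0..1::real}" "(+) g" UNIV] prob_space_unit
    by (auto simp: inj_on_def)
  thus ?thesis by (simp add: bernoulli_def shift_inv_def[abs_def] restrict_UNIV)
qed

lemma measurable_shift_inv [measurable]: "shift_inv g \<in> measurable bernoulli bernoulli"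
  unfolding bernoulli_def shift_inv_def
  by (rule measurable_PiM_single') (auto simp: space_PiM PiE_def Pi_def)

lemma measure_shift_inv:
  assumes "A \<in> sets bernoulli"
  shows "measure bernoulli (shift_inv g -` A \<inter> space bernoulli) = measure bernoulli A"
  using measure_distr[OF measurable_shift_inv assms, of g] by (simp add: distr_shift_inv)

text \<open>At \<open>y h = 1\<close> all digits vanish; the digits of \<open>y h < 1\<close> are the usual ones.\<close>

definition bits :: "('g \<Rightarrow> real) \<Rightarrow> ('g \<times> nat) set" where
  "bits y = {(h, i). odd \<lfloor>2 ^ Suc i * y h\<rfloor>}"

lemma bits_shift_inv: "bits (shift_inv g y) = shift_pos g -` bits y"
  by (auto simp: bits_def shift_inv_def shift_pos_def)

lemma floor_double_div_2: "\<lfloor>2 * x\<rfloor> div 2 = \<lfloor>x :: real\<rfloor>"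
proof -
  have "2 * \<lfloor>x\<rfloor> \<le> \<lfloor>2 * x\<rfloor>" "\<lfloor>2 * x\<rfloor> < 2 * \<lfloor>x\<rfloor> + 2" by linarith+
  thus ?thesis by presburger
qed

text \<open>\<open>j\<close> is the integer with binary digits \<open>v 0\<close>, ...,
  \<open>v (k - 1)\<close>, leading digit first.\<close>

lemma dyadic_cell:
  "\<exists>j\<ge>0. j < 2 ^ k \<and> (\<forall>t::real. 0 \<le> t \<longrightarrow> t < 1 \<longrightarrow>
     (\<forall>i<k. odd \<lfloor>2 ^ Suc i * t\<rfloor> = v i) \<longleftrightarrow> \<lfloor>2 ^ k * t\<rfloor> = j)"
proof (induction k)
  case 0
  show ?case by (intro exI[of _ 0]) (auto simp: floor_eq_iff)
next
  case (Suc k)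
  then obtain j where j: "j \<ge> 0" "j < 2 ^ k"
    "\<And>t::real. 0 \<le> t \<Longrightarrow> t < 1 \<Longrightarrow> (\<forall>i<k. odd \<lfloor>2 ^ Suc i * t\<rfloor> = v i) \<longleftrightarrow> \<lfloor>2 ^ k * t\<rfloor> = j" by blast
  define j' where "j' = 2 * j + (if v k then 1 else 0)"
  have "(\<forall>i<Suc k. odd \<lfloor>2 ^ Suc i * t\<rfloor> = v i) \<longleftrightarrow> \<lfloor>2 ^ Suc k * t\<rfloor> = j'" if "0 \<le> t" "t < 1" for t :: real
  proof -
    have "\<lfloor>2 ^ k * t\<rfloor> = \<lfloor>2 ^ Suc k * t\<rfloor> div 2"
      using floor_double_div_2[of "2 ^ k * t"] by (simp add: mult.assoc)
    hence "(\<forall>i<Suc k. odd \<lfloor>2 ^ Suc i * t\<rfloor> = v i) \<longleftrightarrow>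
        \<lfloor>2 ^ Suc k * t\<rfloor> div 2 = j \<and> odd \<lfloor>2 ^ Suc k * t\<rfloor> = v k"
      using j(3)[OF that] by (auto simp: less_Suc_eq)
    also have "\<dots> \<longleftrightarrow> \<lfloor>2 ^ Suc k * t\<rfloor> = j'"
      unfolding j'_def by (cases "v k") (simp_all, presburger+)
    finally show ?thesis .
  qed
  moreover have "j' \<ge> 0" "j' < 2 ^ Suc k" using j by (auto simp: j'_def)
  ultimately show ?case by blast
qed

lemma unit_cell:
  "{t. 0 \<le> t \<and> t \<le> 1 \<and> (\<forall>i<k. odd \<lfloor>2 ^ Suc i * t\<rfloor> = v i)} \<in> sets (restrict_space lborel {0..1::real})" (is "?A \<in> _")
  "emeasure (restrict_space lborel {0..1::real})
     {t. 0 \<le> t \<and> t \<le> 1 \<and> (\<forall>i<k. odd \<lfloor>2 ^ Suc i * t\<rfloor> = v i)} = ennreal (1 / 2 ^ k)"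
proof -
  obtain j where j: "j \<ge> 0" "j < 2 ^ k"
    "\<And>t::real. 0 \<le> t \<Longrightarrow> t < 1 \<Longrightarrow> (\<forall>i<k. odd \<lfloor>2 ^ Suc i * t\<rfloor> = v i) \<longleftrightarrow> \<lfloor>2 ^ k * t\<rfloor> = j"
    using dyadic_cell[of k v] by blast
  define I where "I = {real_of_int j / 2 ^ k ..< (real_of_int j + 1) / 2 ^ k}"
  have le: "(real_of_int j + 1) / 2 ^ k \<le> 1"
  proof -
    have "j + 1 \<le> 2 ^ k" using j(2) by simp
    hence "real_of_int (j + 1) \<le> 2 ^ k" by (metis of_int_le_numeral_power_cancel_iff)
    thus ?thesis by simp
  qed
  have I: "t \<in> I \<longleftrightarrow> \<lfloor>2 ^ k * t\<rfloor> = j" for t by (auto simp: I_def floor_eq_iff field_simps)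
  have I01: "0 \<le> t \<and> t < 1" if "t \<in> I" for t
  proof -
    have "0 \<le> real_of_int j / 2 ^ k" using j(1) by simp
    thus ?thesis using that less_le_trans[OF _ le] unfolding I_def by (auto intro: order.trans)
  qed
  define A :: "real set" where "A = {t. 0 \<le> t \<and> t \<le> 1 \<and> (\<forall>i<k. odd \<lfloor>2 ^ Suc i * t\<rfloor> = v i)}"
  \<comment> \<open>The endpoint 1, whose digits vanish, is the only possible point of
    \<open>A\<close> outside the dyadic cell.\<close>
  have A: "t \<in> A \<longleftrightarrow> t \<in> I \<or> t \<in> A \<and> t = 1" for t
  proof (cases "0 \<le> t \<and> t < 1")
    case True
    hence "t \<in> A \<longleftrightarrow> t \<in> I" using j(3)[of t] I[of t] by (simp add: A_def)
    thus ?thesis using True by blast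
  next
    case False
    hence "t \<notin> I" "t \<in> A \<Longrightarrow> t = 1" using I01[of t] by (auto simp: A_def)
    thus ?thesis by blast
  qed
  have A01: "A \<subseteq> {0..1}" by (auto simp: A_def)
  have Im: "I \<in> sets borel" by (simp add: I_def)
  have "A = I \<or> A = I \<union> {1}" using A by blast
  hence Am: "A \<in> sets borel" using Im by (elim disjE) simp_all
  show "?A \<in> sets (restrict_space lborel {0..1::real})"
    unfolding A_def[symmetric] using Am A01 by (subst sets_restrict_space_iff) simp_all
  have "emeasure (restrict_space lborel {0..1::real}) A = emeasure lborel A"
    using A01 by (intro emeasure_restrict_space) simp_all
  also have "\<dots> = emeasure lborel I"
  proof (rule emeasure_eq_AE)
    show "AE t in lborel. (t \<in> A) = (t \<in> I)"
      using AE_lborel_singleton[of "1::real"] by eventually_elim (use A in blast)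
  qed (use Am Im in simp_all)
  also have "\<dots> = ennreal (1 / 2 ^ k)"
    unfolding I_def by (subst emeasure_lborel_Ico) (auto simp: divide_right_mono diff_divide_distrib[symmetric])
  finally show "emeasure (restrict_space lborel {0..1::real}) ?A = ennreal (1 / 2 ^ k)"
    unfolding A_def .
qed

lemma bits_cylinder:
  assumes "finite H" "T \<subseteq> H \<times> {..<k}"
  shows "{y \<in> space bernoulli. bits y \<inter> (H \<times> {..<k}) = T} \<in> sets bernoulli" (is "?S \<in> _")
    and "measure bernoulli {y \<in> space bernoulli. bits y \<inter> (H \<times> {..<k}) = T} = 1 / 2 ^ card (H \<times> {..<k})"
proof -
  let ?M = "\<lambda>_. restrict_space lborel {0..1::real}"
  let ?A = "\<lambda>h. {t. 0 \<le> t \<and> t \<le> 1 \<and> (\<forall>i<k. odd \<lfloor>2 ^ Suc i * t\<rfloor> = ((h, i) \<in> T))}"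
  have eq: "?S = prod_emb UNIV ?M H (Pi\<^sub>E H ?A)"
  proof (intro set_eqI)
    fix y
    have "bits y \<inter> (H \<times> {..<k}) = T \<longleftrightarrow> (\<forall>h\<in>H. \<forall>i<k. odd \<lfloor>2 ^ Suc i * y h\<rfloor> = ((h, i) \<in> T))"
      using assms(2) unfolding bits_def by (auto simp del: power_Suc)
    thus "y \<in> ?S \<longleftrightarrow> y \<in> prod_emb UNIV ?M H (Pi\<^sub>E H ?A)"
      by (auto simp del: power_Suc simp: space_bernoulli prod_emb_def space_restrict_space PiE_def Pi_def)
  qed
  show "?S \<in> sets bernoulli"
    unfolding eq unfolding bernoulli_def using assms unit_cell(1) by (intro sets_PiM_I) auto
  have "emeasure bernoulli ?S = (\<Prod>h\<in>H. emeasure (?M h) (?A h))"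
    unfolding eq unfolding bernoulli_def using assms unit_cell(1) prob_space_unit
    by (intro emeasure_PiM_emb) auto
  also have "\<dots> = (\<Prod>h\<in>H. ennreal (1 / 2 ^ k))"
    by (intro prod.cong refl unit_cell(2))
  also have "\<dots> = ennreal (1 / 2 ^ card (H \<times> {..<k}))"
    by (simp add: ennreal_power card_cartesian_product power_divide power_mult[symmetric] mult.commute)
  finally show "measure bernoulli ?S = 1 / 2 ^ card (H \<times> {..<k})"
    by (simp add: measure_def)
qed

text \<open>The digits are independent fair coins. This turns integrals over the Bernoulli space
  into finite averages.\<close>

lemma bits_local:
  fixes \<phi> :: "('g \<times> nat) set \<Rightarrow> real"
  assumes "finite W" "local_on W \<phi>"
  shows "(\<lambda>y. \<phi> (bits y)) \<in> borel_measurable bernoulli"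
    and "(\<integral>y. \<phi> (bits y) \<partial>bernoulli) = avg W \<phi> {}"
proof -
  interpret prob_space "bernoulli :: ('g \<Rightarrow> real) measure" by (rule prob_space_bernoulli)
  obtain k where k: "\<forall>n\<in>snd ` W. n < k"
    using finite_nat_set_iff_bounded[of "snd ` W"] assms(1) by auto
  define B where "B = fst ` W \<times> {..<k}"
  have WB: "W \<subseteq> B" using k by (force simp: B_def)
  have fB: "finite B" using assms by (simp add: B_def)
  let ?S = "\<lambda>T. {y \<in> space bernoulli. bits y \<inter> B = T}"
  have S: "?S T \<in> sets bernoulli" "measure bernoulli (?S T) = 1 / 2 ^ card B" if "T \<in> Pow B" for T
    using bits_cylinder[of "fst ` W" T k] that assms(1) by (auto simp: B_def)
  have fin: "emeasure (bernoulli :: ('g \<Rightarrow> real) measure) X < \<infinity>" for X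
    by (metis emeasure_finite infinity_ennreal_def top.not_eq_extremum)
  have eq: "\<phi> (bits y) = (\<Sum>T\<in>Pow B. \<phi> T * indicator (?S T) y)" if "y \<in> space bernoulli" for y
  proof -
    have "(\<Sum>T\<in>Pow B. \<phi> T * indicator (?S T) y) = (\<Sum>T\<in>{bits y \<inter> B}. \<phi> T)"
      using that fB by (intro sum.mono_neutral_cong_right) (auto simp: indicator_def split: if_splits)
    also have "\<dots> = \<phi> (bits y)"
      using local_onD[OF assms(2), of "bits y \<inter> B" "bits y"] WB by auto
    finally show ?thesis by simp
  qed
  have "(\<lambda>y. \<Sum>T\<in>Pow B. \<phi> T * indicator (?S T) y) \<in> borel_measurable bernoulli"
    by (intro borel_measurable_sum borel_measurable_times borel_measurable_const borel_measurable_indicator S)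
  thus "(\<lambda>y. \<phi> (bits y)) \<in> borel_measurable bernoulli"
    by (subst measurable_cong[OF eq])
  have "(\<integral>y. \<phi> (bits y) \<partial>bernoulli) = (\<integral>y. (\<Sum>T\<in>Pow B. \<phi> T * indicator (?S T) y) \<partial>bernoulli)"
    by (intro Bochner_Integration.integral_cong refl eq)
  also have "\<dots> = (\<Sum>T\<in>Pow B. \<integral>y. \<phi> T * indicator (?S T) y \<partial>bernoulli)"
    by (intro Bochner_Integration.integral_sum integrable_mult_right integrable_real_indicator S fin)
  also have "\<dots> = (\<Sum>T\<in>Pow B. \<phi> T * (1 / 2 ^ card B))"
  proof (intro sum.cong refl)
    fix T assume T: "T \<in> Pow B"
    have "?S T \<inter> space bernoulli = ?S T" by auto
    thus "(\<integral>y. \<phi> T * indicator (?S T) y \<partial>bernoulli) = \<phi> T * (1 / 2 ^ card B)"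
      using S[OF T] by simp
  qed
  also have "\<dots> = avg B \<phi> {}" by (simp add: avg_def sum_divide_distrib)
  also have "\<dots> = avg W \<phi> {}" using avg_local[OF fB assms(2)] WB by (simp add: Int_absorb1)
  finally show "(\<integral>y. \<phi> (bits y) \<partial>bernoulli) = avg W \<phi> {}" .
qed

section \<open>Density of the events that read finitely many bits\<close>

definition cyl :: "('g \<times> nat) set set \<Rightarrow> ('g \<Rightarrow> real) set" where
  "cyl C = {y \<in> space bernoulli. bits y \<in> C}"

lemma sets_cyl:
  assumes "finite F" "local_on F (\<lambda>x. x \<in> C)"
  shows "cyl C \<in> sets bernoulli"
proof -
  have "(\<lambda>y. indicat_real C (bits y)) \<in> borel_measurable bernoulli"
    by (rule bits_local(1)[OF assms(1) local_on_indicator[OF assms(2)]])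
  hence "(\<lambda>y. indicat_real C (bits y)) -` {1} \<inter> space bernoulli \<in> sets bernoulli"
    by (rule measurable_sets) simp
  moreover have "(\<lambda>y. indicat_real C (bits y)) -` {1} \<inter> space bernoulli = cyl C"
    by (auto simp: cyl_def indicator_def)
  ultimately show ?thesis by simp
qed

text \<open>The sets with this property will be closed under complements and countable unions and
  contain \<open>{y. y h < c}\<close> for every coordinate, so every measurable set has it.\<close>

definition approximable :: "('g \<Rightarrow> real) set \<Rightarrow> bool" where
  "approximable A \<longleftrightarrow> A \<in> sets bernoulli \<and> (\<forall>\<epsilon>>0. \<exists>F C. finite F \<and> local_on F (\<lambda>x. x \<in> C) \<and>
     measure bernoulli ((A - cyl C) \<union> (cyl C - A)) < \<epsilon>)"

lemma approximable_empty: "approximable {}"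
  unfolding approximable_def
  by (auto intro!: exI[of _ "{}"] simp: local_on_def cyl_def)

lemma approximable_compl:
  assumes "approximable A"
  shows "approximable (space bernoulli - A)"
proof -
  have A: "A \<subseteq> space bernoulli" using assms sets.sets_into_space by (auto simp: approximable_def)
  have "(space bernoulli - A - cyl (- C)) \<union> (cyl (- C) - (space bernoulli - A)) = (A - cyl C) \<union> (cyl C - A)" for C
    using A by (auto simp: cyl_def)
  moreover have "local_on F (\<lambda>x. x \<in> - C)" if "local_on F (\<lambda>x. x \<in> C)" for F :: "('a \<times> nat) set" and C
    using that by (auto simp: local_on_def)
  ultimately show ?thesis
    using assms unfolding approximable_def by (metis sets.compl_sets)
qed

lemma approximable_Un:
  assumes "approximable A" "approximable B"
  shows "approximable (A \<union> B)"
  unfolding approximable_def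
proof (intro conjI allI impI)
  interpret prob_space "bernoulli :: ('a \<Rightarrow> real) measure" by (rule prob_space_bernoulli)
  show s: "A \<union> B \<in> sets bernoulli" using assms by (auto simp: approximable_def)
  fix \<epsilon> :: real assume "\<epsilon> > 0"
  hence "\<epsilon> / 2 > 0" by simp
  with assms obtain F1 C1 F2 C2 where
    1: "finite F1" "local_on F1 (\<lambda>x. x \<in> C1)" "measure bernoulli ((A - cyl C1) \<union> (cyl C1 - A)) < \<epsilon> / 2" and
    2: "finite F2" "local_on F2 (\<lambda>x. x \<in> C2)" "measure bernoulli ((B - cyl C2) \<union> (cyl C2 - B)) < \<epsilon> / 2"
    unfolding approximable_def by meson
  have loc: "local_on (F1 \<union> F2) (\<lambda>x. x \<in> C1 \<union> C2)"
    using local_on_mono[OF 1(2), of "F1 \<union> F2"] local_on_mono[OF 2(2), of "F1 \<union> F2"]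
    by (simp add: local_on_def)
  have meas: "A \<in> events" "B \<in> events" "cyl C1 \<in> events" "cyl C2 \<in> events"
    using assms sets_cyl[OF 1(1,2)] sets_cyl[OF 2(1,2)] by (auto simp: approximable_def)
  have "prob ((A \<union> B - cyl (C1 \<union> C2)) \<union> (cyl (C1 \<union> C2) - (A \<union> B)))
      \<le> prob (((A - cyl C1) \<union> (cyl C1 - A)) \<union> ((B - cyl C2) \<union> (cyl C2 - B)))"
    using meas by (intro finite_measure_mono) (auto simp: cyl_def)
  also have "\<dots> \<le> prob ((A - cyl C1) \<union> (cyl C1 - A)) + prob ((B - cyl C2) \<union> (cyl C2 - B))"
    using meas by (intro measure_subadditive) auto
  also have "\<dots> < \<epsilon>" using 1(3) 2(3) by simp
  finally show "\<exists>F C. finite F \<and> local_on F (\<lambda>x. x \<in> C) \<and>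
     prob ((A \<union> B - cyl C) \<union> (cyl C - (A \<union> B))) < \<epsilon>"
    using loc 1(1) 2(1) by (intro exI[of _ "F1 \<union> F2"] exI[of _ "C1 \<union> C2"]) simp
qed

lemma approximable_close:
  assumes "A \<in> sets bernoulli"
    and "\<And>\<epsilon>. \<epsilon> > 0 \<Longrightarrow> \<exists>B. approximable B \<and> measure bernoulli ((A - B) \<union> (B - A)) < \<epsilon>"
  shows "approximable A"
  unfolding approximable_def
proof (intro conjI allI impI assms(1))
  interpret prob_space "bernoulli :: ('a \<Rightarrow> real) measure" by (rule prob_space_bernoulli)
  fix \<epsilon> :: real assume "\<epsilon> > 0"
  hence "\<epsilon> / 2 > 0" by simp
  with assms(2) obtain B where B: "approximable B" "prob ((A - B) \<union> (B - A)) < \<epsilon> / 2" by blast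
  with \<open>\<epsilon> / 2 > 0\<close> obtain F C where
    C: "finite F" "local_on F (\<lambda>x. x \<in> C)" "prob ((B - cyl C) \<union> (cyl C - B)) < \<epsilon> / 2"
    unfolding approximable_def by meson
  have meas: "A \<in> events" "B \<in> events" "cyl C \<in> events"
    using assms(1) B(1) sets_cyl[OF C(1,2)] by (auto simp: approximable_def)
  have "prob ((A - cyl C) \<union> (cyl C - A)) \<le> prob (((A - B) \<union> (B - A)) \<union> ((B - cyl C) \<union> (cyl C - B)))"
    using meas by (intro finite_measure_mono) auto
  also have "\<dots> \<le> prob ((A - B) \<union> (B - A)) + prob ((B - cyl C) \<union> (cyl C - B))"
    using meas by (intro measure_subadditive) auto
  also have "\<dots> < \<epsilon>" using B(2) C(3) by simp
  finally show "\<exists>F C. finite F \<and> local_on F (\<lambda>x. x \<in> C) \<and> prob ((A - cyl C) \<union> (cyl C - A)) < \<epsilon>"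
    using C(1,2) by blast
qed

lemma approximable_UN:
  fixes A :: "nat \<Rightarrow> ('g \<Rightarrow> real) set"
  assumes "\<And>n. approximable (A n)"
  shows "approximable (\<Union>n. A n)"
proof (rule approximable_close)
  interpret prob_space "bernoulli :: ('g \<Rightarrow> real) measure" by (rule prob_space_bernoulli)
  have meas: "A n \<in> events" for n using assms by (auto simp: approximable_def)
  thus "(\<Union>n. A n) \<in> events" by auto
  define B where "B n = (\<Union>i<n. A i)" for n
  have B: "approximable (B n)" for n
  proof (induction n)
    case (Suc n)
    have "B (Suc n) = B n \<union> A n" by (auto simp: B_def less_Suc_eq)
    thus ?case using Suc assms approximable_Un by metis
  qed (simp add: B_def approximable_empty)
  hence Bm: "B n \<in> events" for n by (auto simp: approximable_def)
  have U: "(\<Union>n. B n) = (\<Union>n. A n)" by (auto simp: B_def)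
  have "(\<lambda>n. prob (B n)) \<longlonglongrightarrow> prob (\<Union>n. B n)"
    by (rule finite_Lim_measure_incseq) (auto simp: Bm, force simp: incseq_def B_def)
  fix \<epsilon> :: real assume "\<epsilon> > 0"
  then obtain n where n: "\<bar>prob (B n) - prob (\<Union>n. A n)\<bar> < \<epsilon>"
    using \<open>(\<lambda>n. prob (B n)) \<longlonglongrightarrow> prob (\<Union>n. B n)\<close> unfolding U
    by (metis LIMSEQ_iff order_refl real_norm_def)
  have sub: "B n \<subseteq> (\<Union>n. A n)" by (auto simp: B_def)
  hence "((\<Union>n. A n) - B n) \<union> (B n - (\<Union>n. A n)) = (\<Union>n. A n) - B n" by auto
  moreover have "prob ((\<Union>n. A n) - B n) = prob (\<Union>n. A n) - prob (B n)"
    using sub Bm meas by (intro finite_measure_Diff) auto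
  ultimately have "prob (((\<Union>n. A n) - B n) \<union> (B n - (\<Union>n. A n))) < \<epsilon>" using n by simp
  thus "\<exists>B. approximable B \<and> prob (((\<Union>n. A n) - B) \<union> (B - (\<Union>n. A n))) < \<epsilon>" using B by blast
qed

lemma measurable_coord: "(\<lambda>y. y h) \<in> borel_measurable bernoulli"
proof -
  have "(\<lambda>y. y h) \<in> measurable (bernoulli :: ('a \<Rightarrow> real) measure) (restrict_space lborel {0..1})"
    unfolding bernoulli_def by (rule measurable_component_singleton) simp
  thus ?thesis by (simp add: measurable_restrict_space2_iff)
qed

lemma measure_coord:
  assumes "B \<in> sets borel" "B \<subseteq> {0..1}"
  shows "measure bernoulli {y \<in> space bernoulli. y h \<in> B} = measure lborel B"
proof -
  let ?M = "\<lambda>_. restrict_space lborel {0..1::real}"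
  have B: "B \<in> sets (restrict_space lborel {0..1})"
    using assms by (subst sets_restrict_space_iff) auto
  have "{y \<in> space bernoulli. y h \<in> B} = prod_emb UNIV ?M {h} (Pi\<^sub>E {h} (\<lambda>_. B))"
    using assms(2) by (auto simp: space_bernoulli prod_emb_def space_restrict_space PiE_def Pi_def)
  hence "emeasure bernoulli {y \<in> space bernoulli. y h \<in> B} = (\<Prod>h\<in>{h}. emeasure (?M h) B)"
    unfolding bernoulli_def using B prob_space_unit by (simp only:) (intro emeasure_PiM_emb, auto)
  also have "\<dots> = emeasure lborel B" using assms by (simp add: emeasure_restrict_space)
  finally show ?thesis by (simp add: measure_def)
qed

lemma approximable_lessThan: "approximable {y \<in> space bernoulli. y h < c}"
proof (rule approximable_close)
  interpret prob_space "bernoulli :: ('a \<Rightarrow> real) measure" by (rule prob_space_bernoulli)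
  show "{y \<in> space bernoulli. y h < c} \<in> events"
    using measurable_coord[of h] by measurable
  fix \<epsilon> :: real assume "\<epsilon> > 0"
  then obtain k where k: "(1/2) ^ k < \<epsilon>" using real_arch_pow_inv[of \<epsilon> "1/2"] by auto
  define n where "n = \<lfloor>2 ^ k * c\<rfloor>"
  define F where "F = {h} \<times> {..<k}"
  \<comment> \<open>Asking for some real number with the given digits makes it evident that only the
    first \<open>k\<close> digits at \<open>h\<close> are read.\<close>
  define C where "C = {x. \<exists>t::real. 0 \<le> t \<and> t < 1 \<and> (\<forall>i<k. odd \<lfloor>2 ^ Suc i * t\<rfloor> = ((h, i) \<in> x)) \<and> \<lfloor>2 ^ k * t\<rfloor> < n}"
  have loc: "local_on F (\<lambda>x. x \<in> C)"
    unfolding local_on_def C_def F_def by auto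
  have bC: "bits y \<in> C \<longleftrightarrow> \<lfloor>2 ^ k * y h\<rfloor> < n" if "0 \<le> y h" "y h < 1" for y
  proof
    assume "bits y \<in> C"
    then obtain t :: real where t: "0 \<le> t" "t < 1" "\<forall>i<k. odd \<lfloor>2 ^ Suc i * t\<rfloor> = ((h, i) \<in> bits y)" "\<lfloor>2 ^ k * t\<rfloor> < n"
      by (auto simp: C_def)
    obtain j where "\<And>t::real. 0 \<le> t \<Longrightarrow> t < 1 \<Longrightarrow> (\<forall>i<k. odd \<lfloor>2 ^ Suc i * t\<rfloor> = ((h, i) \<in> bits y)) \<longleftrightarrow> \<lfloor>2 ^ k * t\<rfloor> = j"
      using dyadic_cell[of k "\<lambda>i. (h, i) \<in> bits y"] by blast
    moreover have "\<forall>i<k. odd \<lfloor>2 ^ Suc i * y h\<rfloor> = ((h, i) \<in> bits y)" by (simp add: bits_def)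
    ultimately have "\<lfloor>2 ^ k * t\<rfloor> = \<lfloor>2 ^ k * y h\<rfloor>" using t(1-3) that by metis
    thus "\<lfloor>2 ^ k * y h\<rfloor> < n" using t(4) by simp
  next
    assume "\<lfloor>2 ^ k * y h\<rfloor> < n"
    thus "bits y \<in> C" unfolding C_def using that by (auto simp: bits_def intro!: exI[of _ "y h"])
  qed
  let ?I = "{real_of_int n / 2 ^ k .. c} \<inter> {0..1}"
  have cyl: "cyl C \<in> events" by (rule sets_cyl[OF _ loc]) (simp add: F_def)
  have app: "approximable (cyl C)"
    unfolding approximable_def using cyl loc by (auto intro!: exI[of _ F] exI[of _ C] simp: F_def)
  \<comment> \<open>Rounding \<open>c\<close> down to \<open>n / 2 ^ k\<close> misplaces only points
    between the two, besides the endpoint 1.\<close>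
  have "({y \<in> space bernoulli. y h < c} - cyl C) \<union> (cyl C - {y \<in> space bernoulli. y h < c})
      \<subseteq> {y \<in> space bernoulli. y h \<in> ?I \<union> {1}}"
  proof
    fix y assume y: "y \<in> ({y \<in> space bernoulli. y h < c} - cyl C) \<union> (cyl C - {y \<in> space bernoulli. y h < c})"
    hence sp: "y \<in> space bernoulli" by (auto simp: cyl_def)
    hence y01: "0 \<le> y h" "y h \<le> 1" by (auto simp: space_bernoulli)
    show "y \<in> {y \<in> space bernoulli. y h \<in> ?I \<union> {1}}"
    proof (cases "y h = 1")
      case False
      hence lt: "y h < 1" using y01 by simp
      have b: "y \<in> cyl C \<longleftrightarrow> \<lfloor>2 ^ k * y h\<rfloor> < n" using bC[of y, OF y01(1) lt] sp by (simp add: cyl_def)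
      have n1: "real_of_int n \<le> 2 ^ k * c" unfolding n_def by linarith
      have "\<not> \<lfloor>2 ^ k * y h\<rfloor> < n \<and> y h < c"
      proof (rule ccontr)
        assume "\<not> ?thesis"
        hence "\<lfloor>2 ^ k * y h\<rfloor> < n" "c \<le> y h" using y sp b by auto
        hence "2 ^ k * c \<le> 2 ^ k * y h" by simp
        hence "n \<le> \<lfloor>2 ^ k * y h\<rfloor>" unfolding n_def by (rule floor_mono)
        thus False using \<open>\<lfloor>2 ^ k * y h\<rfloor> < n\<close> by simp
      qed
      hence "real_of_int n \<le> 2 ^ k * y h" "y h \<le> c" by linarith+
      thus ?thesis using sp y01 by (simp add: divide_le_eq mult.commute)
    qed (use sp in simp)
  qed
  hence "prob (({y \<in> space bernoulli. y h < c} - cyl C) \<union> (cyl C - {y \<in> space bernoulli. y h < c}))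
      \<le> prob {y \<in> space bernoulli. y h \<in> ?I \<union> {1}}"
    using measurable_coord[of h] by (intro finite_measure_mono) (auto, measurable)
  also have "\<dots> = measure lborel (?I \<union> {1})" by (rule measure_coord) auto
  also have "\<dots> \<le> measure lborel {real_of_int n / 2 ^ k .. c} + measure lborel {1::real}"
  proof (rule order.trans[OF measure_Un_le add_right_mono])
    show "measure lborel ?I \<le> measure lborel {real_of_int n / 2 ^ k .. c}"
      by (rule measure_mono_fmeasurable) (auto intro: fmeasurable_cbox[of "real_of_int n / 2 ^ k" c, simplified])
  qed auto
  also have "\<dots> \<le> (1/2) ^ k"
  proof -
    have "real_of_int n / 2 ^ k \<le> c"
      unfolding n_def by (simp add: divide_le_eq mult.commute)
    moreover have "c - real_of_int n / 2 ^ k \<le> (1/2) ^ k"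
    proof -
      have "2 ^ k * c \<le> real_of_int n + 1" unfolding n_def by linarith
      hence "c \<le> (real_of_int n + 1) / 2 ^ k" by (simp add: pos_le_divide_eq mult.commute)
      thus ?thesis by (simp add: add_divide_distrib power_one_over)
    qed
    ultimately show ?thesis by simp
  qed
  finally have "prob (({y \<in> space bernoulli. y h < c} - cyl C) \<union> (cyl C - {y \<in> space bernoulli. y h < c})) < \<epsilon>"
    using k by simp
  thus "\<exists>B. approximable B \<and> prob (({y \<in> space bernoulli. y h < c} - B) \<union> (B - {y \<in> space bernoulli. y h < c})) < \<epsilon>"
    using app by blast
qed

lemma approximable_coord:
  assumes "B \<in> sets (borel :: real measure)"
  shows "approximable {y \<in> space bernoulli. y h \<in> B}"
proof -
  have "sets (borel :: real measure) = sigma_sets UNIV (range lessThan)"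
    unfolding borel_Iio by (rule sets_measure_of) simp
  with assms have "B \<in> sigma_sets UNIV (range lessThan)" by (simp only:)
  thus ?thesis
  proof induction
    case (Basic a)
    thus ?case using approximable_lessThan by auto
  next
    case Empty
    show ?case using approximable_empty by simp
  next
    case (Compl a)
    have "{y \<in> space bernoulli. y h \<in> UNIV - a} = space bernoulli - {y \<in> space bernoulli. y h \<in> a}" by auto
    thus ?case using approximable_compl[OF Compl.IH] by simp
  next
    case (Union a)
    have "{y \<in> space bernoulli. y h \<in> (\<Union>i. a i)} = (\<Union>i. {y \<in> space bernoulli. y h \<in> a i})" by auto
    thus ?case using approximable_UN[OF Union.IH] by simp
  qed
qed

lemma approximable_sets:
  assumes "A \<in> sets bernoulli"
  shows "approximable A"
proof -
  let ?G = "{{f\<in>\<Pi>\<^sub>E i\<in>UNIV. space (restrict_space lborel {0..1::real}). f i \<in> B} | i B.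
      i \<in> UNIV \<and> B \<in> sets (restrict_space lborel {0..1::real})}"
  have sp: "(\<Pi>\<^sub>E i\<in>UNIV. space (restrict_space lborel {0..1::real})) = space (bernoulli :: ('a \<Rightarrow> real) measure)"
    by (simp add: bernoulli_def space_PiM)
  have "A \<in> sigma_sets (\<Pi>\<^sub>E i\<in>UNIV. space (restrict_space lborel {0..1::real})) ?G"
    using assms unfolding bernoulli_def sets_PiM_single .
  thus ?thesis
    unfolding sp
  proof induction
    case (Basic a)
    then obtain i B where a: "a = {f \<in> space bernoulli. f i \<in> B}" "B \<in> sets (restrict_space lborel {0..1::real})" by auto
    hence "B \<in> sets borel" by (subst (asm) sets_restrict_space_iff) auto
    thus ?case unfolding a by (rule approximable_coord)
  qed (auto intro: approximable_empty approximable_compl approximable_UN)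
qed

section \<open>Thinnings\<close>

lemma zero_mem_iota: "y \<in> U \<Longrightarrow> 0 \<in> iota U y"
  by (simp add: iota_def shift_inv_def)

lemma F_bern_integral:
  fixes U :: "('g::{group_add,countable} \<Rightarrow> real) set"
  assumes U: "U \<in> sets bernoulli" "measure bernoulli U > 0"
  shows "prob_space (F_bern U)"
    and "f \<in> borel_measurable Mo_borel \<Longrightarrow> (\<lambda>y. indicat_real U y * f (iota U y)) \<in> borel_measurable bernoulli"
    and "f \<in> borel_measurable Mo_borel \<Longrightarrow>
      (\<integral>E. f E \<partial>F_bern U) = (\<integral>y. indicat_real U y * f (iota U y) \<partial>bernoulli) / measure bernoulli U"
proof -
  interpret prob_space "bernoulli :: ('g \<Rightarrow> real) measure" by (rule prob_space_bernoulli)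
  let ?B = "bernoulli :: ('g \<Rightarrow> real) measure"
  define N where "N = restrict_space (uniform_measure ?B U) U"
  have Usp: "U \<subseteq> space ?B" using U(1) by (rule sets.sets_into_space)
  have spN: "space N = U" using Usp by (auto simp: N_def space_restrict_space)
  have setsN: "sets N = sets (restrict_space ?B U)"
    unfolding N_def by (rule sets_restrict_space_cong) simp
  have em0: "emeasure ?B U \<noteq> 0" using U(2) by (simp add: emeasure_eq_measure)
  have emtop: "emeasure ?B U \<noteq> \<infinity>" by simp
  have i_meas: "iota U \<in> measurable N Mo_borel"
  proof (rule measurable_Mo_borel)
    fix y assume "y \<in> space N"
    thus "iota U y \<in> Mo_space" by (simp add: spN Mo_space_def zero_mem_iota)
  next
    fix g
    have "{y \<in> space N. g \<in> iota U y} = U \<inter> (shift_inv g -` U \<inter> space ?B)"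
      using Usp by (auto simp: spN iota_def)
    moreover have "U \<inter> (shift_inv g -` U \<inter> space ?B) \<in> sets N"
      unfolding setsN using U(1) measurable_sets[OF measurable_shift_inv U(1), of g]
      by (subst sets_restrict_space_iff) auto
    ultimately show "{y \<in> space N. g \<in> iota U y} \<in> sets N" by simp
  qed
  have pN: "prob_space N"
  proof
    have "emeasure N (space N) = emeasure (uniform_measure ?B U) U"
      unfolding spN unfolding N_def using U(1) Usp by (intro emeasure_restrict_space) auto
    also have "\<dots> = 1" using U by (simp add: emeasure_uniform_measure emeasure_eq_measure divide_ennreal)
    finally show "emeasure N (space N) = 1" .
  qed
  have F: "F_bern U = distr N Mo_borel (iota U)" by (simp add: F_bern_def N_def)
  show "prob_space (F_bern U)" unfolding F by (rule prob_space.prob_space_distr[OF pN i_meas])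
  assume f: "f \<in> borel_measurable Mo_borel"
  have "(\<lambda>y. f (iota U y)) \<in> borel_measurable N" using measurable_comp[OF i_meas f] by (simp add: comp_def)
  hence "(\<lambda>y. f (iota U y)) \<in> borel_measurable (restrict_space ?B U)"
    by (simp add: measurable_cong_sets[OF setsN refl])
  thus m: "(\<lambda>y. indicat_real U y * f (iota U y)) \<in> borel_measurable ?B"
    using U(1) by (subst (asm) borel_measurable_restrict_space_iff) (auto simp: mult.commute)
  have un: "uniform_measure ?B U = density ?B (\<lambda>y. ennreal (indicat_real U y / prob U))"
    unfolding uniform_measure_def
  proof (intro arg_cong2[where f=density] refl ext)
    fix y
    show "indicator U y / emeasure ?B U = ennreal (indicat_real U y / prob U)"
      using U(2) by (auto simp: emeasure_eq_measure indicator_def divide_ennreal[symmetric])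
  qed
  have "(\<integral>E. f E \<partial>F_bern U) = (\<integral>y. f (iota U y) \<partial>N)"
    unfolding F by (rule integral_distr[OF i_meas f])
  also have "\<dots> = (\<integral>y. indicat_real U y *\<^sub>R f (iota U y) \<partial>uniform_measure ?B U)"
    unfolding N_def using U(1) Usp by (intro integral_restrict_space) auto
  also have "\<dots> = (\<integral>y. (indicat_real U y / prob U) *\<^sub>R (indicat_real U y *\<^sub>R f (iota U y)) \<partial>?B)"
    unfolding un using m U(1) by (intro integral_density) auto
  also have "\<dots> = (\<integral>y. (indicat_real U y * f (iota U y)) / prob U \<partial>?B)"
    by (intro Bochner_Integration.integral_cong refl) (auto simp: indicator_def)
  also have "\<dots> = (\<integral>y. indicat_real U y * f (iota U y) \<partial>?B) / prob U" by simp
  finally show "(\<integral>E. f E \<partial>F_bern U) = (\<integral>y. indicat_real U y * f (iota U y) \<partial>?B) / prob U" .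
qed

text \<open>Unless \<open>y\<close> or one of its translates by the window lies in the symmetric
  difference, the two integrands agree. By invariance all these exceptional sets have the same
  measure.\<close>

lemma cylinder_approximation:
  fixes U :: "('g::{group_add,countable} \<Rightarrow> real) set" and f :: "'g set \<Rightarrow> real" and d :: real
  assumes U: "U \<in> sets bernoulli" "measure bernoulli U > 0" and S: "finite S" "0 \<in> S"
    and C: "finite F" "local_on F (\<lambda>x. x \<in> C)"
    and d: "measure bernoulli ((U - cyl C) \<union> (cyl C - U)) \<le> d"
    and f: "local_on S f" "\<And>E. \<bar>f E\<bar> \<le> 1"
  shows "\<bar>avg (\<Union>s\<in>S. shift_pos s ` F) (\<lambda>x. indicat_real C x * f (occ C x)) {}
      - (\<integral>y. indicat_real U y * f (iota U y) \<partial>bernoulli)\<bar> \<le> (1 + 2 * real (card S)) * d"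
proof -
  interpret prob_space "bernoulli :: ('g \<Rightarrow> real) measure" by (rule prob_space_bernoulli)
  let ?B = "bernoulli :: ('g \<Rightarrow> real) measure"
  let ?J = "\<Union>s\<in>S. shift_pos s ` F"
  define \<Delta> where "\<Delta> = (U - cyl C) \<union> (cyl C - U)"
  define \<Delta>s where "\<Delta>s s = shift_inv s -` \<Delta> \<inter> space ?B" for s
  have Usp: "U \<subseteq> space ?B" using U(1) by (rule sets.sets_into_space)
  have Cs: "cyl C \<in> events" by (rule sets_cyl[OF C])
  have \<Delta>: "\<Delta> \<in> events" unfolding \<Delta>_def using U(1) Cs by auto
  have \<Delta>s: "\<Delta>s s \<in> events" "prob (\<Delta>s s) = prob \<Delta>" for s
    unfolding \<Delta>s_def using measurable_sets[OF measurable_shift_inv \<Delta>] measure_shift_inv[OF \<Delta>] by auto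
  let ?a = "\<lambda>y. indicat_real C (bits y) * f (occ C (bits y))" and ?b = "\<lambda>y. indicat_real U y * f (iota U y)"
  have loc: "local_on ?J (\<lambda>x. indicat_real C x * f (occ C x))"
    unfolding local_on_def
  proof
    fix x
    have "F \<subseteq> ?J" using S(2) by force
    hence "indicat_real C x = indicat_real C (x \<inter> ?J)"
      by (intro local_onD[OF local_on_mono[OF local_on_indicator[OF C(2)]], of ?J]) auto
    moreover have "f (occ C x) = f (occ C (x \<inter> ?J))"
      by (rule local_onD[OF local_on_occ[OF C(2) f(1)]]) auto
    ultimately show "indicat_real C x * f (occ C x) = indicat_real C (x \<inter> ?J) * f (occ C (x \<inter> ?J))" by simp
  qed
  have finJ: "finite ?J" using S(1) C(1) by auto
  have am: "?a \<in> borel_measurable ?B" by (rule bits_local(1)[OF finJ loc])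
  have bm: "?b \<in> borel_measurable ?B"
    by (rule F_bern_integral(2)[OF U borel_measurable_local[OF S(1) f(1)]])
  have abs: "\<bar>?a y\<bar> \<le> 1" "\<bar>?b y\<bar> \<le> 1" for y
    using f(2)[of "occ C (bits y)"] f(2)[of "iota U y"] by (auto simp: abs_mult indicator_def)
  have ai: "integrable ?B ?a" using am abs by (intro integrable_const_bound[where B=1]) auto
  have bi: "integrable ?B ?b" using bm abs by (intro integrable_const_bound[where B=1]) auto
  have fin: "emeasure ?B X < \<infinity>" for X
    by (metis emeasure_finite infinity_ennreal_def top.not_eq_extremum)
  let ?e = "\<lambda>y. indicat_real \<Delta> y + 2 * (\<Sum>s\<in>S. indicat_real (\<Delta>s s) y)"
  have ei: "integrable ?B ?e"
    by (intro Bochner_Integration.integrable_add integrable_mult_right Bochner_Integration.integrable_sum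
        integrable_real_indicator \<Delta> \<Delta>s fin)
  have pt: "\<bar>?a y - ?b y\<bar> \<le> ?e y" if y: "y \<in> space ?B" for y
  proof (cases "y \<in> \<Delta>")
    case True
    \<comment> \<open>One of the two indicators vanishes here, which gives 1 instead of 2.\<close>
    hence "\<bar>?a y - ?b y\<bar> \<le> 1"
      using y f(2)[of "occ C (bits y)"] f(2)[of "iota U y"] by (auto simp: \<Delta>_def cyl_def indicator_def)
    also have "\<dots> \<le> ?e y" using True by (simp add: sum_nonneg)
    finally show ?thesis .
  next
    case False
    hence CU: "bits y \<in> C \<longleftrightarrow> y \<in> U" using y by (auto simp: \<Delta>_def cyl_def)
    show ?thesis
    proof (cases "\<exists>s\<in>S. y \<in> \<Delta>s s")
      case True
      then obtain s where s: "s \<in> S" "y \<in> \<Delta>s s" by blast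
      have "\<bar>?a y - ?b y\<bar> \<le> 2" using abs[of y] by linarith
      also have "2 = 2 * indicat_real (\<Delta>s s) y" using s by simp
      also have "\<dots> \<le> 2 * (\<Sum>s\<in>S. indicat_real (\<Delta>s s) y)"
        using s(1) S(1) by (intro mult_left_mono member_le_sum[where f="\<lambda>s. indicat_real (\<Delta>s s) y"]) auto
      also have "\<dots> \<le> ?e y" by simp
      finally show ?thesis .
    next
      case no: False
      have "occ C (bits y) \<inter> S = iota U y \<inter> S"
      proof -
        have "s \<in> occ C (bits y) \<longleftrightarrow> s \<in> iota U y" if "s \<in> S" for s
        proof -
          have sp: "shift_inv s y \<in> space ?B" using measurable_space[OF measurable_shift_inv y] .
          have "shift_inv s y \<notin> \<Delta>" using no that y by (auto simp: \<Delta>s_def)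
          hence "bits (shift_inv s y) \<in> C \<longleftrightarrow> shift_inv s y \<in> U"
            using sp by (auto simp: \<Delta>_def cyl_def)
          thus ?thesis by (simp add: occ_def iota_def bits_shift_inv)
        qed
        thus ?thesis by blast
      qed
      hence "f (occ C (bits y)) = f (iota U y)" by (rule local_onD[OF f(1)])
      hence "?a y = ?b y" using CU by (simp add: indicator_def)
      thus ?thesis by (simp add: sum_nonneg)
    qed
  qed
  have "\<bar>avg ?J (\<lambda>x. indicat_real C x * f (occ C x)) {} - (\<integral>y. ?b y \<partial>?B)\<bar> = \<bar>\<integral>y. ?a y - ?b y \<partial>?B\<bar>"
    using bits_local(2)[OF finJ loc] ai bi by simp
  also have "\<dots> \<le> (\<integral>y. \<bar>?a y - ?b y\<bar> \<partial>?B)" by (rule integral_abs_bound)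
  also have "\<dots> \<le> (\<integral>y. ?e y \<partial>?B)"
    using ai bi ei pt by (intro integral_mono) auto
  also have "\<dots> = prob \<Delta> + 2 * (\<Sum>s\<in>S. prob (\<Delta>s s))"
  proof -
    have *: "integral\<^sup>L ?B (indicat_real X) = prob X" if "X \<in> events" for X
      using that sets.sets_into_space[OF that] by (simp add: Int_absorb2)
    have "(\<integral>y. ?e y \<partial>?B) = integral\<^sup>L ?B (indicat_real \<Delta>) + 2 * (\<Sum>s\<in>S. integral\<^sup>L ?B (indicat_real (\<Delta>s s)))"
      using \<Delta> \<Delta>s(1) fin
      by (subst Bochner_Integration.integral_add)
         (auto simp: Bochner_Integration.integral_sum intro!: integrable_real_indicator Bochner_Integration.integrable_sum)
    thus ?thesis using * \<Delta> \<Delta>s(1) by simp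
  qed
  also have "\<dots> = (1 + 2 * real (card S)) * prob \<Delta>" by (simp add: \<Delta>s(2) algebra_simps)
  also have "\<dots> \<le> (1 + 2 * real (card S)) * d" using d unfolding \<Delta>_def by (intro mult_left_mono) auto
  finally show ?thesis .
qed

text \<open>Since \<open>N / Z\<close> is at most 1 in absolute value, the error in the
  normalisation is not amplified.\<close>

lemma ratio_diff_le:
  fixes N Z B m :: real
  assumes "\<bar>N\<bar> \<le> Z" "Z > 0" "m > 0"
  shows "\<bar>N / Z - B / m\<bar> \<le> (\<bar>N - B\<bar> + \<bar>Z - m\<bar>) / m"
proof -
  have "N / Z - B / m = (N - B) / m + N / Z * ((m - Z) / m)"
    using assms by (simp add: field_simps)
  also have "\<bar>\<dots>\<bar> \<le> \<bar>(N - B) / m\<bar> + \<bar>N / Z * ((m - Z) / m)\<bar>" by (rule abs_triangle_ineq)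
  also have "\<bar>N / Z * ((m - Z) / m)\<bar> \<le> 1 * \<bar>(m - Z) / m\<bar>"
    unfolding abs_mult using assms by (intro mult_right_mono) (auto simp: abs_divide)
  finally show ?thesis using assms by (simp add: abs_minus_commute add_divide_distrib)
qed

text \<open>\<open>\<eta>\<close>, \<open>T\<close> and \<open>\<delta>\<close> are chosen in this
  order and before \<open>U\<close>, which makes \<open>\<delta>\<close> uniform. The cylinder set
  depends on \<open>U\<close> and approximates it relative to the measure of \<open>U\<close>, by
  which all errors are divided in the end.\<close>

lemma thinning_step:
  fixes S :: "'g::{group_add,countable} set" and \<epsilon> :: real
  assumes "finite S" "0 \<in> S" "0 < \<epsilon>" "\<epsilon> \<le> 1"
  shows "\<exists>\<delta>>0. \<forall>U\<in>sets bernoulli. 0 < measure bernoulli U \<longrightarrow> measure bernoulli U < \<delta> \<longrightarrow>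
    (\<exists>Q. unimodular Q \<and> (AE E in Q. finite E) \<and>
      (\<forall>f :: 'g set \<Rightarrow> real. local_on S f \<longrightarrow> (\<forall>E. \<bar>f E\<bar> \<le> 1) \<longrightarrow> \<bar>(\<integral>E. f E \<partial>Q) - (\<integral>E. f E \<partial>F_bern U)\<bar> \<le> \<epsilon>))"
proof -
  interpret prob_space "bernoulli :: ('g \<Rightarrow> real) measure" by (rule prob_space_bernoulli)
  define n where "n = real (card S)"
  have n: "n \<ge> 1" using assms(1,2) by (auto simp: n_def Suc_le_eq card_gt_0_iff)
  \<comment> \<open>\<open>err\<close> will contain \<open>6 * n * \<eta> * P\<close> with
    \<open>P \<le> 2 * \<mu>\<close> and enters twice, for \<open>f\<close> and for the
    normalisation: in total \<open>24 * n * \<eta>\<close>.\<close>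
  define \<eta> where "\<eta> = \<epsilon> / (100 * n)"
  have \<eta>: "\<eta> > 0" "24 * n * \<eta> \<le> \<epsilon> / 4" using n assms by (auto simp: \<eta>_def field_simps)
  define T where "T = 64 * (1 + 1 / \<eta>) / \<eta>"
  have T: "T > 0" "64 * (1 + 1 / \<eta>) / T = \<eta>"
  proof -
    have "64 * (1 + 1 / \<eta>) > 0" using \<eta> by (simp add: add_pos_pos)
    moreover have "a / (a / \<eta>) = \<eta>" "a / \<eta> > 0" if "a > 0" for a using that \<eta>(1) by simp_all
    ultimately show "T > 0" "64 * (1 + 1 / \<eta>) / T = \<eta>" unfolding T_def by blast+
  qed
  have quarter: "a * (\<epsilon> / (4 * a)) = \<epsilon> / 4" "\<epsilon> / (4 * a) > 0" if "a > 0" for a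
    using that assms(3) by simp_all
  \<comment> \<open>\<open>err\<close> will contain \<open>(1 + 2 * n) * exp T * P\<^sup>2\<close>
    with \<open>P\<^sup>2 \<le> 4 * \<delta> * \<mu>\<close>; entering twice, it leads to the factor
    8.\<close>
  define \<delta> where "\<delta> = \<epsilon> / (4 * (8 * (1 + 2 * n) * exp T))"
  have \<delta>: "\<delta> > 0" "8 * (1 + 2 * n) * exp T * \<delta> = \<epsilon> / 4"
    unfolding \<delta>_def using n by (intro quarter; simp)+
  \<comment> \<open>\<open>1 + 2 * n\<close> units pay for replacing \<open>U\<close> by the
    cylinder set, one more for the normalisation.\<close>
  define \<epsilon>1 where "\<epsilon>1 = \<epsilon> / (4 * (2 + 2 * n))"
  have \<epsilon>1: "\<epsilon>1 > 0" "(2 + 2 * n) * \<epsilon>1 = \<epsilon> / 4"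
    unfolding \<epsilon>1_def using n by (intro quarter; simp)+
  have \<epsilon>1': "\<epsilon>1 \<le> 1 / 4"
  proof -
    have "1 * \<epsilon>1 \<le> (2 + 2 * n) * \<epsilon>1" using n \<epsilon>1 by (intro mult_right_mono) auto
    thus ?thesis using \<epsilon>1(2) assms by simp
  qed
  show ?thesis
  proof (intro exI[of _ \<delta>] conjI \<delta>(1) ballI impI)
    fix U :: "('g \<Rightarrow> real) set"
    assume U: "U \<in> events" "prob U > 0" "prob U < \<delta>"
    define \<mu> where "\<mu> = prob U"
    have "\<epsilon>1 * \<mu> > 0" using \<epsilon>1 U by (simp add: \<mu>_def)
    with approximable_sets[OF U(1)] obtain F C where C: "finite F" "local_on F (\<lambda>x. x \<in> C)"
      "prob ((U - cyl C) \<union> (cyl C - U)) < \<epsilon>1 * \<mu>"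
      unfolding approximable_def by meson
    let ?J = "\<Union>s\<in>S. shift_pos s ` F"
    define P where "P = avg F (indicat_real C) {}"
    define err where "err = exp T * P\<^sup>2 + 2 * card S * (exp T * P\<^sup>2 + (2 * \<eta> + 64 * (1 + 1 / \<eta>) / T) * P)"
    obtain G m where G: "finite G" "\<forall>V. m V \<ge> 0" and N: "\<forall>f :: 'g set \<Rightarrow> real. local_on S f \<longrightarrow> (\<forall>E. \<bar>f E\<bar> \<le> 1) \<longrightarrow>
       \<bar>(\<Sum>V\<in>Pow G - {{}}. m V * (\<Sum>g\<in>V. f (translate_set g V))) - avg ?J (\<lambda>x. indicat_real C x * f (occ C x)) {}\<bar> \<le> err"
      using finite_model[OF C(1) assms(1,2) C(2) T(1) \<eta>(1)] unfolding err_def P_def by (elim exE conjE)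
    define I where "I f = (\<Sum>V\<in>Pow G - {{}}. m V * (\<Sum>g\<in>V. f (translate_set g V)))" for f :: "'g set \<Rightarrow> real"
    define A where "A f = avg ?J (\<lambda>x. indicat_real C x * f (occ C x)) {}" for f
    define B where "B f = (\<integral>y. indicat_real U y * f (iota U y) \<partial>bernoulli)" for f
    define Z where "Z = (\<Sum>V\<in>Pow G - {{}}. m V * card V)"
    have IA: "\<bar>I f - A f\<bar> \<le> err" if "local_on S f" "\<And>E. \<bar>f E\<bar> \<le> 1" for f
      unfolding I_def A_def using N[rule_format, OF that] .
    have AB: "\<bar>A f - B f\<bar> \<le> (1 + 2 * n) * (\<epsilon>1 * \<mu>)" if "local_on S f" "\<And>E. \<bar>f E\<bar> \<le> 1" for f
      unfolding A_def B_def n_def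
      by (rule cylinder_approximation[OF U(1,2) assms(1,2) C(1,2) less_imp_le[OF C(3)] that])
    \<comment> \<open>The constant function recovers the normalisations: \<open>Z\<close> for the
      model, \<open>P\<close> for the cylinder set, \<open>\<mu>\<close> for
      \<open>U\<close>.\<close>
    have one: "local_on S (\<lambda>_. 1::real)" by (simp add: local_on_def)
    have I1: "I (\<lambda>_. 1) = Z" by (simp add: I_def Z_def)
    have B1: "B (\<lambda>_. 1) = \<mu>"
      using U(1) sets.sets_into_space[OF U(1)] by (simp add: B_def \<mu>_def Int_absorb2)
    have PA: "A (\<lambda>_. 1) = P"
    proof -
      have "F \<subseteq> ?J" using assms(2) by force
      moreover have "finite ?J" using C(1) assms(1) by auto
      ultimately show ?thesis
        using avg_local[OF _ local_on_indicator[OF C(2)], of ?J "{}"] by (simp add: A_def P_def Int_absorb1)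
    qed
    have P0: "P \<ge> 0" unfolding P_def by (rule avg_nonneg) simp
    have P\<mu>: "\<bar>P - \<mu>\<bar> \<le> \<mu>"
    proof -
      have "\<bar>P - \<mu>\<bar> \<le> (1 + 2 * n) * (\<epsilon>1 * \<mu>)" using AB[OF one] by (simp add: PA B1)
      also have "\<dots> = ((1 + 2 * n) * \<epsilon>1) * \<mu>" by simp
      also have "\<dots> \<le> ((2 + 2 * n) * \<epsilon>1) * \<mu>" using \<epsilon>1 U by (intro mult_right_mono) (auto simp: \<mu>_def)
      also have "\<dots> \<le> 1 * \<mu>" unfolding \<epsilon>1(2) using assms U by (intro mult_right_mono) (auto simp: \<mu>_def)
      finally show ?thesis by simp
    qed
    hence P2: "P \<le> 2 * \<mu>" by linarith
    have err: "2 * err \<le> \<epsilon> / 2 * \<mu>"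
    proof -
      have "P\<^sup>2 \<le> (2 * \<mu>)\<^sup>2" using P0 P2 by (intro power_mono)
      also have "\<dots> = 4 * \<mu> * \<mu>" by (simp add: power2_eq_square)
      also have "\<dots> \<le> 4 * \<delta> * \<mu>" using U by (intro mult_right_mono) (auto simp: \<mu>_def)
      finally have PP: "P\<^sup>2 \<le> 4 * \<delta> * \<mu>" .
      have "err = (1 + 2 * n) * exp T * P\<^sup>2 + 6 * n * \<eta> * P"
        unfolding err_def T(2) n_def by (simp add: algebra_simps)
      also have "\<dots> \<le> (1 + 2 * n) * exp T * (4 * \<delta> * \<mu>) + 6 * n * \<eta> * (2 * \<mu>)"
        using PP P2 n \<eta>(1) by (intro add_mono mult_left_mono) auto
      finally have "2 * err \<le> (8 * (1 + 2 * n) * exp T * \<delta>) * \<mu> + (24 * n * \<eta>) * \<mu>"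
        by (simp add: algebra_simps)
      also have "\<dots> \<le> \<epsilon> / 4 * \<mu> + \<epsilon> / 4 * \<mu>"
        unfolding \<delta>(2) using \<eta>(2) U by (intro add_mono mult_right_mono) (auto simp: \<mu>_def)
      finally show ?thesis by simp
    qed
    have \<mu>: "\<mu> > 0" using U by (simp add: \<mu>_def)
    have eps\<mu>: "\<epsilon> * \<mu> \<le> \<mu>" using assms \<mu> by simp
    have q: "(1 + 2 * n) * (\<epsilon>1 * \<mu>) + \<epsilon>1 * \<mu> = \<epsilon> / 4 * \<mu>"
    proof -
      have "(1 + 2 * n) * (\<epsilon>1 * \<mu>) + \<epsilon>1 * \<mu> = ((2 + 2 * n) * \<epsilon>1) * \<mu>" by (simp add: algebra_simps)
      thus ?thesis unfolding \<epsilon>1(2) .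
    qed
    \<comment> \<open>Comparing the measures directly saves the factor \<open>1 + 2 * n\<close> and
      fits the one unit reserved in \<open>\<epsilon>1\<close>.\<close>
    have PU: "\<bar>P - \<mu>\<bar> \<le> \<epsilon>1 * \<mu>"
    proof -
      have Cs: "cyl C \<in> events" by (rule sets_cyl[OF C(1,2)])
      have "P = prob (cyl C)"
      proof -
        have "P = (\<integral>y. indicat_real C (bits y) \<partial>bernoulli)"
          unfolding P_def using bits_local(2)[OF C(1) local_on_indicator[OF C(2)]] by simp
        also have "\<dots> = (\<integral>y. indicat_real (cyl C) y \<partial>bernoulli)"
          by (intro Bochner_Integration.integral_cong refl) (auto simp: cyl_def indicator_def)
        finally show ?thesis using sets.sets_into_space[OF Cs] by (simp add: Int_absorb2)
      qed
      moreover have "prob (cyl C) \<le> prob (U \<union> ((U - cyl C) \<union> (cyl C - U)))"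
        using U(1) Cs by (intro finite_measure_mono) auto
      moreover have "prob U \<le> prob (cyl C \<union> ((U - cyl C) \<union> (cyl C - U)))"
        using U(1) Cs by (intro finite_measure_mono) auto
      moreover have "prob (U \<union> ((U - cyl C) \<union> (cyl C - U))) \<le> prob U + prob ((U - cyl C) \<union> (cyl C - U))"
        using U(1) Cs by (intro measure_subadditive) auto
      moreover have "prob (cyl C \<union> ((U - cyl C) \<union> (cyl C - U))) \<le> prob (cyl C) + prob ((U - cyl C) \<union> (cyl C - U))"
        using U(1) Cs by (intro measure_subadditive) auto
      ultimately show ?thesis using C(3) unfolding \<mu>_def by linarith
    qed
    have Z\<mu>: "\<bar>Z - \<mu>\<bar> \<le> err + \<epsilon>1 * \<mu>"
      using IA[OF one] PU by (simp add: I1 PA)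
    \<comment> \<open>\<open>err\<close> and \<open>\<epsilon>1 * \<mu>\<close> are each at most
      \<open>\<mu> / 4\<close>.\<close>
    have Z: "Z > 0"
    proof -
      have "\<epsilon>1 * \<mu> \<le> 1 / 4 * \<mu>" using \<epsilon>1' \<mu> by (intro mult_right_mono) auto
      thus ?thesis using Z\<mu> err eps\<mu> \<mu> by linarith
    qed
    obtain Q where Q: "unimodular Q" "AE E in Q. finite E"
      "\<And>f::'g set \<Rightarrow> real. f \<in> borel_measurable Mo_borel \<Longrightarrow> (\<integral>E. f E \<partial>Q) = I f / Z"
      using unimodular_of_weights[OF G(1) spec[OF G(2)] Z[unfolded Z_def]] unfolding I_def Z_def by (elim exE conjE) blast
    show "\<exists>Q. unimodular Q \<and> (AE E in Q. finite E) \<and>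
      (\<forall>f :: 'g set \<Rightarrow> real. local_on S f \<longrightarrow> (\<forall>E. \<bar>f E\<bar> \<le> 1) \<longrightarrow> \<bar>(\<integral>E. f E \<partial>Q) - (\<integral>E. f E \<partial>F_bern U)\<bar> \<le> \<epsilon>)"
    proof (intro exI[of _ Q] conjI Q(1,2) allI impI)
      fix f :: "'g set \<Rightarrow> real" assume f: "local_on S f" "\<forall>E. \<bar>f E\<bar> \<le> 1"
      have fm: "f \<in> borel_measurable Mo_borel" by (rule borel_measurable_local[OF assms(1) f(1)])
      have IZ: "\<bar>I f\<bar> \<le> Z"
      proof -
        have "\<bar>I f\<bar> \<le> (\<Sum>V\<in>Pow G - {{}}. \<bar>m V * (\<Sum>g\<in>V. f (translate_set g V))\<bar>)"
          unfolding I_def by (rule sum_abs)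
        also have "\<dots> \<le> Z"
          unfolding Z_def
        proof (intro sum_mono)
          fix V
          have "\<bar>\<Sum>g\<in>V. f (translate_set g V)\<bar> \<le> (\<Sum>g\<in>V. \<bar>f (translate_set g V)\<bar>)" by (rule sum_abs)
          also have "\<dots> \<le> (\<Sum>g\<in>V. 1)" using f(2) by (intro sum_mono) simp
          finally show "\<bar>m V * (\<Sum>g\<in>V. f (translate_set g V))\<bar> \<le> m V * card V"
            using G(2) by (simp add: abs_mult mult_left_mono)
        qed
        finally show ?thesis .
      qed
      have "\<bar>(\<integral>E. f E \<partial>Q) - (\<integral>E. f E \<partial>F_bern U)\<bar> = \<bar>I f / Z - B f / \<mu>\<bar>"
        using Q(3)[OF fm] F_bern_integral(3)[OF U(1,2) fm] by (simp add: B_def \<mu>_def)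
      also have "\<dots> \<le> (\<bar>I f - B f\<bar> + \<bar>Z - \<mu>\<bar>) / \<mu>"
        by (rule ratio_diff_le[OF IZ Z \<mu>])
      also have "\<dots> \<le> (\<epsilon> * \<mu>) / \<mu>"
      proof (rule divide_right_mono)
        have "\<bar>I f - B f\<bar> \<le> err + (1 + 2 * n) * (\<epsilon>1 * \<mu>)"
          using IA[of f] AB[of f] f by fastforce
        hence "\<bar>I f - B f\<bar> + \<bar>Z - \<mu>\<bar> \<le> 2 * err + ((1 + 2 * n) * (\<epsilon>1 * \<mu>) + \<epsilon>1 * \<mu>)"
          using Z\<mu> by linarith
        also have "\<dots> \<le> \<epsilon> / 2 * \<mu> + \<epsilon> / 4 * \<mu>" unfolding q using err by simp
        also have "\<dots> \<le> \<epsilon> * \<mu>" using assms \<mu> by simp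
        finally show "\<bar>I f - B f\<bar> + \<bar>Z - \<mu>\<bar> \<le> \<epsilon> * \<mu>" .
      qed (use \<mu> in simp)
      also have "\<dots> = \<epsilon>" using \<mu> by simp
      finally show "\<bar>(\<integral>E. f E \<partial>Q) - (\<integral>E. f E \<partial>F_bern U)\<bar> \<le> \<epsilon>" .
    qed
  qed
qed

lemma integral_window_diff_le:
  fixes f h :: "'g::group_add set \<Rightarrow> real"
  assumes "prob_space Q" "sets Q = sets Mo_borel"
    and "f \<in> borel_measurable Mo_borel" "h \<in> borel_measurable Mo_borel"
    and "\<And>E. E \<in> Mo_space \<Longrightarrow> \<bar>f E\<bar> \<le> K" "\<And>E. E \<in> Mo_space \<Longrightarrow> \<bar>f E - h E\<bar> \<le> e"
  shows "\<bar>(\<integral>E. f E \<partial>Q) - (\<integral>E. h E \<partial>Q)\<bar> \<le> e"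
proof -
  interpret prob_space Q by (rule assms(1))
  have sp: "space Q = Mo_space" using sets_eq_imp_space_eq[OF assms(2)] by simp
  have m: "f \<in> borel_measurable Q" "h \<in> borel_measurable Q"
    using assms(3,4) by (simp_all add: measurable_cong_sets[OF assms(2) refl])
  have fi: "integrable Q f"
    using m assms(5) by (intro integrable_const_bound[where B=K]) (auto simp: sp)
  have "\<bar>h E\<bar> \<le> K + e" if "E \<in> Mo_space" for E using assms(5,6)[OF that] by linarith
  hence hi: "integrable Q h"
    using m by (intro integrable_const_bound[where B="K + e"]) (auto simp: sp)
  have "\<bar>(\<integral>E. f E \<partial>Q) - (\<integral>E. h E \<partial>Q)\<bar> = \<bar>\<integral>E. f E - h E \<partial>Q\<bar>" using fi hi by simp
  also have "\<dots> \<le> (\<integral>E. \<bar>f E - h E\<bar> \<partial>Q)" by (rule integral_abs_bound)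
  also have "\<dots> \<le> (\<integral>E. e \<partial>Q)" using fi hi assms(6) by (intro integral_mono) (auto simp: sp)
  finally show ?thesis by (simp add: prob_space)
qed

theorem theorem1p5:
  fixes \<nu> :: "'g::{group_add,countable} set measure"
  assumes "fiid_thinning \<nu>"
  shows "\<exists>\<mu>s :: nat \<Rightarrow> 'g set measure.
           (\<forall>n. unimodular (\<mu>s n) \<and> (AE E in \<mu>s n. finite E))
           \<and> weak_star_lim \<mu>s \<nu>"
proof -
  obtain U :: "nat \<Rightarrow> ('g \<Rightarrow> real) set" where U: "\<And>n. U n \<in> sets bernoulli" "\<And>n. emeasure bernoulli (U n) > 0"
    and lim0: "(\<lambda>n. measure bernoulli (U n)) \<longlonglongrightarrow> 0" and lim: "weak_star_lim (\<lambda>n. F_bern (U n)) \<nu>"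
    using assms unfolding fiid_thinning_def by blast
  interpret B: prob_space "bernoulli :: ('g \<Rightarrow> real) measure" by (rule prob_space_bernoulli)
  have Upos: "measure bernoulli (U n) > 0" for n
    using U(2)[of n] by (simp add: B.emeasure_eq_measure)
  define S :: "nat \<Rightarrow> 'g set" where "S k = insert 0 {g. to_nat g < k}" for k
  have finS: "finite (S k)" for k
  proof -
    have "finite (to_nat -` {..<k} :: 'g set)" by (rule finite_vimageI) auto
    thus ?thesis by (simp add: S_def vimage_def)
  qed
  \<comment> \<open>Diagonal choice: the \<open>k\<close>-th model is good on the
    \<open>k\<close>-th window to precision \<open>1 / (k + 1)\<close>, and \<open>r \<ge> k\<close>
    ensures that the sets compared with it still converge to the thinning.\<close>
  have "\<exists>r Q. r \<ge> k \<and> unimodular Q \<and> (AE E in Q. finite E) \<and>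
      (\<forall>f :: 'g set \<Rightarrow> real. local_on (S k) f \<longrightarrow> (\<forall>E. \<bar>f E\<bar> \<le> 1) \<longrightarrow>
         \<bar>(\<integral>E. f E \<partial>Q) - (\<integral>E. f E \<partial>F_bern (U r))\<bar> \<le> inverse (real (Suc k)))" for k
  proof -
    have "0 < inverse (real (Suc k))" "inverse (real (Suc k)) \<le> 1" by (auto simp: inverse_le_1_iff)
    then obtain \<delta> where \<delta>: "\<delta> > 0" "\<And>U. U \<in> sets bernoulli \<Longrightarrow> 0 < measure bernoulli U \<Longrightarrow> measure bernoulli U < \<delta> \<Longrightarrow>
      (\<exists>Q. unimodular Q \<and> (AE E in Q. finite E) \<and>
      (\<forall>f :: 'g set \<Rightarrow> real. local_on (S k) f \<longrightarrow> (\<forall>E. \<bar>f E\<bar> \<le> 1) \<longrightarrow>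
        \<bar>(\<integral>E. f E \<partial>Q) - (\<integral>E. f E \<partial>F_bern U)\<bar> \<le> inverse (real (Suc k))))"
      using thinning_step[OF finS[of k], of "inverse (real (Suc k))"] by (auto simp: S_def)
    obtain n where n: "\<forall>i\<ge>n. measure bernoulli (U i) < \<delta>"
      using order_tendstoD(2)[OF lim0 \<delta>(1)] unfolding eventually_sequentially by blast
    have "measure bernoulli (U (max n k)) < \<delta>" "max n k \<ge> k" using n by auto
    thus ?thesis using \<delta>(2)[OF U(1) Upos] by blast
  qed
  then obtain r Q where r: "\<And>k. r k \<ge> k" and Q: "\<And>k. unimodular (Q k)" "\<And>k. AE E in Q k. finite E"
    and close: "\<And>k (f :: 'g set \<Rightarrow> real). local_on (S k) f \<Longrightarrow> (\<And>E. \<bar>f E\<bar> \<le> 1) \<Longrightarrow>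
         \<bar>(\<integral>E. f E \<partial>Q k) - (\<integral>E. f E \<partial>F_bern (U (r k)))\<bar> \<le> inverse (real (Suc k))"
    by metis
  have "weak_star_lim Q \<nu>"
    unfolding weak_star_lim_def
  proof (intro allI impI, elim conjE)
    fix f :: "'g set \<Rightarrow> real"
    assume f: "continuous_map Mo_top euclideanreal f" and bdd: "bounded (f ` Mo_space)"
    obtain K where K: "K > 0" "\<And>E. E \<in> Mo_space \<Longrightarrow> \<bar>f E\<bar> \<le> K"
      using bdd unfolding bounded_pos by auto
    have fm: "f \<in> borel_measurable Mo_borel" by (rule borel_measurable_continuous_Mo[OF f])
    have rlim: "filterlim r at_top sequentially"
      by (rule filterlim_at_top_mono[OF filterlim_ident]) (simp add: r)
    have "(\<lambda>n. \<integral>E. f E \<partial>F_bern (U n)) \<longlonglongrightarrow> (\<integral>E. f E \<partial>\<nu>)"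
      using lim f bdd unfolding weak_star_lim_def by blast
    hence limF: "(\<lambda>k. \<integral>E. f E \<partial>F_bern (U (r k))) \<longlonglongrightarrow> (\<integral>E. f E \<partial>\<nu>)"
      by (rule filterlim_compose[OF _ rlim])
    have "(\<lambda>k. (\<integral>E. f E \<partial>Q k) - (\<integral>E. f E \<partial>F_bern (U (r k)))) \<longlonglongrightarrow> 0"
    proof (rule LIMSEQ_I)
      fix e :: real assume "e > 0"
      hence "e / 4 > 0" by simp
      from continuous_Mo_uniform_window[OF f this] obtain W where W: "finite W"
        "\<forall>E\<in>Mo_space. \<forall>E'\<in>Mo_space. E \<inter> W = E' \<inter> W \<longrightarrow> \<bar>f E - f E'\<bar> < e / 4"
        by (elim exE conjE)
      obtain k0 where k0: "\<forall>j\<in>to_nat ` W. j < k0"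
        using finite_nat_set_iff_bounded[THEN iffD1, OF finite_imageI[OF W(1), of to_nat]] by (elim exE)
      obtain k1 where k1: "K * inverse (real (Suc k)) < e / 4" if "k \<ge> k1" for k
      proof -
        have "(\<lambda>k. K * inverse (real (Suc k))) \<longlonglongrightarrow> K * 0"
          by (rule tendsto_mult_left[OF LIMSEQ_inverse_real_of_nat])
        hence "eventually (\<lambda>k. K * inverse (real (Suc k)) < e / 4) sequentially"
          by (rule order_tendstoD(2)) (use \<open>e > 0\<close> in simp)
        then obtain N where N: "\<forall>k\<ge>N. K * inverse (real (Suc k)) < e / 4"
          unfolding eventually_sequentially by (elim exE)
        show ?thesis by (rule that[of N]) (use N in simp)
      qed
      show "\<exists>no. \<forall>k\<ge>no. norm ((\<integral>E. f E \<partial>Q k) - (\<integral>E. f E \<partial>F_bern (U (r k))) - 0) < e"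
      proof (intro exI[of _ "max k0 k1"] allI impI)
        fix k assume k: "k \<ge> max k0 k1"
        \<comment> \<open>Inserting 0 keeps the truncated set in \<open>Mo_space\<close>, where
          \<open>K\<close> bounds \<open>f\<close>; division by \<open>K\<close> gives the bound 1
          required in \<open>close\<close>. The choice of \<open>k1\<close> absorbs the factor
          \<open>K\<close>.\<close>
        define h where "h E = f (insert 0 (E \<inter> S k)) / K" for E
        have WS: "W \<subseteq> S k" using k0 k by (force simp: S_def)
        have Mo: "insert 0 (E \<inter> S k) \<in> Mo_space" for E by (simp add: Mo_space_def)
        have hloc: "local_on (S k) h" by (simp add: local_on_def h_def)
        have hle: "\<bar>h E\<bar> \<le> 1" for E using K(1) K(2)[OF Mo] by (simp add: h_def)
        have hm: "(\<lambda>E. K * h E) \<in> borel_measurable Mo_borel"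
          using borel_measurable_local[OF finS hloc] by simp
        have hf: "\<bar>f E - K * h E\<bar> \<le> e / 4" if "E \<in> Mo_space" for E
        proof -
          have "E \<inter> W = insert 0 (E \<inter> S k) \<inter> W" using WS that by (auto simp: Mo_space_def)
          thus ?thesis using W(2) that Mo K(1) by (simp add: h_def less_imp_le)
        qed
        have pF: "prob_space (F_bern (U (r k)))" by (rule F_bern_integral(1)[OF U(1) Upos])
        have pQ: "prob_space (Q k)" and sQ: "sets (Q k) = sets Mo_borel"
          using Q(1)[of k] by (auto simp: unimodular_def random_rooted_subset_def)
        have 1: "\<bar>(\<integral>E. f E \<partial>Q k) - (\<integral>E. K * h E \<partial>Q k)\<bar> \<le> e / 4"
          by (rule integral_window_diff_le[OF pQ sQ fm hm K(2) hf])
        have 2: "\<bar>(\<integral>E. f E \<partial>F_bern (U (r k))) - (\<integral>E. K * h E \<partial>F_bern (U (r k)))\<bar> \<le> e / 4"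
          by (rule integral_window_diff_le[OF pF _ fm hm K(2) hf]) (simp add: F_bern_def)
        have "\<bar>(\<integral>E. K * h E \<partial>Q k) - (\<integral>E. K * h E \<partial>F_bern (U (r k)))\<bar>
            = K * \<bar>(\<integral>E. h E \<partial>Q k) - (\<integral>E. h E \<partial>F_bern (U (r k)))\<bar>"
          using K(1) by (simp add: abs_mult flip: right_diff_distrib)
        also have "\<dots> \<le> K * inverse (real (Suc k))"
          using K(1) close[OF hloc hle] by (intro mult_left_mono) auto
        also have "\<dots> < e / 4" using k by (intro k1) simp
        finally show "norm ((\<integral>E. f E \<partial>Q k) - (\<integral>E. f E \<partial>F_bern (U (r k))) - 0) < e"
          using 1 2 \<open>e > 0\<close> unfolding real_norm_def by linarith
      qed
    qed
    from tendsto_add[OF this limF] show "(\<lambda>k. \<integral>E. f E \<partial>Q k) \<longlonglongrightarrow> (\<integral>E. f E \<partial>\<nu>)" by simp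
  qed
  thus ?thesis using Q by blast
qed

end
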